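(* Let $D=(V,A)$ and $D'=(V,A')$ be two digraphs on the same vertex set. If $D$ and $D'$ are $P^4C$-isomorphic, then $D$ is perfect if and only if $D'$ is perfect.
   Context: Digraphs are finite, without loops and without parallel arcs: $D=(V,A)$ with $A$ a set of ordered pairs of distinct vertices (antiparallel arcs $(v,w),(w,v)$ are allowed). The symmetric part $S(D)$ of $D=(V,A)$ is the digraph $(V,A_2)$, where $A_2$ is the union of all pairs of antiparallel arcs of $D$; it is identified with the undirected graph having an edge $vw$ for each antiparallel pair $(v,w),(w,v)$. A proper $k$-coloring of $D$ is a map $c:V\to\{1,\ldots,k\}$ such that for all $1\le i\le k$ the subdigraph of $D$ induced by $c^{-1}(\{i\})$ is acyclic (contains no directed cycle; a pair of antiparallel arcs counts as a directed cycle of length 2). The dichromatic number $\chi(D)$ is the smallest nonnegative integer $k$ such that $D$ admits a proper $k$-coloring. A clique in $D$ is a subdigraph in which for any two distinct vertices $v,w$ both arcs $(v,w)$ and $(w,v)$ exist; the clique number $\omega(D)$ is the size of the largest clique. $D$ is perfect if $\chi(H)=\omega(H)$ for every induced subdigraph $H$ of $D$. A set of vertices induces a digraph (or graph) $F$ if the subdigraph (subgraph) induced by that set is isomorphic to $F$. $P_4$ is the (undirected) chordless path on four vertices. $\vec{C_3}$ is the directed 3-cycle, with exactly the arcs $(a,b),(b,c),(c,a)$. $\vec{P_3}$ with midpoint $b$ is the digraph on three vertices $a,b,c$ with exactly the arcs $(a,b),(b,c)$. $\vec{P}_3^+$ and $\vec{P}_3^-$ with midpoint $b$ are the two digraphs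 obtained from $\vec{P_3}$ by replacing exactly one of its two arcs by a pair of antiparallel arcs, i.e. the digraphs on $a,b,c$ with arc sets $\{(a,b),(b,a),(b,c)\}$ and $\{(a,b),(b,c),(c,b)\}$ (which of the two carries which name is irrelevant here). Two digraphs $D=(V,A)$ and $D'=(V,A')$ on the same vertex set are $P^4C$-isomorphic if and only if: (1) any set $\{a,b,c,d\}\subseteq V$ induces a $P_4$ in $S(D)$ if and only if it induces a $P_4$ in $S(D')$; (2) any set $\{a,b,c\}\subseteq V$ induces a $\vec{C_3}$ in $D$ if and only if it induces a $\vec{C_3}$ in $D'$; (3) any set $\{a,b,c\}\subseteq V$ induces a $\vec{P_3}$ with midpoint $b$ in $D$ if and only if it induces a $\vec{P_3}$ with midpoint $b$ in $D'$; (4) any set $\{a,b,c\}\subseteq V$ induces a $\vec{P}_3^+$ or a $\vec{P}_3^-$, in either case with midpoint $b$, in $D$ if and only if it induces one of them with midpoint $b$ in $D'$. *)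

theory Defs
  imports "Graph_Theory.Digraph_Isomorphism" "Graph_Theory.Pair_Digraph"
begin

(* Undirected graphs are identified with symmetric digraphs, an edge being a pair of
   antiparallel arcs. Finiteness, absence of loops and absence of parallel arcs are not built
   into the definitions below; they come from the locales digraph and pair_digraph. *)

definition symmetric_part :: "('a, 'b) pre_digraph \<Rightarrow> ('a, 'b) pre_digraph" where
  "symmetric_part G = G\<lparr>arcs := {e \<in> arcs G. head G e \<rightarrow>\<^bsub>G\<^esub> tail G e}\<rparr>"

(* In a loopfree digraph the shortest cycles in the sense of the library are pairs of
   antiparallel arcs. *)
definition proper_coloring :: "('a, 'b) pre_digraph \<Rightarrow> nat \<Rightarrow> ('a \<Rightarrow> nat) \<Rightarrow> bool" where
  "proper_coloring G k c \<longleftrightarrow>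
     (\<forall>v\<in>verts G. c v \<in> {1..k}) \<and>
     (\<forall>i\<in>{1..k}. \<nexists>p. pre_digraph.cycle (G \<restriction> {v \<in> verts G. c v = i}) p)"

definition dichromatic_number :: "('a, 'b) pre_digraph \<Rightarrow> nat" where
  "dichromatic_number G = (LEAST k. \<exists>c. proper_coloring G k c)"

definition clique :: "('a, 'b) pre_digraph \<Rightarrow> ('a, 'b) pre_digraph \<Rightarrow> bool" where
  "clique K G \<longleftrightarrow>
     subgraph K G \<and> (\<forall>v\<in>verts K. \<forall>w\<in>verts K. v \<noteq> w \<longrightarrow> v \<rightarrow>\<^bsub>K\<^esub> w \<and> w \<rightarrow>\<^bsub>K\<^esub> v)"

definition clique_number :: "('a, 'b) pre_digraph \<Rightarrow> nat" where
  "clique_number G = Max {card (verts K) | K. clique K G}"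

definition perfect :: "('a, 'b) pre_digraph \<Rightarrow> bool" where
  "perfect G \<longleftrightarrow> (\<forall>H. induced_subgraph H G \<longrightarrow> dichromatic_number H = clique_number H)"

definition induces :: "('a, 'b) pre_digraph \<Rightarrow> 'a set \<Rightarrow> ('c, 'd) pre_digraph \<Rightarrow> bool" where
  "induces G S F \<longleftrightarrow> S \<subseteq> verts G \<and> digraph_iso (G \<restriction> S) F"

(* The isomorphism onto F is required to send b to the vertex m of F. *)
definition induces_at ::
    "('a, 'b) pre_digraph \<Rightarrow> 'a set \<Rightarrow> 'a \<Rightarrow> ('c, 'd) pre_digraph \<Rightarrow> 'c \<Rightarrow> bool" where
  "induces_at G S b F m \<longleftrightarrow> S \<subseteq> verts G \<and> b \<in> S \<and>
     (\<exists>f. pre_digraph.digraph_isomorphism (G \<restriction> S) f \<and> F = app_iso f (G \<restriction> S) \<and> iso_verts f b = m)"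

definition P4 :: "nat pair_pre_digraph" where
  "P4 = \<lparr>pverts = {0, 1, 2, 3}, parcs = {(0, 1), (1, 0), (1, 2), (2, 1), (2, 3), (3, 2)}\<rparr>"

definition dir_C3 :: "nat pair_pre_digraph" where
  "dir_C3 = \<lparr>pverts = {0, 1, 2}, parcs = {(0, 1), (1, 2), (2, 0)}\<rparr>"

(* In each of the following three digraphs the midpoint is 1. *)

definition dir_P3 :: "nat pair_pre_digraph" where
  "dir_P3 = \<lparr>pverts = {0, 1, 2}, parcs = {(0, 1), (1, 2)}\<rparr>"

definition dir_P3_plus :: "nat pair_pre_digraph" where
  "dir_P3_plus = \<lparr>pverts = {0, 1, 2}, parcs = {(0, 1), (1, 0), (1, 2)}\<rparr>"

definition dir_P3_minus :: "nat pair_pre_digraph" where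
  "dir_P3_minus = \<lparr>pverts = {0, 1, 2}, parcs = {(0, 1), (1, 2), (2, 1)}\<rparr>"

definition induces_P3_pm_at :: "('a, 'b) pre_digraph \<Rightarrow> 'a set \<Rightarrow> 'a \<Rightarrow> bool" where
  "induces_P3_pm_at G S b \<longleftrightarrow>
     induces_at G S b (with_proj dir_P3_plus) 1 \<or> induces_at G S b (with_proj dir_P3_minus) 1"

(* Meant for digraphs with verts G = verts G'. *)
definition P4C_isomorphic :: "('a, 'b) pre_digraph \<Rightarrow> ('a, 'c) pre_digraph \<Rightarrow> bool" where
  "P4C_isomorphic G G' \<longleftrightarrow>
     (\<forall>a\<in>verts G. \<forall>b\<in>verts G. \<forall>c\<in>verts G. \<forall>d\<in>verts G.
        induces (symmetric_part G) {a, b, c, d} (with_proj P4) \<longleftrightarrow>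
        induces (symmetric_part G') {a, b, c, d} (with_proj P4)) \<and>
     (\<forall>a\<in>verts G. \<forall>b\<in>verts G. \<forall>c\<in>verts G.
        induces G {a, b, c} (with_proj dir_C3) \<longleftrightarrow>
        induces G' {a, b, c} (with_proj dir_C3)) \<and>
     (\<forall>a\<in>verts G. \<forall>b\<in>verts G. \<forall>c\<in>verts G.
        induces_at G {a, b, c} b (with_proj dir_P3) 1 \<longleftrightarrow>
        induces_at G' {a, b, c} b (with_proj dir_P3) 1) \<and>
     (\<forall>a\<in>verts G. \<forall>b\<in>verts G. \<forall>c\<in>verts G.
        induces_P3_pm_at G {a, b, c} b \<longleftrightarrow> induces_P3_pm_at G' {a, b, c} b)"

end

theory Submission
  imports Defs
begin

text \<open>A digraph is perfect iff its symmetric part is perfect and it has no induced directed cycle of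
  length at least 3: a colour class that is stable in the symmetric part and not acyclic contains
  such a cycle, and such a cycle has clique number 1 but is not 1-colourable. Around an induced
  directed cycle of \<open>D'\<close> of length at least 4, every two consecutive arcs form a \<open>P\<^sub>3\<close>; its midpoint
  being preserved, the cycle is a directed cycle in \<open>D\<close>, and the other conditions exclude chords.

  It remains to see that perfection of a graph depends on its P4-structure only (Reed). Let \<open>G\<close> be
  minimally imperfect and let \<open>H\<close> have the same P4-structure. Then \<open>G\<close> is prime and has no star
  cutset, which yields an induced cycle of length at least 5 in \<open>G\<close> or in its complement. The
  P4-structure of a cycle of length at least 7 determines it up to complementation, and the one of a
  pentagon forces a pentagon. Agreement of \<open>G\<close> and \<open>H\<close> on a prime set spreads to all vertices: the
  adjacencies of a further vertex to a prime set are determined by the P4-structure up to a few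
  exceptions, which either can be absorbed or lead to a star cutset. The same holds for a hexagon,
  except that \<open>H\<close> may induce a domino there, which needs a separate argument. So \<open>H\<close> is \<open>G\<close> or its
  complement, and is imperfect by the perfect graph theorem.\<close>

subsection \<open>Minimally imperfect graphs\<close>

text \<open>What shapes the argument is the list of exceptions. A vertex with two admissible
  neighbourhoods in a prime set is a copy of one vertex of the set, or sees all or nothing of it in
  either reading, or is flipped: the two neighbourhoods are disjoint cliques without edges between
  them and the rest of the set is stable, or this holds in the complement. Copies are absorbed in
  pairs, a copy of \<open>s\<close> together with a vertex that separates it from \<open>s\<close>.
  Flips pass to subsets, so it suffices that the starting set admits none. The cycles of length 7
  and 8 and the path on eight vertices, which serves for all longer cycles, admit none. The hexagon
  admits six, one for each ordered pair of opposite edges, and only there does a flipped vertex have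
  to be excluded by a star cutset. The pentagon cannot be a starting set: all its quadruples are
  P4s, so its P4-structure does not determine the cyclic order. But a pentagon is imperfect, so by
  minimality it is the whole graph.\<close>

definition ugraph :: "('a \<Rightarrow> 'a \<Rightarrow> bool) \<Rightarrow> bool" where
  "ugraph E \<longleftrightarrow> (\<forall>x y. E x y \<longrightarrow> E y x) \<and> (\<forall>x. \<not> E x x)"

definition co :: "('a \<Rightarrow> 'a \<Rightarrow> bool) \<Rightarrow> 'a \<Rightarrow> 'a \<Rightarrow> bool" where
  "co E x y \<longleftrightarrow> x \<noteq> y \<and> \<not> E x y"

definition clq :: "('a \<Rightarrow> 'a \<Rightarrow> bool) \<Rightarrow> 'a set \<Rightarrow> bool" where
  "clq E K \<longleftrightarrow> (\<forall>x\<in>K. \<forall>y\<in>K. x \<noteq> y \<longrightarrow> E x y)"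

definition stab :: "('a \<Rightarrow> 'a \<Rightarrow> bool) \<Rightarrow> 'a set \<Rightarrow> bool" where
  "stab E S \<longleftrightarrow> (\<forall>x\<in>S. \<forall>y\<in>S. \<not> E x y)"

definition omega :: "('a \<Rightarrow> 'a \<Rightarrow> bool) \<Rightarrow> 'a set \<Rightarrow> nat" where
  "omega E W = Max (card ` {K. K \<subseteq> W \<and> clq E K})"

definition colorable :: "('a \<Rightarrow> 'a \<Rightarrow> bool) \<Rightarrow> 'a set \<Rightarrow> nat \<Rightarrow> bool" where
  "colorable E W k \<longleftrightarrow>
     (\<exists>c::'a \<Rightarrow> nat. (\<forall>x\<in>W. c x < k) \<and> (\<forall>x\<in>W. \<forall>y\<in>W. E x y \<longrightarrow> c x \<noteq> c y))"

definition perf :: "('a \<Rightarrow> 'a \<Rightarrow> bool) \<Rightarrow> 'a set \<Rightarrow> bool" where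
  "perf E V \<longleftrightarrow> (\<forall>W\<subseteq>V. colorable E W (omega E W))"

lemma ugraph_co: "ugraph E \<Longrightarrow> ugraph (co E)"
  by (auto simp: ugraph_def co_def)

lemma co_co: "ugraph E \<Longrightarrow> co (co E) = E"
  by (auto simp: ugraph_def co_def fun_eq_iff)

lemma ugraphD: "ugraph E \<Longrightarrow> E x y \<longleftrightarrow> E y x" "ugraph E \<Longrightarrow> \<not> E x x"
  by (auto simp: ugraph_def)

lemma stab_iff_clq_co: "ugraph E \<Longrightarrow> stab E S \<longleftrightarrow> clq (co E) S"
  unfolding ugraph_def co_def stab_def clq_def by metis

lemma card_clq_le_omega:
  assumes "finite W" "K \<subseteq> W" "clq E K"
  shows "card K \<le> omega E W"
proof -
  have "finite {K. K \<subseteq> W \<and> clq E K}" using assms(1) by auto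
  then show ?thesis unfolding omega_def using assms by (intro Max_ge) auto
qed

lemma omega_witness:
  assumes "finite W"
  obtains K where "K \<subseteq> W" "clq E K" "card K = omega E W"
proof -
  have "finite {K. K \<subseteq> W \<and> clq E K}" "{} \<in> {K. K \<subseteq> W \<and> clq E K}"
    using assms by (auto simp: clq_def)
  then have "omega E W \<in> card ` {K. K \<subseteq> W \<and> clq E K}"
    unfolding omega_def by (intro Max_in) auto
  then show ?thesis using that by auto
qed

lemma omega_le_iff:
  assumes "finite W"
  shows "omega E W \<le> m \<longleftrightarrow> (\<forall>K\<subseteq>W. clq E K \<longrightarrow> card K \<le> m)"
  by (metis assms card_clq_le_omega le_trans omega_witness)

lemma omega_mono:
  assumes "finite W" "W' \<subseteq> W" shows "omega E W' \<le> omega E W"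
  by (metis assms card_clq_le_omega finite_subset omega_witness order_trans)

lemma colorable_mono: "colorable E W k \<Longrightarrow> k \<le> l \<Longrightarrow> colorable E W l"
  unfolding colorable_def by (meson order_less_le_trans)

lemma perf_mono: "perf E V \<Longrightarrow> W \<subseteq> V \<Longrightarrow> perf E W"
  unfolding perf_def by blast

section \<open>Weighted colourings and Lovasz's perfect graph theorem\<close>

lemma card_clq_Int_stab:
  assumes "clq E K" "stab E A" shows "card (K \<inter> A) \<le> 1"
proof -
  have "a = b" if "a \<in> K \<inter> A" "b \<in> K \<inter> A" for a b
    using assms that unfolding clq_def stab_def by blast
  then show ?thesis
    by (metis One_nat_def card_le_Suc0_iff_eq card.infinite zero_le_one)
qed

lemma sum_count_list_sets:
  assumes "finite K"
  shows "(\<Sum>x\<in>K. length (filter (\<lambda>A. x \<in> A) L)) = (\<Sum>A\<leftarrow>L. card (K \<inter> A))"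
proof (induction L)
  case (Cons A L)
  have "(\<Sum>x\<in>K. if x \<in> A then 1 else 0) = card (K \<inter> A)"
    using assms by (simp add: sum.If_cases)
  moreover have "(\<Sum>x\<in>K. length (filter (\<lambda>A. x \<in> A) (A # L))) =
    (\<Sum>x\<in>K. (if x \<in> A then 1 else 0) + length (filter (\<lambda>A. x \<in> A) L))"
    by (rule sum.cong) auto
  ultimately show ?case using Cons by (simp add: sum.distrib)
qed simp

lemma sum_list_clq_stab:
  assumes "clq E K" "\<forall>A\<in>set L. stab E A"
  shows "(\<Sum>A\<leftarrow>L. card (K \<inter> A)) \<le> length L"
  using assms(2)
proof (induction L)
  case (Cons A L)
  then show ?case using card_clq_Int_stab[OF assms(1), of A] by simp
qed simp

text \<open>This replaces the replication lemma: a vertex of weight \<open>w x\<close> stands for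
  \<open>w x\<close> pairwise adjacent copies, which need not be constructed. \<open>L\<close> is a
  list because a stable set may be used several times. Weights at most 1 amount to perfection of the
  support; otherwise a unit is removed from a vertex \<open>x\<close> of weight at least 2, and a
  class through \<open>x\<close> of the resulting colouring is split off.\<close>

theorem weighted_coloring:
  assumes "finite V" "perf E V" "ugraph E"
    and "\<forall>K\<subseteq>V. clq E K \<longrightarrow> sum w K \<le> m"
  shows "\<exists>L. length L = m \<and> (\<forall>A\<in>set L. A \<subseteq> V \<and> stab E A) \<and>
    (\<forall>x\<in>V. length (filter (\<lambda>A. x \<in> A) L) = w x)"
  using assms(4)
proof (induction "sum w V" arbitrary: w m rule: less_induct)
  case less
  show ?case
  proof (cases "\<forall>x\<in>V. w x \<le> 1")
    case True
    define W where "W = {x\<in>V. w x = 1}"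
    have fW: "finite W" "W \<subseteq> V" using assms(1) by (auto simp: W_def)
    have "omega E W \<le> m"
    proof -
      obtain K where K: "K \<subseteq> W" "clq E K" "card K = omega E W" using omega_witness fW by metis
      have "sum w K = card K" using K(1) by (simp add: W_def subset_iff)
      with K less.prems fW show ?thesis by (metis order_trans)
    qed
    then have "colorable E W m" using assms(2) fW colorable_mono unfolding perf_def by blast
    then obtain c where c: "\<forall>x\<in>W. c x < m" "\<forall>x\<in>W. \<forall>y\<in>W. E x y \<longrightarrow> c x \<noteq> c y"
      unfolding colorable_def by blast
    let ?L = "map (\<lambda>i. {x\<in>W. c x = i}) [0..<m]"
    have "length (filter (\<lambda>A. x \<in> A) ?L) = w x" if "x \<in> V" for x
    proof (cases "x \<in> W")
      case True
      have "length (filter (\<lambda>A. x \<in> A) ?L) = card {i. i < m \<and> x \<in> map (\<lambda>i. {x\<in>W. c x = i}) [0..<m] ! i}"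
        by (simp only: length_filter_conv_card length_map length_upt minus_nat.diff_0)
      also have "{i. i < m \<and> x \<in> map (\<lambda>i. {x\<in>W. c x = i}) [0..<m] ! i} = {c x}" using c(1) True by auto
      finally show ?thesis using True by (simp add: W_def)
    next
      case False
      then have "w x = 0" using that \<open>\<forall>x\<in>V. w x \<le> 1\<close> by (force simp: W_def le_Suc_eq)
      then show ?thesis using False by (auto simp: filter_map o_def)
    qed
    moreover have "\<forall>A\<in>set ?L. A \<subseteq> V \<and> stab E A" using c(2) fW(2) by (fastforce simp: stab_def)
    ultimately show ?thesis by (intro exI[of _ ?L]) auto
  next
    case False
    then obtain x where x: "x \<in> V" "w x \<ge> 2" by force
    define w1 where "w1 = w(x := w x - 1)"
    have w1_le: "w1 y \<le> w y" for y by (auto simp: w1_def)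
    have sum_w1: "sum w K = sum w1 K + 1" if "x \<in> K" "finite K" for K
      using that x by (simp add: w1_def sum.remove[of K x])
    have less1: "sum w1 V < sum w V" using sum_w1[OF x(1) assms(1)] by simp
    have m1: "\<forall>K\<subseteq>V. clq E K \<longrightarrow> sum w1 K \<le> m"
      using less.prems by (meson order_trans sum_mono w1_le)
    obtain L1 where L1: "length L1 = m" "\<forall>A\<in>set L1. A \<subseteq> V \<and> stab E A"
      "\<forall>x\<in>V. length (filter (\<lambda>A. x \<in> A) L1) = w1 x"
      using less.hyps[OF less1 m1] by blast
    have "filter (\<lambda>A. x \<in> A) L1 \<noteq> []" using L1(3) x by (auto simp: w1_def simp flip: length_0_conv)
    then obtain A where A: "A \<in> set L1" "x \<in> A" by (auto simp: filter_empty_conv)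
    \<comment> \<open>This is \<open>w\<close> minus the indicator of \<open>A\<close>, since at
      \<open>x\<close> the unit has already gone from \<open>w1\<close>. The truncated subtraction
      is harmless by \<open>w1_pos\<close>.\<close>
    define w2 where "w2 = (\<lambda>y. if y \<in> A - {x} then w1 y - 1 else w1 y)"
    have w1_pos: "w1 y \<ge> 1" if "y \<in> A" for y
    proof -
      have "A \<in> set (filter (\<lambda>A. y \<in> A) L1)" using A that by auto
      then have "length (filter (\<lambda>A. y \<in> A) L1) > 0" by (auto simp del: set_filter)
      moreover have "y \<in> V" using A L1(2) that by auto
      ultimately show ?thesis using L1(3) by auto
    qed
    have w2_le: "w2 y \<le> w1 y" for y by (auto simp: w2_def)
    have less2: "sum w2 V < sum w V"
      using less1 sum_mono[of V w2 w1, OF w2_le] by linarith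
    have m_pos: "m \<ge> 1" using L1(1) A by (cases L1) auto
    \<comment> \<open>A clique through \<open>x\<close> has lost the unit at \<open>x\<close>; a
      clique meeting \<open>A\<close> elsewhere loses a unit there; a clique missing
      \<open>A\<close> is covered by the other \<open>m - 1\<close> classes of
      \<open>L1\<close>.\<close>
    have m2: "\<forall>K\<subseteq>V. clq E K \<longrightarrow> sum w2 K \<le> m - 1"
    proof (intro allI impI)
      fix K assume K: "K \<subseteq> V" "clq E K"
      have fK: "finite K" using finite_subset[OF K(1) assms(1)] .
      have w2w1: "sum w2 K \<le> sum w1 K" by (simp add: sum_mono w2_le)
      consider "x \<in> K" | "x \<notin> K" "K \<inter> A = {}" | y where "x \<notin> K" "y \<in> K \<inter> A" by blast
      then show "sum w2 K \<le> m - 1"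
      proof cases
        case 1
        have "sum w K \<le> m" using less.prems K by blast
        then show ?thesis using sum_w1[OF 1 fK] w2w1 by linarith
      next
        case 2
        obtain us vs where us: "L1 = us @ A # vs" using A by (meson split_list)
        have "sum w1 K = (\<Sum>B\<leftarrow>L1. card (K \<inter> B))"
          unfolding sum_count_list_sets[OF fK, of L1, symmetric] using L1(3) K(1) by (intro sum.cong) auto
        also have "\<dots> = (\<Sum>B\<leftarrow>us @ vs. card (K \<inter> B))" using 2 us by simp
        also have "\<dots> \<le> length (us @ vs)" using L1(2) us by (intro sum_list_clq_stab[OF K(2)]) auto
        also have "\<dots> = m - 1" using us L1(1) by auto
        finally show ?thesis using w2w1 by simp
      next
        case 3
        then have "y \<noteq> x" by auto
        then have "w2 y < w1 y" using 3 w1_pos[of y] by (auto simp: w2_def)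
        then have "sum w2 K < sum w1 K" using 3 fK w2_le by (intro sum_strict_mono_ex1) auto
        moreover have "sum w1 K \<le> m" using m1 K by blast
        ultimately show ?thesis by linarith
      qed
    qed
    obtain L2 where L2: "length L2 = m - 1" "\<forall>A\<in>set L2. A \<subseteq> V \<and> stab E A"
      "\<forall>x\<in>V. length (filter (\<lambda>A. x \<in> A) L2) = w2 x"
      using less.hyps[OF less2 m2] by blast
    have "length (filter (\<lambda>A. y \<in> A) (A # L2)) = w y" if "y \<in> V" for y
      using L2(3) that w1_pos[of y] x A by (auto simp: w2_def w1_def)
    then show ?thesis using L2 A L1(2) m_pos by (intro exI[of _ "A # L2"]) auto
  qed
qed

text \<open>Otherwise every clique \<open>K\<close>, the empty one included, is missed by some
  maximum stable set \<open>A K\<close>. Weight a vertex by the number of these sets through it. A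
  clique meets each of them at most once and its own one not at all, so its weight is less than the
  number of cliques. A weighted colouring then spreads the total weight, the number of cliques times
  the stability number, over one stable set too few.\<close>

lemma clique_meeting_max_stable:
  assumes "finite V" "V \<noteq> {}" "perf E V" "ugraph E"
  shows "\<exists>K\<subseteq>V. clq E K \<and> (\<forall>A\<subseteq>V. stab E A \<and> card A = omega (co E) V \<longrightarrow> K \<inter> A \<noteq> {})"
proof (rule ccontr)
  let ?Q = "{K. K \<subseteq> V \<and> clq E K}" and ?a = "omega (co E) V"
  assume "\<not> ?thesis"
  then have "\<forall>K\<in>?Q. \<exists>A\<subseteq>V. stab E A \<and> card A = ?a \<and> K \<inter> A = {}" by blast
  then obtain A where A: "\<And>K. K \<in> ?Q \<Longrightarrow> A K \<subseteq> V \<and> stab E (A K) \<and> card (A K) = ?a \<and> K \<inter> A K = {}"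
    by metis
  have fQ: "finite ?Q" using assms(1) by auto
  have card_Q: "card ?Q \<ge> 1"
    using fQ by (simp add: Suc_le_eq card_gt_0_iff) (auto simp: clq_def intro: exI[of _ "{}"])
  define w where "w x = card {K\<in>?Q. x \<in> A K}" for x
  have sum_w: "sum w B = (\<Sum>K\<in>?Q. card (B \<inter> A K))" if "finite B" for B
  proof -
    have "sum w B = (\<Sum>x\<in>B. \<Sum>K\<in>?Q. if x \<in> A K then 1 else 0)"
      unfolding w_def using fQ by (intro sum.cong) (auto simp: sum.If_cases Int_def)
    also have "\<dots> = (\<Sum>K\<in>?Q. \<Sum>x\<in>B. if x \<in> A K then 1 else 0)" by (rule sum.swap)
    also have "\<dots> = (\<Sum>K\<in>?Q. card (B \<inter> A K))"
      using that by (intro sum.cong) (auto simp: sum.If_cases)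
    finally show ?thesis .
  qed
  have "\<forall>K\<subseteq>V. clq E K \<longrightarrow> sum w K \<le> card ?Q - 1"
  proof (intro allI impI)
    fix K assume K: "K \<subseteq> V" "clq E K"
    have "sum w K = (\<Sum>K'\<in>?Q. card (K \<inter> A K'))" using sum_w K assms(1) finite_subset by blast
    also have "\<dots> = (\<Sum>K'\<in>?Q - {K}. card (K \<inter> A K'))"
      using fQ A[of K] K by (subst sum.remove[of _ K]) auto
    also have "\<dots> \<le> (\<Sum>K'\<in>?Q - {K}. 1)"
      using card_clq_Int_stab[OF K(2)] A by (intro sum_mono) auto
    also have "\<dots> = card ?Q - 1" using K fQ by simp
    finally show "sum w K \<le> card ?Q - 1" .
  qed
  from weighted_coloring[OF assms(1,3,4) this]
  obtain L where L: "length L = card ?Q - 1" "\<forall>A\<in>set L. A \<subseteq> V \<and> stab E A"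
    "\<forall>x\<in>V. length (filter (\<lambda>A. x \<in> A) L) = w x"
    by (elim exE conjE)
  have "(\<Sum>B\<leftarrow>L. card (V \<inter> B)) = (\<Sum>x\<in>V. w x)"
    unfolding sum_count_list_sets[OF assms(1), of L, symmetric] using L(3) by (intro sum.cong) auto
  also have "\<dots> = (\<Sum>K\<in>?Q. ?a)"
    unfolding sum_w[OF assms(1)]
  proof (rule sum.cong[OF refl])
    fix K assume "K \<in> ?Q"
    from A[OF this] show "card (V \<inter> A K) = ?a" by (simp add: Int_absorb1)
  qed
  also have "\<dots> = card ?Q * ?a" by simp
  finally have 1: "(\<Sum>B\<leftarrow>L. card (V \<inter> B)) = card ?Q * ?a" .
  have "card (V \<inter> B) \<le> ?a" if "B \<in> set L" for B
    using L(2) that by (intro card_clq_le_omega[OF assms(1)]) (auto simp: Int_absorb1 stab_iff_clq_co[OF assms(4), symmetric])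
  then have "(\<Sum>B\<leftarrow>L. card (V \<inter> B)) \<le> (\<Sum>B\<leftarrow>L. ?a)" by (intro sum_list_mono)
  then have le: "card ?Q * ?a \<le> (card ?Q - 1) * ?a" using 1 L(1) by (simp add: sum_list_triv)
  obtain v where "v \<in> V" using assms(2) by auto
  then have a1: "?a \<ge> 1" using card_clq_le_omega[of V "{v}" "co E"] assms(1) by (simp add: clq_def)
  have "\<not> q * a \<le> (q - 1) * a" if "q \<ge> 1" "a \<ge> 1" for q a :: nat
    using that by (cases q) auto
  from this[OF card_Q a1] le show False by (rule notE)
qed

text \<open>A clique meeting all maximum stable sets is a colour class of the complement whose
  removal lowers the stability number, so induction colours the rest with one colour less.\<close>

theorem perfect_graph_theorem:
  assumes "finite V" "perf E V" "ugraph E"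
  shows "perf (co E) V"
  unfolding perf_def
proof (intro allI impI)
  fix W assume "W \<subseteq> V"
  have "finite W" "perf E W" using finite_subset[OF \<open>W \<subseteq> V\<close> assms(1)] perf_mono[OF assms(2) \<open>W \<subseteq> V\<close>] .
  then show "colorable (co E) W (omega (co E) W)"
  proof (induction "card W" arbitrary: W rule: less_induct)
    case less
    show ?case
    proof (cases "W = {}")
      case True then show ?thesis by (simp add: colorable_def)
    next
      case False
      obtain K where K: "K \<subseteq> W" "clq E K"
        and hit: "\<And>A. A \<subseteq> W \<Longrightarrow> stab E A \<Longrightarrow> card A = omega (co E) W \<Longrightarrow> K \<inter> A \<noteq> {}"
        using clique_meeting_max_stable[OF less.prems(1) False less.prems(2) assms(3)] by blast
      let ?W = "W - K"
      obtain A where A: "A \<subseteq> W" "clq (co E) A" "card A = omega (co E) W"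
        using omega_witness less.prems(1) by metis
      have "K \<noteq> {}" using hit[of A] A stab_iff_clq_co[OF assms(3)] by auto
      then have "card ?W < card W" using K less.prems(1) by (intro psubset_card_mono) auto
      then have col: "colorable (co E) ?W (omega (co E) ?W)"
        using less.hyps[OF _ _ perf_mono[OF less.prems(2)]] less.prems(1) by blast
      obtain B where B: "B \<subseteq> ?W" "clq (co E) B" "card B = omega (co E) ?W"
        using omega_witness less.prems(1) by (metis finite_Diff)
      have "card B \<le> omega (co E) W" using B less.prems(1) by (intro card_clq_le_omega) auto
      moreover have "card B \<noteq> omega (co E) W" using hit[of B] B stab_iff_clq_co[OF assms(3)] by auto
      ultimately have lt: "omega (co E) ?W < omega (co E) W" using B by simp
      obtain c where c: "\<forall>x\<in>?W. c x < omega (co E) ?W" "\<forall>x\<in>?W. \<forall>y\<in>?W. co E x y \<longrightarrow> c x \<noteq> c y"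
        using col unfolding colorable_def by blast
      let ?c = "\<lambda>x. if x \<in> K then omega (co E) ?W else c x"
      have "\<forall>x\<in>W. ?c x < omega (co E) W" using c(1) lt by (auto intro: less_trans)
      moreover have "\<forall>x\<in>W. \<forall>y\<in>W. co E x y \<longrightarrow> ?c x \<noteq> ?c y"
      proof (intro ballI impI)
        fix x y assume xy: "x \<in> W" "y \<in> W" "co E x y"
        have "\<not> (x \<in> K \<and> y \<in> K)" using xy(3) K(2) by (auto simp: clq_def co_def)
        then show "?c x \<noteq> ?c y" using c(1)[rule_format, of x] c(1)[rule_format, of y] c(2) xy
          by (cases "x \<in> K"; cases "y \<in> K") auto
      qed
      ultimately show ?thesis unfolding colorable_def by (intro exI[of _ ?c] conjI)
    qed
  qed
qed

section \<open>Minimally imperfect graphs: primality and star cutsets\<close>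

definition minimp :: "('a \<Rightarrow> 'a \<Rightarrow> bool) \<Rightarrow> 'a set \<Rightarrow> bool" where
  "minimp E V \<longleftrightarrow> ugraph E \<and> finite V \<and> \<not> colorable E V (omega E V) \<and>
     (\<forall>W\<subset>V. colorable E W (omega E W))"

lemma minimp_exists:
  assumes "ugraph E" "finite V" "\<not> perf E V"
  obtains W where "W \<subseteq> V" "minimp E W"
proof -
  let ?P = "\<lambda>W. W \<subseteq> V \<and> \<not> colorable E W (omega E W)"
  obtain W0 where "?P W0" using assms(3) by (auto simp: perf_def)
  then obtain W where W: "?P W" "\<And>W'. ?P W' \<Longrightarrow> card W \<le> card W'"
    using ex_has_least_nat[of ?P W0 card] by blast
  have "finite W" using W assms(2) finite_subset by blast
  then have "colorable E W' (omega E W')" if "W' \<subset> W" for W'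
    using W that psubset_card_mono[of W W'] by (meson leD order_trans psubset_imp_subset)
  then have "minimp E W" using W(1) assms(1) \<open>finite W\<close> by (simp add: minimp_def)
  then show ?thesis using W(1) that by blast
qed

lemma minimp_co:
  assumes "minimp E V" shows "minimp (co E) V"
proof -
  have u: "ugraph E" and f: "finite V" using assms by (auto simp: minimp_def)
  have "colorable (co E) W (omega (co E) W)" if "W \<subset> V" for W
  proof -
    have "perf E W" using assms that unfolding perf_def minimp_def by (meson subset_psubset_trans)
    then have "perf (co E) W" using perfect_graph_theorem u f that
      by (meson finite_subset psubset_imp_subset)
    then show ?thesis by (simp add: perf_def)
  qed
  moreover have "\<not> colorable (co E) V (omega (co E) V)"
  proof
    assume "colorable (co E) V (omega (co E) V)"
    then have "perf (co E) V" using calculation unfolding perf_def by (metis psubsetI)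
    then have "perf E V" using perfect_graph_theorem[OF f] ugraph_co[OF u] co_co[OF u] by metis
    then show False using assms by (simp add: perf_def minimp_def)
  qed
  ultimately show ?thesis using u f by (simp add: minimp_def ugraph_co)
qed

lemma minimp_perf: "minimp E V \<Longrightarrow> W \<subset> V \<Longrightarrow> perf E W"
  unfolding perf_def minimp_def by (meson subset_psubset_trans)

text \<open>A module. Since \<open>a\<close> and \<open>b\<close> range over all pairs, the
  implication says that a vertex outside sees all of \<open>M\<close> or nothing of it.\<close>

definition homog :: "('a \<Rightarrow> 'a \<Rightarrow> bool) \<Rightarrow> 'a set \<Rightarrow> 'a set \<Rightarrow> bool" where
  "homog E V M \<longleftrightarrow> M \<subseteq> V \<and> (\<forall>x\<in>V - M. \<forall>a\<in>M. \<forall>b\<in>M. E x a \<longrightarrow> E x b)"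

definition prime :: "('a \<Rightarrow> 'a \<Rightarrow> bool) \<Rightarrow> 'a set \<Rightarrow> bool" where
  "prime E V \<longleftrightarrow> (\<forall>M. homog E V M \<longrightarrow> M = V \<or> (\<forall>a\<in>M. \<forall>b\<in>M. a = b))"

text \<open>Contract \<open>M\<close> to one of its vertices \<open>m\<close> and give
  \<open>m\<close> the weight \<open>omega E M\<close>. The contracted graph is a proper induced
  subgraph, hence perfect, and in its weighted colouring with \<open>omega E V\<close> classes
  exactly \<open>omega E M\<close> classes contain \<open>m\<close>. These serve as the colours of
  \<open>M\<close>, which is perfect as well.\<close>

theorem minimp_prime:
  assumes "minimp E V" shows "prime E V"
  unfolding prime_def
proof (intro allI impI, rule ccontr)
  fix M assume M: "homog E V M" and "\<not> (M = V \<or> (\<forall>a\<in>M. \<forall>b\<in>M. a = b))"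
  then obtain m m' where mm: "m \<in> M" "m' \<in> M" "m \<noteq> m'" "M \<subset> V" by (auto simp: homog_def)
  have u: "ugraph E" and f: "finite V" using assms by (auto simp: minimp_def)
  let ?W = "insert m (V - M)" and ?h = "omega E M" and ?k = "omega E V"
  have W: "?W \<subset> V" using mm by auto
  define w where "w x = (if x = m then ?h else 1)" for x
  have fM: "finite M" using mm f finite_subset by blast
  have "\<forall>K\<subseteq>?W. clq E K \<longrightarrow> sum w K \<le> ?k"
  proof (intro allI impI)
    fix K assume K: "K \<subseteq> ?W" "clq E K"
    have fK: "finite K" using K W f by (meson finite_subset psubset_imp_subset)
    show "sum w K \<le> ?k"
    proof (cases "m \<in> K")
      case False
      then have "sum w K = (\<Sum>x\<in>K. 1)" by (intro sum.cong) (auto simp: w_def)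
      then have "sum w K = card K" by simp
      then show ?thesis using card_clq_le_omega[OF f, of K E] K W by (metis order_trans psubset_imp_subset)
    next
      case True
      obtain J where J: "J \<subseteq> M" "clq E J" "card J = ?h" using omega_witness fM by metis
      have "sum w K = ?h + sum w (K - {m})" using True fK by (simp add: sum.remove w_def)
      also have "sum w (K - {m}) = (\<Sum>x\<in>K - {m}. 1)" by (intro sum.cong) (auto simp: w_def)
      also have "\<dots> = card (K - {m})" by simp
      finally have s: "sum w K = ?h + card (K - {m})" .
      have disj: "J \<inter> (K - {m}) = {}" using J K by auto
      have "clq E (J \<union> (K - {m}))"
        unfolding clq_def
      proof (intro ballI impI)
        have *: "E x y" if "x \<in> J" "y \<in> K - {m}" for x y
        proof -
          have "E y m" using K(2) that True by (auto simp: clq_def)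
          moreover have "x \<in> M" "y \<in> V - M" using that J(1) K(1) mm(1) by auto
          ultimately have "E y x" using M mm(1) unfolding homog_def by blast
          then show ?thesis using ugraphD(1)[OF u] by blast
        qed
        fix x y assume "x \<in> J \<union> (K - {m})" "y \<in> J \<union> (K - {m})" "x \<noteq> y"
        then show "E x y" using *[of x y] *[of y x] J(2) K(2) ugraphD(1)[OF u, of x y]
          unfolding clq_def by blast
      qed
      moreover have "J \<union> (K - {m}) \<subseteq> V" using J K mm by auto
      ultimately have "card (J \<union> (K - {m})) \<le> ?k" using f by (intro card_clq_le_omega)
      moreover have "card (J \<union> (K - {m})) = ?h + card (K - {m})"
        using disj J fM fK finite_subset by (metis card_Un_disjoint finite_Diff)
      ultimately show ?thesis using s by simp
    qed
  qed
  from weighted_coloring[OF finite_subset[OF psubset_imp_subset[OF W] f] minimp_perf[OF assms W] u this]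
  obtain L where L: "length L = ?k" "\<forall>A\<in>set L. A \<subseteq> ?W \<and> stab E A"
    "\<forall>x\<in>?W. length (filter (\<lambda>A. x \<in> A) L) = w x"
    by (elim exE conjE)
  obtain c where c: "\<forall>x\<in>M. c x < ?h" "\<forall>x\<in>M. \<forall>y\<in>M. E x y \<longrightarrow> c x \<noteq> c y"
    using minimp_perf[OF assms mm(4)] by (auto simp: perf_def colorable_def)
  let ?I = "{i. i < ?k \<and> m \<in> L ! i}"
  have "card ?I = ?h" using L(1,3) by (simp add: length_filter_conv_card w_def)
  then obtain f where f: "bij_betw f {..<?h} ?I"
    using finite_same_card_bij[of "{..<?h}" ?I] by auto
  have ex: "\<exists>i<?k. x \<in> L ! i" if "x \<in> V - M" for x
  proof -
    have "length (filter (\<lambda>A. x \<in> A) L) = 1" using L(3) that mm by (auto simp: w_def)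
    then have "filter (\<lambda>A. x \<in> A) L \<noteq> []" by auto
    then show ?thesis using L(1) by (auto simp: filter_empty_conv in_set_conv_nth)
  qed
  \<comment> \<open>A vertex outside \<open>M\<close> has weight 1 and so lies in exactly one class,
    which \<open>SOME\<close> selects; colours of \<open>M\<close> are sent to the classes through
    \<open>m\<close>.\<close>
  define d where "d x = (if x \<in> M then f (c x) else (SOME i. i < ?k \<and> x \<in> L ! i))" for x
  have dV: "d x < ?k \<and> x \<in> L ! d x" if "x \<in> V - M" for x
    using someI_ex[OF ex[OF that]] that by (simp add: d_def)
  have dM: "d x < ?k \<and> m \<in> L ! d x" if "x \<in> M" for x
    using bij_betw_apply[OF f, of "c x"] c(1) that by (simp add: d_def)
  have st: "\<not> E x y" if "x \<in> L ! i" "y \<in> L ! i" "i < ?k" for x y i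
    using L(1,2) that by (metis nth_mem stab_def)
  have "d x \<noteq> d y" if xy: "x \<in> V" "y \<in> V" "E x y" for x y
  proof (cases "x \<in> M")
    case True
    show ?thesis
    proof (cases "y \<in> M")
      case y: True
      have "c x \<noteq> c y" using c(2) True y xy by auto
      then show ?thesis using True y c(1) f by (auto simp: d_def bij_betw_def inj_on_def)
    next
      case False
      have "E y m" using M xy True False mm ugraphD(1)[OF u, of x y] by (auto simp: homog_def)
      then show ?thesis using dM[OF True] dV[of y] False xy st by auto
    qed
  next
    case False
    show ?thesis
    proof (cases "y \<in> M")
      case True
      have "E x m" using M xy True False mm by (auto simp: homog_def)
      then show ?thesis using dM[OF True] dV[of x] False xy st by (metis DiffI)
    next
      case y: False
      then show ?thesis using dV[of x] dV[of y] False xy st by auto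
    qed
  qed
  moreover have "d x < ?k" if "x \<in> V" for x using dV dM that by blast
  ultimately have "colorable E V ?k" unfolding colorable_def by blast
  then show False using assms by (simp add: minimp_def)
qed

text \<open>Chvatal's star cutset lemma: the colour classes of the centre in two colourings of the
  pieces unite to a stable set meeting all maximum cliques.\<close>

theorem minimp_star_cutset:
  assumes "minimp E V" "v \<in> C" "\<forall>x\<in>C. x = v \<or> E v x" "V = C \<union> A \<union> B"
    and "A \<noteq> {}" "B \<noteq> {}" "A \<inter> B = {}" "A \<inter> C = {}" "B \<inter> C = {}"
    and "\<forall>a\<in>A. \<forall>b\<in>B. \<not> E a b"
  shows False
proof -
  have u: "ugraph E" and f: "finite V" using assms(1) by (auto simp: minimp_def)
  let ?k = "omega E V"
  have "\<exists>c::'a \<Rightarrow> nat. (\<forall>x\<in>A \<union> C. c x < ?k) \<and> (\<forall>x\<in>A \<union> C. \<forall>y\<in>A \<union> C. E x y \<longrightarrow> c x \<noteq> c y)"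
  proof -
    have "A \<union> C \<subset> V" using assms by auto
    then have "colorable E (A \<union> C) (omega E (A \<union> C))" using assms(1) by (auto simp: minimp_def)
    moreover have "omega E (A \<union> C) \<le> ?k" using \<open>A \<union> C \<subset> V\<close> f by (intro omega_mono) auto
    ultimately show ?thesis using colorable_mono unfolding colorable_def by blast
  qed
  then obtain c where c: "\<forall>x\<in>A \<union> C. c x < ?k" "\<forall>x\<in>A \<union> C. \<forall>y\<in>A \<union> C. E x y \<longrightarrow> c x \<noteq> c y" by blast
  have "\<exists>c::'a \<Rightarrow> nat. (\<forall>x\<in>B \<union> C. c x < ?k) \<and> (\<forall>x\<in>B \<union> C. \<forall>y\<in>B \<union> C. E x y \<longrightarrow> c x \<noteq> c y)"
  proof -
    have "B \<union> C \<subset> V" using assms by auto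
    then have "colorable E (B \<union> C) (omega E (B \<union> C))" using assms(1) by (auto simp: minimp_def)
    moreover have "omega E (B \<union> C) \<le> ?k" using \<open>B \<union> C \<subset> V\<close> f by (intro omega_mono) auto
    ultimately show ?thesis using colorable_mono unfolding colorable_def by blast
  qed
  then obtain d where d: "\<forall>x\<in>B \<union> C. d x < ?k" "\<forall>x\<in>B \<union> C. \<forall>y\<in>B \<union> C. E x y \<longrightarrow> d x \<noteq> d y" by blast
  \<comment> \<open>The vertices of \<open>C\<close> other than \<open>v\<close> are adjacent to
    \<open>v\<close> and never share its colour. Hence the two classes meet \<open>C\<close> in
    \<open>v\<close> only, and there is no edge between their remaining parts, which lie in
    \<open>A\<close> and in \<open>B\<close>.\<close>
  define S where "S = {x\<in>A \<union> C. c x = c v} \<union> {x\<in>B \<union> C. d x = d v}"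
  have vS: "v \<in> S" using assms(2) by (auto simp: S_def)
  have SC: "x = v" if "x \<in> S" "x \<in> C" for x
  proof (rule ccontr)
    assume "x \<noteq> v"
    then have "E v x" using that assms(3) by auto
    then have "c x \<noteq> c v" "d x \<noteq> d v" using c(2) d(2) that assms(2) ugraphD(1)[OF u] by blast+
    then show False using that by (auto simp: S_def)
  qed
  have Sst: "\<not> E x y" if "x \<in> S" "y \<in> S" for x y
  proof
    assume xy: "E x y"
    then have "E y x" using ugraphD(1)[OF u] by blast
    have cases: "z = v \<or> z \<in> A \<and> c z = c v \<or> z \<in> B \<and> d z = d v" if "z \<in> S" for z
      using SC[of z] that unfolding S_def by blast
    have 1: "\<not> (z \<in> A \<and> c z = c v \<and> z' \<in> A \<union> C \<and> c z' = c v)" if "E z z'" for z z'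
      using c(2) that by force
    have 2: "\<not> (z \<in> B \<and> d z = d v \<and> z' \<in> B \<union> C \<and> d z' = d v)" if "E z z'" for z z'
      using d(2) that by force
    from cases[OF that(1)] cases[OF that(2)] show False
      using 1[OF xy] 1[OF \<open>E y x\<close>] 2[OF xy] 2[OF \<open>E y x\<close>] assms(2,10) xy \<open>E y x\<close> ugraphD(2)[OF u]
      by blast
  qed
  have kpos: "?k \<ge> 1" using c(1) assms(2) by fastforce
  \<comment> \<open>A clique cannot meet both \<open>A\<close> and \<open>B\<close>, so it lies in
    one of the pieces, and there the colour of \<open>v\<close> is no longer in use.\<close>
  have "omega E (V - S) \<le> ?k - 1"
    unfolding omega_le_iff[OF finite_Diff[OF f]]
  proof (intro allI impI)
    have *: "card K \<le> ?k - 1" if K: "K \<subseteq> X - S" "clq E K" "v \<in> X" and e: "\<forall>x\<in>X. e x < ?k"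
      "\<forall>x\<in>X. \<forall>y\<in>X. E x y \<longrightarrow> e x \<noteq> e y" "\<forall>x\<in>X - S. e x \<noteq> e v" for K X and e :: "'a \<Rightarrow> nat"
    proof -
      have "inj_on e K" using K(1,2) e(2) unfolding inj_on_def clq_def by (meson DiffD1 subsetD)
      moreover have "e x < ?k \<and> e x \<noteq> e v" if "x \<in> K" for x using K(1) e(1,3) that by blast
      then have "e ` K \<subseteq> {..<?k} - {e v}" by auto
      ultimately have "card K \<le> card ({..<?k} - {e v})" by (metis card_inj_on_le finite_Diff finite_lessThan)
      also have "\<dots> = ?k - 1" using K(3) e(1) by simp
      finally show ?thesis .
    qed
    fix K assume K: "K \<subseteq> V - S" "clq E K"
    have "K \<subseteq> (A \<union> C) - S \<or> K \<subseteq> (B \<union> C) - S"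
    proof (rule ccontr)
      assume "\<not> ?thesis"
      then obtain a b where "a \<in> K" "a \<in> A" "b \<in> K" "b \<in> B" using K assms(4) by blast
      moreover from this have "a \<noteq> b" using assms(7) by auto
      ultimately have "E a b" using K(2) unfolding clq_def by simp
      then show False using assms(10) \<open>a \<in> A\<close> \<open>b \<in> B\<close> by simp
    qed
    then show "card K \<le> ?k - 1"
    proof
      assume KA: "K \<subseteq> (A \<union> C) - S"
      have "\<forall>x\<in>(A \<union> C) - S. c x \<noteq> c v" by (auto simp: S_def)
      from *[OF KA K(2) _ c this] show ?thesis using assms(2) by simp
    next
      assume KB: "K \<subseteq> (B \<union> C) - S"
      have "\<forall>x\<in>(B \<union> C) - S. d x \<noteq> d v" by (auto simp: S_def)
      from *[OF KB K(2) _ d this] show ?thesis using assms(2) by simp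
    qed
  qed
  moreover have "V - S \<subset> V" using vS assms(2,4) by auto
  then have "colorable E (V - S) (omega E (V - S))" using assms(1) by (simp add: minimp_def)
  ultimately have "colorable E (V - S) (?k - 1)" by (metis colorable_mono)
  then obtain e where e: "\<forall>x\<in>V - S. e x < ?k - 1" "\<forall>x\<in>V - S. \<forall>y\<in>V - S. E x y \<longrightarrow> e x \<noteq> e y"
    unfolding colorable_def by blast
  let ?e = "\<lambda>x. if x \<in> S then ?k - 1 else e x"
  have "\<forall>x\<in>V. ?e x < ?k"
  proof
    fix x assume "x \<in> V"
    then show "?e x < ?k" using e(1)[rule_format, of x] kpos by (cases "x \<in> S") auto
  qed
  moreover have "\<forall>x\<in>V. \<forall>y\<in>V. E x y \<longrightarrow> ?e x \<noteq> ?e y"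
  proof (intro ballI impI)
    fix x y assume "x \<in> V" "y \<in> V" "E x y"
    then show "?e x \<noteq> ?e y"
      using e(1)[rule_format, of x] e(1)[rule_format, of y] e(2)[rule_format, of x y] Sst[of x y]
      by (cases "x \<in> S"; cases "y \<in> S") auto
  qed
  ultimately have "colorable E V ?k" unfolding colorable_def by (intro exI[of _ ?e] conjI)
  then show False using assms(1) by (simp add: minimp_def)
qed

subsection \<open>Induced cycles in minimally imperfect graphs\<close>

definition ispath :: "('a \<Rightarrow> 'a \<Rightarrow> bool) \<Rightarrow> 'a list \<Rightarrow> bool" where
  "ispath E xs \<longleftrightarrow> distinct xs \<and>
     (\<forall>i j. i < j \<and> j < length xs \<longrightarrow> (E (xs ! i) (xs ! j) \<longleftrightarrow> j = Suc i))"

definition iscycle :: "('a \<Rightarrow> 'a \<Rightarrow> bool) \<Rightarrow> 'a list \<Rightarrow> bool" where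
  "iscycle E xs \<longleftrightarrow> distinct xs \<and>
     (\<forall>i j. i < j \<and> j < length xs \<longrightarrow> (E (xs ! i) (xs ! j) \<longleftrightarrow> j = Suc i \<or> i = 0 \<and> j = length xs - 1))"

definition conn :: "('a \<Rightarrow> 'a \<Rightarrow> bool) \<Rightarrow> 'a set \<Rightarrow> bool" where
  "conn E Z \<longleftrightarrow> (\<forall>A B. A \<union> B = Z \<and> A \<inter> B = {} \<and> A \<noteq> {} \<and> B \<noteq> {} \<longrightarrow> (\<exists>a\<in>A. \<exists>b\<in>B. E a b))"

lemma connD:
  assumes "conn E Z" "A \<subseteq> Z" "A \<noteq> {}" "A \<noteq> Z"
  obtains a b where "a \<in> A" "b \<in> Z - A" "E a b"
proof -
  have "A \<union> (Z - A) = Z" "A \<inter> (Z - A) = {}" "Z - A \<noteq> {}" using assms by auto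
  then have "\<exists>a\<in>A. \<exists>b\<in>Z - A. E a b" using assms(1,3) unfolding conn_def by blast
  then show ?thesis using that by blast
qed

text \<open>Minimising over walks rather than paths makes cutting and pasting easy: a chord, a
  repetition, or a later vertex of \<open>P\<close> or an earlier vertex of \<open>T\<close> would
  each yield a shorter walk.\<close>

lemma shortest_path:
  assumes "conn E Z" "P \<subseteq> Z" "T \<subseteq> Z" "P \<noteq> {}" "T \<noteq> {}"
  obtains ws where "ws \<noteq> []" "ispath E ws" "set ws \<subseteq> Z"
    "\<And>i. i < length ws \<Longrightarrow> ws ! i \<in> P \<longleftrightarrow> i = 0"
    "\<And>i. i < length ws \<Longrightarrow> ws ! i \<in> T \<longleftrightarrow> i = length ws - 1"
proof -
  let ?W = "\<lambda>ws. ws \<noteq> [] \<and> set ws \<subseteq> Z \<and> successively E ws \<and> hd ws \<in> P"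
  define R where "R = {last ws | ws. ?W ws}"
  have "P \<subseteq> R"
  proof
    fix p assume "p \<in> P"
    then have "?W [p]" "p = last [p]" using assms by auto
    then show "p \<in> R" unfolding R_def by (intro CollectI exI[of _ "[p]"] conjI) auto
  qed
  have RZ: "R \<subseteq> Z" unfolding R_def by auto
  have "R = Z"
  proof (rule ccontr)
    assume "R \<noteq> Z"
    then obtain a b where ab: "a \<in> R" "b \<in> Z - R" "E a b"
      using connD[OF assms(1) RZ] \<open>P \<subseteq> R\<close> assms(4) by blast
    then obtain ws where "?W ws" "last ws = a" unfolding R_def by blast
    then have "?W (ws @ [b])" "last (ws @ [b]) = b" using ab
      by (auto simp: successively_append_iff)
    then have "b \<in> R" unfolding R_def by (intro CollectI exI[of _ "ws @ [b]"] conjI) auto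
    then show False using ab by blast
  qed
  moreover obtain t where "t \<in> T" using assms(5) by blast
  ultimately have "t \<in> R" using assms(3) by blast
  then obtain ws0 where "?W ws0 \<and> t = last ws0" unfolding R_def by (elim CollectE exE) blast
  then have "?W ws0 \<and> last ws0 \<in> T" using \<open>t \<in> T\<close> by simp
  then have "\<exists>ws. (?W ws \<and> last ws \<in> T) \<and> (\<forall>us. ?W us \<and> last us \<in> T \<longrightarrow> length ws \<le> length us)"
    by (rule ex_has_least_nat)
  then obtain ws where ws: "?W ws" "last ws \<in> T"
    and min': "\<forall>us. ?W us \<and> last us \<in> T \<longrightarrow> length ws \<le> length us"
    by (elim exE conjE) simp
  have min: "length ws \<le> length us" if "?W us" "last us \<in> T" for us
    using min' that by simp
  have suc: "successively E (take i ws)" "successively E (drop i ws)" for i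
    using ws(1) by (metis append_take_drop_id successively_append_iff)+
  have sub: "set (take i ws) \<subseteq> Z" "set (drop i ws) \<subseteq> Z" for i
    using ws(1) by (meson order_trans set_take_subset set_drop_subset)+
  have chord: "j = Suc i" if "i < j" "j < length ws" "E (ws ! i) (ws ! j)" for i j
  proof (rule ccontr)
    assume "j \<noteq> Suc i"
    let ?us = "take (Suc i) ws @ drop j ws"
    have "last (take (Suc i) ws) = ws ! i" using that by (simp add: take_Suc_conv_app_nth)
    moreover have "hd (drop j ws) = ws ! j" using that by (simp add: hd_drop_conv_nth)
    ultimately have "successively E ?us" using suc that by (auto simp: successively_append_iff)
    moreover have "hd ?us = hd ws" using that by (cases ws) auto
    moreover have "last ?us = last ws" using that by simp
    moreover have "?us \<noteq> []" using that by simp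
    ultimately have "length ws \<le> length ?us" using ws sub by (intro min) auto
    then show False using that \<open>j \<noteq> Suc i\<close> by simp
  qed
  have dist: "distinct ws"
  proof (rule ccontr)
    assume "\<not> distinct ws"
    then obtain i j where ij: "i < j" "j < length ws" "ws ! i = ws ! j"
      by (metis distinct_conv_nth linorder_neqE_nat)
    let ?us = "take i ws @ drop j ws"
    have h: "hd (drop j ws) = ws ! i" using ij by (simp add: hd_drop_conv_nth)
    have "take i ws = [] \<or> E (last (take i ws)) (ws ! i)"
    proof (cases i)
      case (Suc n)
      then have "last (take i ws) = ws ! n" using ij by (simp add: take_Suc_conv_app_nth)
      moreover have "successively E ws" using ws(1) by blast
      then have "\<forall>i. Suc i < length ws \<longrightarrow> E (ws ! i) (ws ! Suc i)" by (simp only: successively_conv_nth)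
      then have "E (ws ! n) (ws ! Suc n)" using ij Suc by (elim allE[of _ n]) simp
      ultimately show ?thesis using Suc by simp
    qed simp
    then have "successively E ?us" using suc ij h by (auto simp: successively_append_iff)
    moreover have "hd ?us = hd ws"
    proof (cases i)
      case 0
      then show ?thesis using h ij by (cases ws) auto
    next
      case (Suc n)
      then show ?thesis using ij by (cases ws) auto
    qed
    moreover have "last ?us = last ws" using ij by simp
    moreover have "?us \<noteq> []" using ij by simp
    ultimately have "length ws \<le> length ?us" using ws sub by (intro min) auto
    then show False using ij by simp
  qed
  have "E (ws ! i) (ws ! Suc i)" if "Suc i < length ws" for i
    using ws(1) that by (auto simp: successively_conv_nth)
  then have path: "ispath E ws" using chord dist unfolding ispath_def by blast
  have Pi: "ws ! i \<in> P \<longleftrightarrow> i = 0" if "i < length ws" for i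
  proof
    assume "ws ! i \<in> P"
    then have "?W (drop i ws)" "last (drop i ws) \<in> T"
      using suc sub ws that by (auto simp: hd_drop_conv_nth)
    then have "length ws \<le> length (drop i ws)" by (rule min)
    then show "i = 0" using that by simp
  next
    have "hd ws \<in> P" "hd ws = ws ! 0" using ws(1) hd_conv_nth[of ws] by blast+
    moreover assume "i = 0"
    ultimately show "ws ! i \<in> P" by simp
  qed
  have Ti: "ws ! i \<in> T \<longleftrightarrow> i = length ws - 1" if "i < length ws" for i
  proof
    assume "ws ! i \<in> T"
    moreover have "last (take (Suc i) ws) = ws ! i" using that by (simp add: take_Suc_conv_app_nth)
    moreover have "take (Suc i) ws \<noteq> []" "hd (take (Suc i) ws) = hd ws" using ws(1) by (cases ws; simp)+
    ultimately have "?W (take (Suc i) ws)" "last (take (Suc i) ws) \<in> T"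
      using suc(1)[of "Suc i"] sub(1)[of "Suc i"] ws(1) by simp_all
    then have "length ws \<le> length (take (Suc i) ws)" by (rule min)
    then show "i = length ws - 1" using that by simp
  next
    assume "i = length ws - 1" then show "ws ! i \<in> T" using ws by (simp add: last_conv_nth)
  qed
  show ?thesis using that[OF _ path _ Pi Ti] ws by blast
qed

lemma ispath_Cons:
  assumes "ispath E ws" "x \<notin> set ws" "\<And>i. i < length ws \<Longrightarrow> E x (ws ! i) \<longleftrightarrow> i = 0"
  shows "ispath E (x # ws)"
  unfolding ispath_def
proof (intro conjI allI impI)
  show "distinct (x # ws)" using assms by (simp add: ispath_def)
  fix i j assume "i < j \<and> j < length (x # ws)"
  then show "E ((x # ws) ! i) ((x # ws) ! j) \<longleftrightarrow> j = Suc i"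
    using assms(1) assms(3)[of "j - 1"] unfolding ispath_def by (cases i; cases j) auto
qed

lemma ispath_snoc:
  assumes "ispath E ws" "x \<notin> set ws" "ugraph E" "\<And>i. i < length ws \<Longrightarrow> E x (ws ! i) \<longleftrightarrow> i = length ws - 1"
  shows "ispath E (ws @ [x])"
  unfolding ispath_def
proof (intro conjI allI impI)
  show "distinct (ws @ [x])" using assms by (simp add: ispath_def)
  fix i j assume ij: "i < j \<and> j < length (ws @ [x])"
  then show "E ((ws @ [x]) ! i) ((ws @ [x]) ! j) \<longleftrightarrow> j = Suc i"
    using assms(1) assms(4)[of i] ugraphD(1)[OF assms(3), of x "ws ! i"] unfolding ispath_def
    by (cases "j = length ws") (auto simp: nth_append)
qed

lemma iscycle_Cons:
  assumes "ispath E ws" "x \<notin> set ws" "length ws \<ge> 2"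
    "\<And>i. i < length ws \<Longrightarrow> E x (ws ! i) \<longleftrightarrow> i = 0 \<or> i = length ws - 1"
  shows "iscycle E (x # ws)"
  unfolding iscycle_def
proof (intro conjI allI impI)
  show "distinct (x # ws)" using assms by (simp add: ispath_def)
  fix i j assume "i < j \<and> j < length (x # ws)"
  then show "E ((x # ws) ! i) ((x # ws) ! j) \<longleftrightarrow> j = Suc i \<or> i = 0 \<and> j = length (x # ws) - 1"
    using assms(1,3) assms(4)[of "j - 1"] unfolding ispath_def by (cases i; cases j) auto
qed

lemma ispath_drop: "ispath E ws \<Longrightarrow> ispath E (drop n ws)"
  unfolding ispath_def by (auto simp: less_diff_conv add.commute)

lemma max_card_subset:
  assumes "P A" "finite Y" "\<And>B. P B \<Longrightarrow> B \<subseteq> Y"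
  obtains M where "P M" "\<And>B. P B \<Longrightarrow> card B \<le> card M"
proof -
  have "\<exists>M. P M \<and> (\<forall>B. P B \<longrightarrow> card B \<le> card M)"
  proof (rule ex_has_greatest_nat)
    show "P A" by (rule assms(1))
    show "\<forall>B. P B \<longrightarrow> card B < Suc (card Y)"
    proof (intro allI impI)
      fix B assume "P B"
      from card_mono[OF assms(2) assms(3)[OF this]] show "card B < Suc (card Y)" by simp
    qed
  qed
  then obtain M where M: "P M" "\<forall>B. P B \<longrightarrow> card B \<le> card M" by (elim exE conjE)
  show ?thesis
  proof (rule that[OF M(1)])
    fix B assume "P B" then show "card B \<le> card M" by (rule M(2)[rule_format])
  qed
qed

lemma conn_insert:
  assumes "conn E Y" "Y \<noteq> {}" "y \<in> Y" "E y x" "E x y"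
  shows "conn E (insert x Y)"
  unfolding conn_def
proof (intro allI impI)
  fix A B assume AB: "A \<union> B = insert x Y \<and> A \<inter> B = {} \<and> A \<noteq> {} \<and> B \<noteq> {}"
  have dis: "A \<inter> B = {}" using AB by (elim conjE)
  have un: "z \<in> A \<or> z \<in> B \<longleftrightarrow> z = x \<or> z \<in> Y" for z
    using AB by (metis Un_iff insert_iff)
  have only_x: "x \<in> C \<and> y \<in> D" if "C \<inter> Y = {}" "C \<noteq> {}" "C \<inter> D = {}"
    "\<And>z. z \<in> C \<or> z \<in> D \<longleftrightarrow> z = x \<or> z \<in> Y" for C D
    using that(1,2) that(4)[of y] that(4) assms(3) by (metis disjoint_iff ex_in_conv)
  show "\<exists>a\<in>A. \<exists>b\<in>B. E a b"
  proof (cases "A \<inter> Y = {}")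
    case True
    then have "x \<in> A \<and> y \<in> B" using only_x[of A B] AB un by simp
    then show ?thesis using assms(5) by (elim conjE) (intro bexI)
  next
    case A: False
    show ?thesis
    proof (cases "B \<inter> Y = {}")
      case True
      then have "x \<in> B \<and> y \<in> A" using only_x[of B A] AB un by (simp add: Int_commute disj_commute)
      then show ?thesis using assms(4) by (elim conjE) (intro bexI)
    next
      case False
      have "(A \<inter> Y) \<union> (B \<inter> Y) = Y" "(A \<inter> Y) \<inter> (B \<inter> Y) = {}" using un dis by auto
      then have "\<exists>a\<in>A \<inter> Y. \<exists>b\<in>B \<inter> Y. E a b"
        using assms(1)[unfolded conn_def, rule_format, of "A \<inter> Y" "B \<inter> Y"] A False by simp
      then show ?thesis by auto
    qed
  qed
qed

text \<open>Take a largest co-connected part \<open>Y'\<close> of \<open>Y\<close> with a common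
  neighbour in \<open>Z\<close>. If it is not all of \<open>Y\<close>, some \<open>y0\<close>
  outside is non-adjacent to a vertex of \<open>Y'\<close>. A shortest path in \<open>Z\<close> from
  the common neighbours of \<open>Y'\<close> to the neighbours of \<open>y0\<close> gives a hole
  through \<open>v\<close>, or else its last vertex \<open>w\<close> starts a co-path through
  \<open>Y'\<close> to \<open>y0\<close> that closes to an antihole.\<close>

lemma complete_vertex_or_disc:
  assumes u: "ugraph E" and "finite Y" "Y \<noteq> {}" "Z \<noteq> {}" "Y \<inter> Z = {}" "v \<notin> Y" "v \<notin> Z"
    and Zc: "conn E Z" and Yc: "conn (co E) Y" and YZ: "\<And>y. y \<in> Y \<Longrightarrow> \<exists>z\<in>Z. E y z"
    and vY: "\<And>y. y \<in> Y \<Longrightarrow> E v y" and vZ: "\<And>z. z \<in> Z \<Longrightarrow> \<not> E v z"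
  shows "(\<exists>z\<in>Z. \<forall>y\<in>Y. E z y) \<or>
    (\<exists>xs. 5 \<le> length xs \<and> set xs \<subseteq> insert v (Y \<union> Z) \<and> (iscycle E xs \<or> iscycle (co E) xs))"
proof (rule ccontr)
  assume neg: "\<not> ?thesis"
  then have nodisc: "\<not> iscycle E xs" "\<not> iscycle (co E) xs"
    if "5 \<le> length xs" "set xs \<subseteq> insert v (Y \<union> Z)" for xs using that by blast+
  have sym: "E x y \<longleftrightarrow> E y x" for x y by (rule ugraphD(1)[OF u])
  let ?P = "\<lambda>Y'. Y' \<subseteq> Y \<and> Y' \<noteq> {} \<and> conn (co E) Y' \<and> (\<exists>z\<in>Z. \<forall>y\<in>Y'. E z y)"
  obtain y where "y \<in> Y" using assms(3) by blast
  have "conn (co E) {y}" unfolding conn_def by (auto simp: Un_singleton_iff)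
  moreover obtain z where "z \<in> Z" "E y z" using YZ[OF \<open>y \<in> Y\<close>] by blast
  moreover from this have "\<forall>x\<in>{y}. E z x" using sym[of y z] by simp
  ultimately have y1: "?P {y}" using \<open>y \<in> Y\<close> by (intro conjI bexI[of _ z]) simp_all
  obtain Y' where Y': "?P Y'" and max: "\<And>Y''. ?P Y'' \<Longrightarrow> card Y'' \<le> card Y'"
  proof (rule max_card_subset[of ?P "{y}" Y])
    show "?P {y}" by (rule y1)
    show "finite Y" by (rule assms(2))
    show "B \<subseteq> Y" if "?P B" for B using that by simp
    fix M assume M: "?P M" "\<And>B. ?P B \<Longrightarrow> card B \<le> card M"
    show thesis by (rule that[OF M])
  qed
  have "Y' \<noteq> Y" using neg Y' by blast
  then obtain y1 y0 where y: "y1 \<in> Y'" "y0 \<in> Y - Y'" "co E y1 y0"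
    using connD[OF Yc] Y' by metis
  have fY': "finite Y'" using Y' assms(2) finite_subset by blast
  have Y'': "conn (co E) (insert y0 Y')"
    using Y' y conn_insert[of "co E" Y' y1 y0] sym by (auto simp: co_def)
  define P where "P = {z\<in>Z. \<forall>y\<in>Y'. E z y}"
  define T where "T = {z\<in>Z. E y0 z}"
  have "P \<noteq> {}" "T \<noteq> {}" "P \<subseteq> Z" "T \<subseteq> Z" using Y' YZ[of y0] y unfolding P_def T_def by auto
  then obtain ws where ws: "ws \<noteq> []" "ispath E ws" "set ws \<subseteq> Z"
    and wsP: "\<And>i. i < length ws \<Longrightarrow> ws ! i \<in> P \<longleftrightarrow> i = 0"
    and wsT: "\<And>i. i < length ws \<Longrightarrow> ws ! i \<in> T \<longleftrightarrow> i = length ws - 1"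
    using shortest_path[OF Zc] by metis
  have nth_Z: "ws ! i \<in> Z" if "i < length ws" for i using ws(3) that nth_mem by blast
  \<comment> \<open>A path of one vertex would be a common neighbour of \<open>Y'\<close> and
    \<open>y0\<close>, against the maximality of \<open>Y'\<close>.\<close>
  have len: "length ws \<ge> 2"
  proof (rule ccontr)
    assume "\<not> ?thesis"
    then have "length ws = 1" using ws(1) by (cases ws) (auto simp: Suc_le_eq)
    then have "ws ! 0 \<in> P" "ws ! 0 \<in> T" using wsP[of 0] wsT[of 0] by auto
    then have "\<forall>x\<in>insert y0 Y'. E (ws ! 0) x" "ws ! 0 \<in> Z"
      using sym[of y0] unfolding P_def T_def by auto
    then have "?P (insert y0 Y')" using Y' Y'' y by (intro conjI bexI[of _ "ws ! 0"]) auto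
    then have "card (insert y0 Y') \<le> card Y'" by (rule max)
    then show False using y fY' by simp
  qed
  let ?n = "length ws"
  define w where "w = ws ! (?n - 1)"
  define z where "z = ws ! 0"
  have lt: "0 < ?n" "?n - 1 < ?n" "?n - 1 \<noteq> 0" using len by auto
  have wz: "w \<in> T" "w \<notin> P" "z \<in> P" "z \<notin> T" "w \<in> Z" "z \<in> Z"
    using wsP[OF lt(1)] wsP[OF lt(2)] wsT[OF lt(1)] wsT[OF lt(2)] lt(3) nth_Z[OF lt(1)] nth_Z[OF lt(2)]
    unfolding w_def z_def by simp_all
  then have "w \<noteq> z" by blast
  note wz = wz this
  \<comment> \<open>Otherwise \<open>y'\<close>, the path from the last neighbour of
    \<open>y'\<close> up to \<open>w\<close>, and \<open>y0\<close> form an induced path of at least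
    four vertices of which \<open>v\<close> sees exactly the two ends.\<close>
  have wy: "E w y'" if "y' \<in> Y'" "\<not> E y' y0" for y'
  proof (rule ccontr)
    assume nw: "\<not> E w y'"
    let ?I = "{i. i < ?n \<and> E y' (ws ! i)}"
    define i where "i = Max ?I"
    have I: "finite ?I" "0 \<in> ?I" using wz(3) that len sym by (auto simp: z_def P_def)
    then have iI: "i \<in> ?I" unfolding i_def by (intro Max_in) auto
    have i_max: "j \<le> i" if "j \<in> ?I" for j using I that unfolding i_def by simp
    have "i \<noteq> ?n - 1" using iI nw sym unfolding w_def by auto
    then have i: "i < ?n - 1" using iI by auto
    let ?us = "drop i ws"
    have us: "ispath E ?us" "set ?us \<subseteq> Z" using ws ispath_drop set_drop_subset by fast+
    have nin: "y' \<notin> Z" "y0 \<notin> Z" "y' \<in> Y" "y0 \<in> Y" "y' \<noteq> y0" using that Y' y assms(5) by auto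
    have 1: "ispath E (y' # ?us)"
    proof (rule ispath_Cons[OF us(1)])
      show "y' \<notin> set ?us" using us nin by auto
      fix j assume j: "j < length ?us"
      then show "E y' (?us ! j) \<longleftrightarrow> j = 0" using iI i_max[of "i + j"] by auto
    qed
    have 2: "ispath E ((y' # ?us) @ [y0])"
    proof (rule ispath_snoc[OF 1 _ u])
      show "y0 \<notin> set (y' # ?us)" using us nin by auto
      fix j assume j: "j < length (y' # ?us)"
      show "E y0 ((y' # ?us) ! j) \<longleftrightarrow> j = length (y' # ?us) - 1"
      proof (cases j)
        case 0
        then show ?thesis using that(2) sym i by auto
      next
        case (Suc m)
        then have "E y0 ((y' # ?us) ! j) \<longleftrightarrow> ws ! (i + m) \<in> T"
          using j nth_Z[of "i + m"] unfolding T_def by auto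
        then show ?thesis using wsT[of "i + m"] j Suc i by auto
      qed
    qed
    have 3: "iscycle E (v # ((y' # ?us) @ [y0]))"
    proof (rule iscycle_Cons[OF 2])
      show "v \<notin> set ((y' # ?us) @ [y0])" using us nin assms(6,7) by auto
      show "2 \<le> length ((y' # ?us) @ [y0])" by simp
      fix j assume j: "j < length ((y' # ?us) @ [y0])"
      consider "j = 0" | "j = Suc (length ?us)" | m where "j = Suc m" "m < length ?us"
        using j by (cases j) (auto simp: less_Suc_eq)
      then show "E v (((y' # ?us) @ [y0]) ! j) \<longleftrightarrow> j = 0 \<or> j = length ((y' # ?us) @ [y0]) - 1"
      proof cases
        case 1 then show ?thesis using vY nin by simp
      next
        case 2 then show ?thesis using vY nin by (simp add: nth_append)
      next
        case 3
        then have "((y' # ?us) @ [y0]) ! j = ?us ! m" by (simp add: nth_append)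
        moreover have "?us ! m \<in> Z" using 3(2) us(2) nth_mem by blast
        ultimately show ?thesis using vZ 3 by auto
      qed
    qed
    have "5 \<le> length (v # ((y' # ?us) @ [y0]))" using i by simp
    moreover have "set (v # ((y' # ?us) @ [y0])) \<subseteq> insert v (Y \<union> Z)" using us nin by auto
    ultimately show False using nodisc 3 by blast
  qed
  \<comment> \<open>The same device in the complement: a shortest co-path inside \<open>Y'\<close>
    from a non-neighbour of \<open>w\<close> to a non-neighbour of \<open>y0\<close>. By
    \<open>wy\<close> no vertex is both, so the co-path has at least two vertices.\<close>
  define P2 where "P2 = {y\<in>Y'. \<not> E w y}"
  define T2 where "T2 = {y\<in>Y'. \<not> E y y0}"
  have uc: "ugraph (co E)" using u by (rule ugraph_co)
  have "P2 \<noteq> {}" using wz unfolding P_def P2_def by auto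
  moreover have "T2 \<noteq> {}" using y unfolding T2_def co_def by auto
  moreover have "P2 \<subseteq> Y'" "T2 \<subseteq> Y'" unfolding P2_def T2_def by auto
  moreover have "conn (co E) Y'" using Y' by blast
  ultimately obtain us where us: "us \<noteq> []" "ispath (co E) us" "set us \<subseteq> Y'"
    and usP: "\<And>i. i < length us \<Longrightarrow> us ! i \<in> P2 \<longleftrightarrow> i = 0"
    and usT: "\<And>i. i < length us \<Longrightarrow> us ! i \<in> T2 \<longleftrightarrow> i = length us - 1"
    using shortest_path[of "co E" Y' P2 T2] by metis
  have nth_Y: "us ! i \<in> Y'" if "i < length us" for i using us(3) that nth_mem by blast
  have disj: "Y' \<inter> Z = {}" "y0 \<notin> Z" "y0 \<in> Y" "y0 \<notin> Y'" "Y' \<subseteq> Y" using Y' y assms(5) by auto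
  have len2: "length us \<ge> 2"
  proof (rule ccontr)
    assume "\<not> ?thesis"
    then have "length us = 1" using us(1) by (cases us) (auto simp: Suc_le_eq)
    then have "us ! 0 \<in> P2" "us ! 0 \<in> T2" using usP[of 0] usT[of 0] by auto
    then show False using wy unfolding P2_def T2_def by auto
  qed
  have 1: "ispath (co E) (w # us)"
  proof (rule ispath_Cons[OF us(2)])
    show "w \<notin> set us" using us(3) wz disj by auto
    fix j assume j: "j < length us"
    show "co E w (us ! j) \<longleftrightarrow> j = 0" using usP[OF j] nth_Y[OF j] wz(5) disj unfolding P2_def co_def by auto
  qed
  have 2: "ispath (co E) ((w # us) @ [y0])"
  proof (rule ispath_snoc[OF 1 _ uc])
    show "y0 \<notin> set (w # us)" using us(3) wz disj by auto
    fix j assume j: "j < length (w # us)"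
    show "co E y0 ((w # us) ! j) \<longleftrightarrow> j = length (w # us) - 1"
    proof (cases j)
      case 0
      then show ?thesis using wz(1) us(1) unfolding T_def co_def by auto
    next
      case (Suc m)
      then have m: "m < length us" using j by simp
      then have "co E y0 ((w # us) ! j) \<longleftrightarrow> us ! m \<in> T2"
        using nth_Y[OF m] disj Suc sym unfolding T2_def co_def by auto
      then show ?thesis using usT[OF m] Suc m by auto
    qed
  qed
  have zc: "co E z (((w # us) @ [y0]) ! j) \<longleftrightarrow> j = Suc (length us) \<or> j = 0 \<and> \<not> E z w"
    if "j < length ((w # us) @ [y0])" for j
  proof -
    note j = that
    consider "j = 0" | "j = Suc (length us)" | m where "j = Suc m" "m < length us"
      using j by (cases j) (auto simp: less_Suc_eq)
    then show ?thesis
    proof cases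
      case 1 then show ?thesis using wz by (simp add: co_def)
    next
      case 2
      then have "((w # us) @ [y0]) ! j = y0" by (simp add: nth_append)
      then show ?thesis using 2 wz disj sym unfolding co_def T_def by auto
    next
      case 3
      then have "((w # us) @ [y0]) ! j = us ! m" by (simp add: nth_append)
      then show ?thesis using nth_Y[of m] 3 wz(3) unfolding P_def co_def by auto
    qed
  qed
  have znot: "z \<notin> set ((w # us) @ [y0])" using us(3) wz disj by auto
  \<comment> \<open>On the co-path from \<open>w\<close> to \<open>y0\<close> the vertex
    \<open>z\<close> is co-adjacent to \<open>y0\<close>, to nothing in \<open>Y'\<close>, and to
    \<open>w\<close> precisely if it misses \<open>w\<close>. In that case \<open>z\<close> closes
    an antihole. Otherwise \<open>z\<close> prolongs the co-path, and \<open>v\<close> closes it,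
    being co-adjacent to \<open>w\<close> and \<open>z\<close> only.\<close>
  show False
  proof (cases "E z w")
    case False
    have "iscycle (co E) (z # ((w # us) @ [y0]))"
      using zc False by (intro iscycle_Cons[OF 2 znot]) auto
    moreover have "5 \<le> length (z # ((w # us) @ [y0]))" using len2 by simp
    moreover have "set (z # ((w # us) @ [y0])) \<subseteq> insert v (Y \<union> Z)" using us(3) wz disj by auto
    ultimately show False using nodisc by blast
  next
    case True
    have 3: "ispath (co E) (((w # us) @ [y0]) @ [z])"
      using zc True by (intro ispath_snoc[OF 2 znot uc]) auto
    have "iscycle (co E) (v # (((w # us) @ [y0]) @ [z]))"
    proof (rule iscycle_Cons[OF 3])
      show "v \<notin> set (((w # us) @ [y0]) @ [z])" using us(3) wz disj assms(6,7) by auto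
      show "2 \<le> length (((w # us) @ [y0]) @ [z])" by simp
      fix j assume j: "j < length (((w # us) @ [y0]) @ [z])"
      consider "j = 0" | "j = Suc (length us)" | "j = Suc (Suc (length us))" | m where "j = Suc m" "m < length us"
        using j by (cases j) (auto simp: less_Suc_eq)
      then show "co E v ((((w # us) @ [y0]) @ [z]) ! j) \<longleftrightarrow> j = 0 \<or> j = length (((w # us) @ [y0]) @ [z]) - 1"
      proof cases
        case 1 then show ?thesis using vZ wz assms(7) by (auto simp: co_def)
      next
        case 2
        then have "(((w # us) @ [y0]) @ [z]) ! j = y0" by (simp add: nth_append)
        then show ?thesis using 2 vY disj by (auto simp: co_def)
      next
        case 3
        then have "(((w # us) @ [y0]) @ [z]) ! j = z" by (simp add: nth_append)
        then show ?thesis using 3 vZ wz assms(7) by (auto simp: co_def)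
      next
        case 4
        then have "(((w # us) @ [y0]) @ [z]) ! j = us ! m" by (simp add: nth_append)
        then show ?thesis using nth_Y[of m] 4 vY disj by (auto simp: co_def)
      qed
    qed
    moreover have "5 \<le> length (v # (((w # us) @ [y0]) @ [z]))" using len2 by simp
    moreover have "set (v # (((w # us) @ [y0]) @ [z])) \<subseteq> insert v (Y \<union> Z)" using us(3) wz disj by auto
    ultimately show False using nodisc by blast
  qed
qed

lemma minimp_card_ge_2:
  assumes "minimp E V" "v \<in> V" shows "\<exists>w\<in>V. w \<noteq> v"
proof (rule ccontr)
  assume "\<not> ?thesis"
  then have V: "V = {v}" using assms(2) by blast
  have u: "ugraph E" using assms by (simp add: minimp_def)
  have "omega E V \<ge> 1" using card_clq_le_omega[of V V E] V by (simp add: clq_def)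
  then have "colorable E V (omega E V)"
    using V ugraphD(2)[OF u] unfolding colorable_def by (intro exI[of _ "\<lambda>_. 0"]) auto
  then show False using assms by (simp add: minimp_def)
qed

text \<open>The closed neighbourhood of \<open>v\<close> is a star, so it cannot cut
  \<open>Z\<close> apart, and without \<open>y\<close> it cannot separate \<open>y\<close> from
  \<open>Z\<close>. If \<open>Z\<close> were empty, \<open>Y\<close> would be homogeneous, which
  leaves at most two vertices.\<close>

lemma minimp_neighbourhood:
  assumes "minimp E V" "v \<in> V"
  defines "Y \<equiv> {y\<in>V. E v y}" and "Z \<equiv> {z\<in>V. z \<noteq> v \<and> \<not> E v z}"
  shows "Z \<noteq> {}" "conn E Z" "\<And>y. y \<in> Y \<Longrightarrow> \<exists>z\<in>Z. E y z"
proof -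
  have u: "ugraph E" using assms by (simp add: minimp_def)
  have vv: "\<not> E v v" using ugraphD(2)[OF u] .
  have part: "V = insert v Y \<union> Z" using assms(2) by (auto simp: Y_def Z_def)
  have star: "\<forall>x\<in>insert v Y. x = v \<or> E v x" by (auto simp: Y_def)
  show Zne: "Z \<noteq> {}"
  proof
    assume "Z = {}"
    then have V: "V = insert v Y" using part by simp
    obtain w where w: "w \<in> V" "w \<noteq> v" using minimp_card_ge_2[OF assms(1,2)] by blast
    have "homog E V Y" unfolding homog_def V by (auto simp: Y_def)
    then have Y1: "\<forall>a\<in>Y. \<forall>b\<in>Y. a = b"
      using minimp_prime[OF assms(1)] vv assms(2) unfolding prime_def by (auto simp: Y_def)
    then have Y2: "Y = {w}" using w V by auto
    have VV: "V = {v, w}" using V Y2 by simp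
    have Evw: "E v w" "E w v" using Y2 ugraphD(1)[OF u] by (auto simp: Y_def)
    have "omega E V \<ge> 2" using card_clq_le_omega[of V V E] VV w Evw by (simp add: clq_def)
    then have "colorable E V (omega E V)"
      using VV w ugraphD(2)[OF u] unfolding colorable_def
      by (intro exI[of _ "\<lambda>x. if x = v then 0 else 1"]) auto
    then show False using assms by (simp add: minimp_def)
  qed
  show "conn E Z"
    unfolding conn_def
  proof (intro allI impI, rule ccontr)
    fix A B assume AB: "A \<union> B = Z \<and> A \<inter> B = {} \<and> A \<noteq> {} \<and> B \<noteq> {}" "\<not> (\<exists>a\<in>A. \<exists>b\<in>B. E a b)"
    show False
    proof (rule minimp_star_cutset[OF assms(1) _ star])
      show "V = insert v Y \<union> A \<union> B" using part AB by auto
      show "A \<inter> insert v Y = {}" "B \<inter> insert v Y = {}" using AB by (auto simp: Y_def Z_def)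
    qed (use AB in auto)
  qed
  fix y assume y: "y \<in> Y"
  show "\<exists>z\<in>Z. E y z"
  proof (rule ccontr)
    assume n: "\<not> ?thesis"
    have "y \<noteq> v" using y vv by (auto simp: Y_def)
    show False
    proof (rule minimp_star_cutset[OF assms(1), of v "insert v (Y - {y})" "{y}" Z])
      show "\<forall>x\<in>insert v (Y - {y}). x = v \<or> E v x" using star by auto
      show "V = insert v (Y - {y}) \<union> {y} \<union> Z" using part y by auto
    qed (use y n Zne \<open>y \<noteq> v\<close> in \<open>auto simp: Y_def Z_def\<close>)
  qed
qed

text \<open>This is Hayward's theorem that weakly chordal graphs are perfect. The neighbourhood
  lemma for the graph and for its complement supplies the hypotheses of
  \<open>complete_vertex_or_disc\<close>, and its last part for the complement denies a vertex of
  \<open>Z\<close> complete to \<open>Y\<close>.\<close>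

theorem minimp_disc:
  assumes "minimp E V"
  obtains xs where "5 \<le> length xs" "set xs \<subseteq> V" "iscycle E xs \<or> iscycle (co E) xs"
proof -
  have u: "ugraph E" and f: "finite V" using assms by (auto simp: minimp_def)
  have "V \<noteq> {}" using assms by (auto simp: minimp_def colorable_def)
  then obtain v where v: "v \<in> V" by blast
  define Y where "Y = {y\<in>V. E v y}"
  define Z where "Z = {z\<in>V. z \<noteq> v \<and> \<not> E v z}"
  have Y: "Y = {z\<in>V. z \<noteq> v \<and> \<not> co E v z}" and Z: "Z = {y\<in>V. co E v y}"
    using ugraphD(2)[OF u, of v] by (auto simp: Y_def Z_def co_def)
  note G = minimp_neighbourhood[OF assms v, folded Y_def Z_def]
  note C = minimp_neighbourhood[OF minimp_co[OF assms] v, folded Y Z]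
  have "(\<exists>z\<in>Z. \<forall>y\<in>Y. E z y) \<or>
    (\<exists>xs. 5 \<le> length xs \<and> set xs \<subseteq> insert v (Y \<union> Z) \<and> (iscycle E xs \<or> iscycle (co E) xs))"
  proof (rule complete_vertex_or_disc[OF u _ C(1) G(1) _ _ _ G(2) C(2) G(3)])
    show "finite Y" using f by (simp add: Y_def)
    show "v \<notin> Y" using ugraphD(2)[OF u] by (simp add: Y_def)
  qed (auto simp: Y_def Z_def)
  moreover have "\<not> (\<exists>z\<in>Z. \<forall>y\<in>Y. E z y)" using C(3) by (auto simp: co_def)
  ultimately obtain xs where xs: "5 \<le> length xs" "set xs \<subseteq> insert v (Y \<union> Z)"
    "iscycle E xs \<or> iscycle (co E) xs" by blast
  have "insert v (Y \<union> Z) \<subseteq> V" using v by (auto simp: Y_def Z_def)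
  with xs(2) have "set xs \<subseteq> V" by (rule subset_trans)
  show ?thesis by (rule that[OF xs(1) \<open>set xs \<subseteq> V\<close> xs(3)])
qed

subsection \<open>The P4-structure at a vertex outside a prime set\<close>

text \<open>The twelve labelled paths on \<open>a\<close>, \<open>b\<close>, \<open>c\<close>,
  \<open>d\<close>. Taking six truth values as arguments turns statements about small configurations
  into propositional formulas that \<open>satx\<close> decides.\<close>

definition p4b :: "bool \<Rightarrow> bool \<Rightarrow> bool \<Rightarrow> bool \<Rightarrow> bool \<Rightarrow> bool \<Rightarrow> bool" where
  "p4b ab ac ad bc bd cd \<longleftrightarrow>
     (ab \<and> \<not> ac \<and> \<not> ad \<and> bc \<and> \<not> bd \<and> cd) \<or>
     (ab \<and> \<not> ac \<and> \<not> ad \<and> \<not> bc \<and> bd \<and> cd) \<or>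
     (\<not> ab \<and> ac \<and> \<not> ad \<and> bc \<and> bd \<and> \<not> cd) \<or>
     (\<not> ab \<and> ac \<and> \<not> ad \<and> \<not> bc \<and> bd \<and> cd) \<or>
     (\<not> ab \<and> \<not> ac \<and> ad \<and> bc \<and> bd \<and> \<not> cd) \<or>
     (\<not> ab \<and> \<not> ac \<and> ad \<and> bc \<and> \<not> bd \<and> cd) \<or>
     (ab \<and> ac \<and> \<not> ad \<and> \<not> bc \<and> \<not> bd \<and> cd) \<or>
     (ab \<and> \<not> ac \<and> ad \<and> \<not> bc \<and> \<not> bd \<and> cd) \<or>
     (\<not> ab \<and> ac \<and> ad \<and> bc \<and> \<not> bd \<and> \<not> cd) \<or>
     (\<not> ab \<and> ac \<and> ad \<and> \<not> bc \<and> bd \<and> \<not> cd) \<or>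
     (ab \<and> ac \<and> \<not> ad \<and> \<not> bc \<and> bd \<and> \<not> cd) \<or>
     (ab \<and> \<not> ac \<and> ad \<and> bc \<and> \<not> bd \<and> \<not> cd)"

definition P4on :: "('a \<Rightarrow> 'a \<Rightarrow> bool) \<Rightarrow> 'a \<Rightarrow> 'a \<Rightarrow> 'a \<Rightarrow> 'a \<Rightarrow> bool" where
  "P4on E a b c d \<longleftrightarrow> p4b (E a b) (E a c) (E a d) (E b c) (E b d) (E c d)"

definition p4iso :: "('a \<Rightarrow> 'a \<Rightarrow> bool) \<Rightarrow> ('a \<Rightarrow> 'a \<Rightarrow> bool) \<Rightarrow> 'a set \<Rightarrow> bool" where
  "p4iso E F V \<longleftrightarrow> (\<forall>a\<in>V. \<forall>b\<in>V. \<forall>c\<in>V. \<forall>d\<in>V. distinct [a, b, c, d] \<longrightarrow>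
     (P4on E a b c d \<longleftrightarrow> P4on F a b c d))"

text \<open>P4 is self-complementary; hence a graph and its complement have the same
  P4-structure.\<close>

lemma p4b_neg: "p4b (\<not> ab) (\<not> ac) (\<not> ad) (\<not> bc) (\<not> bd) (\<not> cd) = p4b ab ac ad bc bd cd"
  unfolding p4b_def by (cases ab; cases ac; cases ad; cases bc; cases bd; cases cd) simp_all

lemma P4on_co: "distinct [a, b, c, d] \<Longrightarrow> P4on (co E) a b c d \<longleftrightarrow> P4on E a b c d"
  unfolding P4on_def co_def by (simp add: p4b_neg)

lemma p4iso_co1: "p4iso (co E) F V \<longleftrightarrow> p4iso E F V"
  unfolding p4iso_def by (metis P4on_co)

lemma p4iso_co2: "p4iso E (co F) V \<longleftrightarrow> p4iso E F V"
  unfolding p4iso_def by (metis P4on_co)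

lemma homog_co:
  assumes "homog E S M" shows "homog (co E) S M"
  using assms unfolding homog_def co_def by blast

lemma prime_co:
  assumes "ugraph E" shows "prime (co E) S \<longleftrightarrow> prime E S"
  using homog_co[of E S] homog_co[of "co E" S] unfolding prime_def co_co[OF assms] by blast

lemma primeD:
  assumes "prime E S" "homog E S M" "a \<in> M" "b \<in> M" "a \<noteq> b" shows "M = S"
  using assms unfolding prime_def by blast

text \<open>The component \<open>K\<close> of \<open>a\<close> under \<open>R\<close> within
  \<open>X\<close> is homogeneous: vertices outside \<open>X\<close> do not separate related
  vertices, and a vertex of \<open>X\<close> outside \<open>K\<close> is unrelated to all of
  \<open>K\<close>, so its adjacency to \<open>K\<close> is the constant \<open>B\<close>. As
  \<open>K\<close> contains \<open>a\<close> and \<open>b\<close>, primality makes it all of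
  \<open>S\<close>.\<close>

lemma prime_closure:
  assumes pr: "prime E S" and "X \<subseteq> S" "a \<in> X" "b \<in> X" "a \<noteq> b" "R a b" and symR: "\<And>u v. R u v \<Longrightarrow> R v u"
    and out: "\<And>x u v. x \<in> S - X \<Longrightarrow> u \<in> X \<Longrightarrow> v \<in> X \<Longrightarrow> R u v \<Longrightarrow> E x u \<Longrightarrow> E x v"
    and ins: "\<And>u v. u \<in> X \<Longrightarrow> v \<in> X \<Longrightarrow> u \<noteq> v \<Longrightarrow> \<not> R u v \<Longrightarrow> E u v \<longleftrightarrow> B"
  shows "X = S"
proof -
  let ?T = "{(u, v). u \<in> X \<and> v \<in> X \<and> R u v}"
  define K where "K = {x. (a, x) \<in> ?T\<^sup>*}"
  have KX0: "x \<in> X" if "(a, x) \<in> ?T\<^sup>*" for x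
    using that assms(3) by (induction rule: rtrancl_induct) auto
  have KX: "K \<subseteq> X" 
  proof
    fix x assume "x \<in> K" then show "x \<in> X" unfolding K_def mem_Collect_eq by (rule KX0)
  qed
  have aK: "a \<in> K" by (simp add: K_def)
  have bK: "b \<in> K" unfolding K_def mem_Collect_eq by (rule r_into_rtrancl) (use assms(3,4,6) in simp)
  have step: "v \<in> K" if "u \<in> K" "v \<in> X" "R u v" for u v
  proof -
    have 1: "(a, u) \<in> ?T\<^sup>*" using that(1) by (simp add: K_def)
    have "u \<in> X" using that(1) KX by (rule rev_subsetD)
    then have 2: "(u, v) \<in> ?T" using that by simp
    show ?thesis unfolding K_def by (rule CollectI) (rule rtrancl_into_rtrancl[OF 1 2])
  qed
  have "homog E S K"
    unfolding homog_def
  proof (intro conjI ballI impI)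
    show "K \<subseteq> S" using KX assms(2) by (rule subset_trans)
    fix x u v assume x: "x \<in> S - K" and uv: "u \<in> K" "v \<in> K" "E x u"
    show "E x v"
    proof (cases "x \<in> X")
      case True
      have "E x w \<longleftrightarrow> B" if "w \<in> K" for w
      proof (rule ins[OF True])
        show "w \<in> X" using that KX by (rule rev_subsetD)
        show "x \<noteq> w" using x that by blast
        show "\<not> R x w" using step[OF that True] symR x by blast
      qed
      then show ?thesis using uv by blast
    next
      case False
      then have xS: "x \<in> S - X" using x by blast
      have 1: "E x a \<longleftrightarrow> E x w" if "(a, w) \<in> ?T\<^sup>*" for w
        using that
      proof (induction rule: rtrancl_induct)
        case (step y z)
        then have "R y z" "R z y" "y \<in> X" "z \<in> X" using symR by auto
        then show ?case using step.IH out[OF xS] by blast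
      qed simp
      have "E x a \<longleftrightarrow> E x w" if "w \<in> K" for w
        using that unfolding K_def mem_Collect_eq by (rule 1)
      then show ?thesis using uv by blast
    qed
  qed
  then have "K = S" by (rule primeD[OF pr _ aK bK assms(5)])
  then show ?thesis using KX assms(2) by (simp add: subset_antisym)
qed

text \<open>Here \<open>g\<close> and \<open>h\<close> are two candidates for the neighbourhood in
  \<open>S\<close> of one vertex outside \<open>S\<close>, and no P4 through that vertex and three
  vertices of \<open>S\<close> tells them apart.\<close>

definition amb :: "('a \<Rightarrow> 'a \<Rightarrow> bool) \<Rightarrow> 'a set \<Rightarrow> ('a \<Rightarrow> bool) \<Rightarrow> ('a \<Rightarrow> bool) \<Rightarrow> bool" where
  "amb E S g h \<longleftrightarrow> (\<forall>a\<in>S. \<forall>b\<in>S. \<forall>c\<in>S. distinct [a, b, c] \<longrightarrow>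
     (p4b (g a) (g b) (g c) (E a b) (E a c) (E b c) \<longleftrightarrow> p4b (h a) (h b) (h c) (E a b) (E a c) (E b c)))"

text \<open>\<open>S\<close> splits into the cliques \<open>g\<close> and \<open>h\<close> without
  edges between them and a stable remainder.\<close>

definition flips :: "('a \<Rightarrow> 'a \<Rightarrow> bool) \<Rightarrow> 'a set \<Rightarrow> ('a \<Rightarrow> bool) \<Rightarrow> ('a \<Rightarrow> bool) \<Rightarrow> bool" where
  "flips E S g h \<longleftrightarrow> (\<forall>s\<in>S. \<not> (g s \<and> h s)) \<and>
     (\<forall>s\<in>S. \<forall>t\<in>S. s \<noteq> t \<longrightarrow> (g s \<and> g t \<or> h s \<and> h t \<longrightarrow> E s t) \<and> (g s \<and> h t \<longrightarrow> \<not> E s t) \<and>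
        (\<not> g s \<and> \<not> h s \<and> \<not> g t \<and> \<not> h t \<longrightarrow> \<not> E s t))"

definition unif :: "'a set \<Rightarrow> ('a \<Rightarrow> bool) \<Rightarrow> bool" where
  "unif S g \<longleftrightarrow> (\<forall>s\<in>S. g s) \<or> (\<forall>s\<in>S. \<not> g s)"

text \<open>A copy of \<open>m\<close>, be it a true or a false twin: the value at \<open>m\<close>
  itself is left open.\<close>

definition twin :: "('a \<Rightarrow> 'a \<Rightarrow> bool) \<Rightarrow> 'a set \<Rightarrow> 'a \<Rightarrow> ('a \<Rightarrow> bool) \<Rightarrow> bool" where
  "twin E S m g \<longleftrightarrow> (\<forall>s\<in>S - {m}. g s \<longleftrightarrow> E m s)"

lemma ambD:
  assumes "amb E S g h" "a \<in> S" "b \<in> S" "c \<in> S" "a \<noteq> b" "a \<noteq> c" "b \<noteq> c"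
  shows "p4b (g a) (g b) (g c) (E a b) (E a c) (E b c) \<longleftrightarrow> p4b (h a) (h b) (h c) (E a b) (E a c) (E b c)"
  using assms unfolding amb_def by simp

lemma amb_swap: "amb E S g h \<Longrightarrow> amb E S h g"
  unfolding amb_def by simp

lemma amb_co:
  assumes "amb E S g h" shows "amb (co E) S (\<lambda>x. \<not> g x) (\<lambda>x. \<not> h x)"
  unfolding amb_def
proof (intro ballI impI)
  fix a b c assume "a \<in> S" "b \<in> S" "c \<in> S" "distinct [a, b, c]"
  then show "p4b (\<not> g a) (\<not> g b) (\<not> g c) (co E a b) (co E a c) (co E b c) =
    p4b (\<not> h a) (\<not> h b) (\<not> h c) (co E a b) (co E a c) (co E b c)"
    using ambD[OF assms, of a b c] by (simp add: co_def p4b_neg)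
qed

text \<open>If the conclusion failed, the outer vertex and \<open>c\<close>, \<open>w\<close>,
  \<open>m\<close> would form a P4 in exactly one of the two readings. The next three lemmas hold
  for the same reason; they differ in how the readings treat \<open>c\<close>.\<close>

lemma amb_neither:
  assumes "ugraph E" "amb E S g h" "c \<in> S" "w \<in> S" "m \<in> S" "\<not> g c" "\<not> h c" "E c w" "E c m"
    "g w = h w" "g m \<noteq> h m"
  shows "E w m"
proof -
  have ne: "c \<noteq> w" "c \<noteq> m" "w \<noteq> m" using assms ugraphD(2)[OF assms(1)] by auto
  have "E w m = E m w" by (rule ugraphD(1)[OF assms(1)])
  then show ?thesis using ambD[OF assms(2,3,4,5) ne] assms(6-) unfolding p4b_def by auto
qed

lemma amb_one_nonadj:
  assumes "ugraph E" "amb E S g h" "c \<in> S" "a \<in> S" "b \<in> S" "g c" "\<not> h c" "\<not> E c a" "\<not> E c b"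
    "g a" "\<not> g b" "a \<noteq> c"
  shows "\<not> E a b"
proof -
  have ne: "c \<noteq> a" "c \<noteq> b" "a \<noteq> b" using assms by auto
  show ?thesis using ambD[OF assms(2,3,4,5) ne] assms(6-) unfolding p4b_def by auto
qed

lemma amb_one_adj:
  assumes "ugraph E" "amb E S g h" "c \<in> S" "a \<in> S" "b \<in> S" "g c" "\<not> h c" "E c a" "E c b"
    "h a" "\<not> h b"
  shows "E a b"
proof -
  have ne: "c \<noteq> a" "c \<noteq> b" "a \<noteq> b" using assms ugraphD(2)[OF assms(1)] by auto
  show ?thesis using ambD[OF assms(2,3,4,5) ne] assms(6-) unfolding p4b_def by auto
qed

lemma amb_both:
  assumes "ugraph E" "amb E S g h" "c \<in> S" "w \<in> S" "m \<in> S" "g c" "h c" "\<not> E c w" "\<not> E c m"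
    "g w = h w" "g m \<noteq> h m" "c \<noteq> w"
  shows "\<not> E w m"
proof -
  have ne: "c \<noteq> w" "c \<noteq> m" "w \<noteq> m" using assms by auto
  show ?thesis using ambD[OF assms(2,3,4,5) ne] assms(6-) unfolding p4b_def by auto
qed

text \<open>Each requirement of \<open>flips\<close> comes from primality. Two non-adjacent vertices
  of \<open>g\<close>, or of \<open>h\<close>, or an edge in the remainder would spread by
  \<open>prime_closure\<close> until that class is all of \<open>S\<close>. One edge between
  \<open>g\<close> and \<open>h\<close> would spread to all pairs and make their union a homogeneous
  clique.\<close>

lemma amb_disjoint_unif_or_flips:
  assumes u: "ugraph E" and pr: "prime E S" and am: "amb E S g h"
    and three: "\<And>a b. \<exists>c\<in>S. c \<noteq> a \<and> c \<noteq> b"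
    and dis: "\<And>s. s \<in> S \<Longrightarrow> \<not> (g s \<and> h s)" and m: "m \<in> S" "g m \<noteq> h m"
  shows "unif S g \<and> unif S h \<or> flips E S g h"
proof (rule ccontr)
  assume neg: "\<not> ?thesis"
  note sym = ugraphD(1)[OF u] and irr = ugraphD(2)[OF u]
  have clique: "E a b" if am': "amb E S g' h'" and dis': "\<And>s. s \<in> S \<Longrightarrow> \<not> (g' s \<and> h' s)"
    and ab: "a \<in> S" "b \<in> S" "g' a" "g' b" "a \<noteq> b" and nu: "\<not> (unif S g' \<and> unif S h')" for g' h' a b
  proof (rule ccontr)
    assume nE: "\<not> E a b"
    let ?X = "{x\<in>S. g' x}"
    have "?X = S"
    proof (rule prime_closure[OF pr, of ?X a b "\<lambda>u v. \<not> E u v" True])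
      show "\<not> E v w" if "\<not> E w v" for v w using that sym[of v w] by simp
      fix x v w assume *: "x \<in> S - ?X" "v \<in> ?X" "w \<in> ?X" "\<not> E v w" "E x v"
      show "E x w"
      proof (rule ccontr)
        assume n: "\<not> E x w"
        have "v \<noteq> w" using * n by blast
        then have "\<not> E v x" using amb_one_nonadj[OF u am', of w v x] * n dis'[of w] sym[of w] by auto
        then show False using * sym[of x v] by simp
      qed
    qed (use ab nE in auto)
    then have "unif S g' \<and> unif S h'" using dis' unfolding unif_def by auto
    then show False using nu by blast
  qed
  have Cg: "E a b" if "a \<in> S" "b \<in> S" "g a" "g b" "a \<noteq> b" for a b
    using clique[OF am dis that] neg by blast
  have Ch: "E a b" if "a \<in> S" "b \<in> S" "h a" "h b" "a \<noteq> b" for a b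
    using clique[OF amb_swap[OF am] _ that] neg dis by blast
  have no: "\<not> E a b" if ab: "a \<in> S" "b \<in> S" "g a" "h b" for a b
  proof
    assume Eab: "E a b"
    have spread: "E a' b'" if "E x y" "a' \<in> S" "b' \<in> S" "g a'" "h b'" "x \<in> S" "y \<in> S" "g x" "h y" for a' b' x y
    proof -
      have "E a' y"
      proof (cases "a' = x")
        case False
        then have "E y a'" using amb_one_adj[OF u am, of x y a'] that dis[of x] dis[of a'] Cg[of x a'] by auto
        then show ?thesis using sym[of y a'] by simp
      qed (use that in simp)
      then have "E y a'" using sym[of y a'] by simp
      show ?thesis
      proof (cases "b' = y")
        case False
        then show ?thesis
          using amb_one_adj[OF u amb_swap[OF am], of y a' b'] that dis[of y] dis[of b'] Ch[of y b'] \<open>E y a'\<close> by auto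
      qed (use \<open>E a' y\<close> in simp)
    qed
    have all: "E a' b'" if "a' \<in> S" "b' \<in> S" "g a'" "h b'" for a' b'
      by (rule spread[OF Eab that ab(1,2,3,4)])
    let ?X = "{x\<in>S. g x \<or> h x}"
    have X: "E x y" if "x \<in> ?X" "y \<in> ?X" "x \<noteq> y" for x y
      using that Cg[of x y] Ch[of x y] all[of x y] all[of y x] sym[of x y] by auto
    have "homog E S ?X"
      unfolding homog_def
    proof (intro conjI ballI impI)
      fix x v w assume x: "x \<in> S - ?X" and vw: "v \<in> ?X" "w \<in> ?X" "E x v"
      have gh: "E x b'" if "E x a'" "a' \<in> S" "b' \<in> S" "g a'" "h b'" for a' b'
        using amb_one_adj[OF u am, of a' b' x] that x all[of a' b'] dis[of a'] sym[of x] by auto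
      have hg: "E x a'" if "E x b'" "a' \<in> S" "b' \<in> S" "g a'" "h b'" for a' b'
        using amb_one_adj[OF u amb_swap[OF am], of b' a' x] that x all[of a' b'] dis[of b'] sym by auto
      have gg: "E x b" if "E x a'" "a' \<in> S" "g a'" for a' using gh[of a' b] that ab by auto
      have hh: "E x a" if "E x b'" "b' \<in> S" "h b'" for b' using hg[of b' a] that ab by auto
      have "E x a" "E x b" using vw gg hh gh[of a b] hg[of b a] ab by auto
      then show "E x w" using vw gh[of a w] hg[of b w] ab by auto
    qed auto
    moreover have "a \<noteq> b" using ab dis by blast
    ultimately have XS: "?X = S" using primeD[OF pr, of ?X a b] ab by auto
    \<comment> \<open>Now \<open>S\<close> is a clique with at least three vertices, in which every
      pair is homogeneous.\<close>
    obtain c where c: "c \<in> S" "c \<noteq> a" "c \<noteq> b" using three by blast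
    have "homog E S {a, b}" unfolding homog_def using X XS ab by auto
    then have "{a, b} = S" using primeD[OF pr, of "{a, b}" a b] \<open>a \<noteq> b\<close> by auto
    then show False using c by auto
  qed
  have st: "\<not> E s t" if st: "s \<in> S" "t \<in> S" "\<not> g s" "\<not> h s" "\<not> g t" "\<not> h t" for s t
  proof
    assume Est: "E s t"
    let ?X = "{x\<in>S. \<not> g x \<and> \<not> h x}"
    have "?X = S"
    proof (rule prime_closure[OF pr, of ?X s t E False])
      show "E w v" if "E v w" for v w using that sym[of v w] by simp
      show "s \<noteq> t" using Est irr by auto
      fix x v w assume *: "x \<in> S - ?X" "v \<in> ?X" "w \<in> ?X" "E v w" "E x v"
      have "E w x" using amb_neither[OF u am, of v w x] * dis[of x] sym[of v x] by auto
      then show "E x w" using sym[of x w] by simp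
    qed (use st Est in auto)
    then show False using m by auto
  qed
  have "flips E S g h"
    unfolding flips_def
  proof (intro conjI ballI impI)
    show "\<not> (g s \<and> h s)" if "s \<in> S" for s using dis that .
  qed (use Cg Ch no st in \<open>blast+\<close>)
  then show False using neg by blast
qed

text \<open>\<open>M\<close> is the set where the readings differ. Join to it the vertices on which
  they agree but which some vertex of \<open>M\<close> sees the wrong way: \<open>Q\<close> from the
  common neighbours, \<open>R\<close> from the common non-neighbours. The union is homogeneous, so
  if \<open>M\<close> is non-empty, it is a single vertex, of which both readings are copies, or
  everything. In the latter case \<open>Q\<close> and \<open>R\<close> cannot both occur, which
  leaves disjoint readings or the same in the complement.\<close>

theorem ambiguity:
  assumes u: "ugraph E" and pr: "prime E S" and am: "amb E S g h"
    and three: "\<And>a b. \<exists>c\<in>S. c \<noteq> a \<and> c \<noteq> b"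
  obtains "\<forall>s\<in>S. g s = h s"
    | m where "m \<in> S" "twin E S m g" "twin E S m h"
    | "unif S g" "unif S h"
    | "flips E S g h"
    | "flips (co E) S (\<lambda>x. \<not> g x) (\<lambda>x. \<not> h x)"
proof -
  note sym = ugraphD(1)[OF u] and irr = ugraphD(2)[OF u]
  note am' = amb_swap[OF am]
  have sep: "\<not> E a b" if "c \<in> S" "a \<in> S" "b \<in> S" "g c \<noteq> h c" "\<not> E c a" "\<not> E c b" "g a" "h a" "\<not> g b" "\<not> h b"
    for a b c
  proof (cases "g c")
    case True
    show ?thesis by (rule amb_one_nonadj[OF u am, of c]) (use that True in auto)
  next
    case False
    show ?thesis by (rule amb_one_nonadj[OF u am', of c]) (use that False in auto)
  qed
  have join: "E a b" if "c \<in> S" "a \<in> S" "b \<in> S" "g c \<noteq> h c" "E c a" "E c b" "g a" "h a" "\<not> g b" "\<not> h b"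
    for a b c
  proof (cases "g c")
    case True
    show ?thesis by (rule amb_one_adj[OF u am, of c]) (use that True in auto)
  next
    case False
    show ?thesis by (rule amb_one_adj[OF u am', of c]) (use that False in auto)
  qed
  define M where "M = {s\<in>S. g s \<noteq> h s}"
  define Q where "Q = {s\<in>S. g s \<and> h s \<and> (\<exists>m\<in>M. \<not> E m s)}"
  define R where "R = {s\<in>S. \<not> g s \<and> \<not> h s \<and> (\<exists>m\<in>M. E m s)}"
  have hom: "homog E S (M \<union> Q \<union> R)"
    unfolding homog_def
  proof (intro conjI ballI impI)
    show "M \<union> Q \<union> R \<subseteq> S" by (auto simp: M_def Q_def R_def)
    fix x a b assume x: "x \<in> S - (M \<union> Q \<union> R)" and ab: "a \<in> M \<union> Q \<union> R" "b \<in> M \<union> Q \<union> R" "E x a"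
    have xS: "x \<in> S" "g x = h x" using x by (auto simp: M_def)
    show "E x b"
    proof (cases "g x")
      case True
      have Mx: "E m x" if "m \<in> M" for m using x True xS that by (auto simp: Q_def)
      from ab(2) consider "b \<in> M" | "b \<in> Q" | "b \<in> R" by blast
      then show ?thesis
      proof cases
        case 1 then show ?thesis using Mx[of b] sym[of x b] by simp
      next
        case 2
        then obtain m where bm: "b \<in> S" "g b" "h b" "m \<in> M" "\<not> E m b" by (auto simp: Q_def)
        have "b \<noteq> x" using 2 x by blast
        show ?thesis
        proof (rule ccontr)
          assume "\<not> E x b"
          then have "\<not> E x m"
            using amb_both[OF u am bm(1) xS(1), of m] bm xS(2) \<open>b \<noteq> x\<close> sym[of b] by (auto simp: M_def)
          then show False using Mx[OF bm(4)] sym[of x m] by simp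
        qed
      next
        case 3
        then obtain m where bm: "b \<in> S" "\<not> g b" "\<not> h b" "m \<in> M" "E m b" by (auto simp: R_def)
        show ?thesis using join[of m x b] bm xS True Mx[OF bm(4)] by (auto simp: M_def)
      qed
    next
      case False
      have Mx: "\<not> E m x" if "m \<in> M" for m using x False xS that by (auto simp: R_def)
      from ab(1) consider "a \<in> M" | "a \<in> Q" | "a \<in> R" by blast
      then have "\<not> E x a"
      proof cases
        case 1 then show ?thesis using Mx[of a] sym[of x a] by simp
      next
        case 2
        then obtain m where am2: "a \<in> S" "g a" "h a" "m \<in> M" "\<not> E m a" by (auto simp: Q_def)
        then have "\<not> E a x" using sep[of m a x] xS False Mx[OF am2(4)] by (auto simp: M_def)
        then show ?thesis using sym[of a x] by simp
      next
        case 3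
        then obtain m where am2: "a \<in> S" "\<not> g a" "\<not> h a" "m \<in> M" "E m a" by (auto simp: R_def)
        show ?thesis
        proof
          assume "E x a"
          then have "E x m" using amb_neither[OF u am am2(1) xS(1), of m] am2 xS(2) sym by (auto simp: M_def)
          then show False using Mx[OF am2(4)] sym[of x m] by simp
        qed
      qed
      then show ?thesis using ab(3) by simp
    qed
  qed
  show thesis
  proof (cases "M = {}")
    case True
    then have "\<forall>s\<in>S. g s = h s" by (auto simp: M_def)
    then show thesis by (rule that(1))
  next
    case False
    then obtain m where m: "m \<in> M" by blast
    then have mS: "m \<in> S" "g m \<noteq> h m" by (auto simp: M_def)
    show thesis
    proof (cases "M \<union> Q \<union> R = S")
      case notS: False
      have only: "s = m" if "s \<in> M \<union> Q \<union> R" for s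
        using primeD[OF pr hom that, of m] m notS by blast
      have "g s = E m s \<and> h s = E m s" if "s \<in> S - {m}" for s
      proof -
        have "s \<notin> M" "s \<notin> Q" "s \<notin> R" using only that by auto
        then show ?thesis using that m by (auto simp: M_def Q_def R_def)
      qed
      then have "twin E S m g" "twin E S m h" by (auto simp: twin_def)
      then show thesis by (rule that(2)[OF mS(1)])
    next
      case eqS: True
      have "\<not> (\<exists>q\<in>S. \<exists>r\<in>S. g q \<and> h q \<and> \<not> g r \<and> \<not> h r)"
      proof
        assume "\<exists>q\<in>S. \<exists>r\<in>S. g q \<and> h q \<and> \<not> g r \<and> \<not> h r"
        then obtain q r where qr: "q \<in> S" "r \<in> S" "g q" "h q" "\<not> g r" "\<not> h r" by blast
        then have "q \<in> Q" "r \<in> R" using eqS by (auto simp: M_def Q_def R_def)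
        then obtain m1 m2 where mm: "m1 \<in> M" "\<not> E m1 q" "m2 \<in> M" "E m2 r" by (auto simp: Q_def R_def)
        have mS': "m1 \<in> S" "g m1 \<noteq> h m1" "m2 \<in> S" "g m2 \<noteq> h m2" using mm by (auto simp: M_def)
        \<comment> \<open>Hence \<open>m1\<close>, which misses \<open>q\<close>, also misses
          \<open>r\<close>, and \<open>m2\<close>, which sees \<open>r\<close>, also sees
          \<open>q\<close>. Then \<open>sep\<close> at \<open>m1\<close> makes \<open>q\<close> and
          \<open>r\<close> non-adjacent, while \<open>join\<close> at \<open>m2\<close> makes them
          adjacent.\<close>
        have bad: False if k: "k \<in> S" "g k \<noteq> h k" "\<not> E k q" "E k r" for k
        proof (cases "E q r")
          case True
          then show False using amb_neither[OF u am qr(2,1) k(1)] qr k sym[of r q] sym[of r k] sym[of q k] by auto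
        next
          case n: False
          have "q \<noteq> r" using qr by auto
          then show False using amb_both[OF u am qr(1,2) k(1)] qr k n sym[of q k] sym[of r k] by auto
        qed
        have 1: "\<not> E m1 r" using bad[of m1] mm mS' by blast
        have 2: "E m2 q" using bad[of m2] mm mS' by blast
        have "\<not> E q r" using sep[of m1 q r] mS' mm qr 1 by blast
        moreover have "E q r" using join[of m2 q r] mS' mm qr 2 by blast
        ultimately show False by blast
      qed
      then consider "\<And>s. s \<in> S \<Longrightarrow> \<not> (g s \<and> h s)" | "\<And>s. s \<in> S \<Longrightarrow> \<not> (\<not> g s \<and> \<not> h s)" by blast
      then show thesis
      proof cases
        case 1
        have "unif S g \<and> unif S h \<or> flips E S g h"
          by (rule amb_disjoint_unif_or_flips[OF u pr am three 1 mS])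
        then show thesis using that(3,4) by blast
      next
        case 2
        have "unif S (\<lambda>x. \<not> g x) \<and> unif S (\<lambda>x. \<not> h x) \<or> flips (co E) S (\<lambda>x. \<not> g x) (\<lambda>x. \<not> h x)"
        proof (rule amb_disjoint_unif_or_flips[OF ugraph_co[OF u] _ amb_co[OF am] three _ mS(1)])
          show "prime (co E) S" using pr prime_co[OF u] by simp
        qed (use 2 mS in auto)
        then have "unif S g \<and> unif S h \<or> flips (co E) S (\<lambda>x. \<not> g x) (\<lambda>x. \<not> h x)"
          by (auto simp: unif_def)
        then show thesis using that(3,5) by blast
      qed
    qed
  qed
qed

subsection \<open>Growing a prime set of agreement\<close>

definition agree :: "('a \<Rightarrow> 'a \<Rightarrow> bool) \<Rightarrow> ('a \<Rightarrow> 'a \<Rightarrow> bool) \<Rightarrow> 'a set \<Rightarrow> bool" where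
  "agree G H S \<longleftrightarrow> (\<forall>a\<in>S. \<forall>b\<in>S. G a b = H a b)"

text \<open>The harmless outcomes of \<open>ambiguity\<close>. In the first, both graphs see a copy
  of the same \<open>t\<close>, but the adjacency to \<open>t\<close> may differ between
  them.\<close>

definition tame :: "('a \<Rightarrow> 'a \<Rightarrow> bool) \<Rightarrow> ('a \<Rightarrow> 'a \<Rightarrow> bool) \<Rightarrow> 'a set \<Rightarrow> 'a \<Rightarrow> bool" where
  "tame G H S y \<longleftrightarrow>
     (\<exists>t\<in>S. twin G S t (G y) \<and> twin G S t (H y)) \<or> unif S (G y) \<and> unif S (H y)"

text \<open>The trace on \<open>S\<close> of a homogeneous set is homogeneous in \<open>S\<close>,
  so a nontrivial one is \<open>S\<close> itself or \<open>x\<close> paired with a single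
  vertex.\<close>

lemma prime_insert_cases:
  assumes u: "ugraph E" and pr: "prime E S" and x: "x \<notin> S" and np: "\<not> prime E (insert x S)"
  shows "unif S (E x) \<or> (\<exists>t\<in>S. twin E S t (E x))"
proof -
  note sym = ugraphD(1)[OF u]
  obtain M a b where M: "homog E (insert x S) M" "M \<noteq> insert x S" "a \<in> M" "b \<in> M" "a \<noteq> b"
    using np unfolding prime_def by blast
  have hom: "E z a \<longleftrightarrow> E z b" if "z \<in> insert x S" "z \<notin> M" "a \<in> M" "b \<in> M" for z a b
    using M(1) that unfolding homog_def by blast
  have MS: "M \<subseteq> insert x S" using M(1) by (simp add: homog_def)
  have "homog E S (M \<inter> S)"
    unfolding homog_def
  proof (intro conjI ballI impI)
    fix z c d assume "z \<in> S - M \<inter> S" "c \<in> M \<inter> S" "d \<in> M \<inter> S" "E z c"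
    then show "E z d" using hom[of z c d] by blast
  qed simp
  then have "M \<inter> S = S \<or> (\<forall>c\<in>M \<inter> S. \<forall>d\<in>M \<inter> S. c = d)" using pr unfolding prime_def by blast
  then show ?thesis
  proof
    assume "M \<inter> S = S"
    then have "x \<notin> M" "S \<subseteq> M" using M(2) MS by auto
    then have "E x c \<longleftrightarrow> E x d" if "c \<in> S" "d \<in> S" for c d
      using hom[of x c d] that by auto
    then show ?thesis unfolding unif_def by blast
  next
    assume one: "\<forall>c\<in>M \<inter> S. \<forall>d\<in>M \<inter> S. c = d"
    then have "\<exists>t. t \<in> S \<and> M = {x, t}"
    proof -
      have "x \<in> M" using one M(3-5) MS by blast
      then obtain t where "t \<in> M" "t \<noteq> x" using M(3-5) by blast
      then have "t \<in> S" using MS by blast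
      moreover have "M = {x, t}" using \<open>t \<in> M\<close> \<open>t \<in> S\<close> \<open>x \<in> M\<close> one MS by blast
      ultimately show ?thesis by blast
    qed
    then obtain t where t: "t \<in> S" "M = {x, t}" by blast
    have "E x s \<longleftrightarrow> E t s" if "s \<in> S - {t}" for s
    proof -
      have "s \<notin> M" using t that x by auto
      then show ?thesis using hom[of s x t] t that sym[of s] by auto
    qed
    then show ?thesis using t unfolding twin_def by blast
  qed
qed

text \<open>The assumption \<open>three\<close> excludes sets of at most two vertices, which are
  prime for trivial reasons.\<close>

locale agreeing =
  fixes G H :: "'a \<Rightarrow> 'a \<Rightarrow> bool" and V S :: "'a set"
  assumes ug: "ugraph G" and uh: "ugraph H" and iso: "p4iso G H V" and SV: "S \<subseteq> V"
    and pr: "prime G S" and ag: "agree G H S" and three: "\<exists>c\<in>S. c \<noteq> a \<and> c \<noteq> b"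
begin

lemma gs: "G a b \<longleftrightarrow> G b a" and hs: "H a b \<longleftrightarrow> H b a"
  using ug uh by (auto simp: ugraph_def)

lemma gh: "a \<in> S \<Longrightarrow> b \<in> S \<Longrightarrow> H a b = G a b"
  using ag by (simp add: agree_def)

lemma four:
  assumes "a \<in> V" "b \<in> V" "c \<in> V" "d \<in> V" "a \<noteq> b" "a \<noteq> c" "a \<noteq> d" "b \<noteq> c" "b \<noteq> d" "c \<noteq> d"
  shows "p4b (G a b) (G a c) (G a d) (G b c) (G b d) (G c d) \<longleftrightarrow>
    p4b (H a b) (H a c) (H a d) (H b c) (H b d) (H c d)"
  using iso assms unfolding p4iso_def P4on_def by simp

lemma amb:
  assumes "x \<in> V - S" shows "amb G S (G x) (H x)"
  unfolding amb_def
proof (intro ballI impI)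
  fix a b c assume abc: "a \<in> S" "b \<in> S" "c \<in> S" "distinct [a, b, c]"
  then show "p4b (G x a) (G x b) (G x c) (G a b) (G a c) (G b c) =
    p4b (H x a) (H x b) (H x c) (G a b) (G a c) (G b c)"
    using four[of x a b c] assms SV gh[of a b] gh[of a c] gh[of b c] by auto
qed

lemma dual: "agreeing (co G) (co H) V S"
proof
  show "ugraph (co G)" "ugraph (co H)" using ug uh ugraph_co by auto
  show "p4iso (co G) (co H) V" using iso by (simp add: p4iso_co1 p4iso_co2)
  show "prime (co G) S" using pr prime_co[OF ug] by simp
  show "agree (co G) (co H) S" using ag by (simp add: agree_def co_def)
qed (rule SV three)+

lemma two_homog: "a \<in> S \<Longrightarrow> b \<in> S \<Longrightarrow> a \<noteq> b \<Longrightarrow> homog G S M \<Longrightarrow> a \<in> M \<Longrightarrow> b \<in> M \<Longrightarrow> M = S"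
  using primeD[OF pr] by blast

lemma not_unif: "s \<in> S \<Longrightarrow> \<not> unif (S - {s}) (G s)"
proof
  assume s: "s \<in> S" "unif (S - {s}) (G s)"
  obtain a where a: "a \<in> S" "a \<noteq> s" using three by blast
  obtain b where b: "b \<in> S" "b \<noteq> s" "b \<noteq> a" using three by blast
  have "homog G S (S - {s})" using s unfolding homog_def unif_def by blast
  then have "S - {s} = S" using two_homog[of a b] a b by blast
  then show False using s by blast
qed

lemma twin_unique:
  assumes "s \<in> S" "t \<in> S" "twin G S s g" "twin G S t g" shows "s = t"
proof (rule ccontr)
  assume "s \<noteq> t"
  have "homog G S {s, t}"
    unfolding homog_def
  proof (intro conjI ballI impI)
    fix z a b assume z: "z \<in> S - {s, t}" and ab: "a \<in> {s, t}" "b \<in> {s, t}" "G z a"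
    have "G s z = G t z" 
      using z assms(3)[unfolded twin_def, rule_format, of z] assms(4)[unfolded twin_def, rule_format, of z] by simp
    then show "G z b" using ab gs[of z] by auto
  qed (use assms in auto)
  then have "{s, t} = S" using two_homog assms \<open>s \<noteq> t\<close> by blast
  then show False using three[of s t] by blast
qed

lemma twin_not_unif:
  assumes "s \<in> S" "twin G S s g" shows "\<not> unif S g"
  using not_unif[OF assms(1)] assms(2) unfolding unif_def twin_def by blast

text \<open>A copy \<open>x\<close> of \<open>s\<close> alone would spoil primality through the pair
  of \<open>s\<close> and \<open>x\<close>; the vertex \<open>y\<close> separates this pair. Since
  \<open>y\<close> is no copy of \<open>s\<close>, the pair of \<open>x\<close> and \<open>y\<close>
  is not homogeneous either.\<close>

lemma prime_two:
  assumes x: "x \<in> V - S" and y: "y \<in> V - S" and "x \<noteq> y" and s: "s \<in> S" "twin G S s (G x)"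
    and ny: "\<not> twin G S s (G y)" and d: "G y x \<noteq> G y s"
  shows "prime G (insert x (insert y S))"
  unfolding prime_def
proof (intro allI impI, rule ccontr)
  fix M assume M: "homog G (insert x (insert y S)) M"
    and "\<not> (M = insert x (insert y S) \<or> (\<forall>a\<in>M. \<forall>b\<in>M. a = b))"
  then obtain a b where ab: "M \<noteq> insert x (insert y S)" "a \<in> M" "b \<in> M" "a \<noteq> b" by blast
  have hom: "G z a \<longleftrightarrow> G z b" if "z \<in> insert x (insert y S)" "z \<notin> M" "a \<in> M" "b \<in> M" for z a b
    using M that unfolding homog_def by blast
  have MS: "M \<subseteq> insert x (insert y S)" using M by (simp add: homog_def)
  have xy: "x \<notin> S" "y \<notin> S" using x y by auto
  have tw: "twin G S m (G w)" if "m \<in> S" "\<And>z. z \<in> S \<Longrightarrow> z \<noteq> m \<Longrightarrow> G z m = G z w" for m w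
    using that gs unfolding twin_def by blast
  have "homog G S (M \<inter> S)"
    unfolding homog_def
  proof (intro conjI ballI impI)
    fix z c d assume "z \<in> S - M \<inter> S" "c \<in> M \<inter> S" "d \<in> M \<inter> S" "G z c"
    then show "G z d" using hom[of z c d] by blast
  qed simp
  then have "M \<inter> S = S \<or> (\<forall>c\<in>M \<inter> S. \<forall>d\<in>M \<inter> S. c = d)" using pr unfolding prime_def by blast
  then show False
  proof
    assume "M \<inter> S = S"
    then have SM: "S \<subseteq> M" by blast
    have "x \<in> M"
    proof (rule ccontr)
      assume "x \<notin> M"
      then have "G x c \<longleftrightarrow> G x d" if "c \<in> S" "d \<in> S" for c d
        using hom[of x c d] that SM by blast
      then have "unif S (G x)" unfolding unif_def by blast
      then show False using twin_not_unif s by blast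
    qed
    then have "y \<notin> M" using ab(1) MS SM by blast
    then show False using hom[of y x s] \<open>x \<in> M\<close> SM s d by blast
  next
    assume one: "\<forall>c\<in>M \<inter> S. \<forall>d\<in>M \<inter> S. c = d"
    show False
    proof (cases "M \<inter> S = {}")
      case True
      then have "x \<in> M" "y \<in> M" using ab MS by blast+
      then have "G z x = G z y" if "z \<in> S" for z using hom[of z x y] that True by blast
      moreover have "G s z = G x z" if "z \<in> S" "z \<noteq> s" for z using s that unfolding twin_def by blast
      ultimately have "twin G S s (G y)" using gs unfolding twin_def by blast
      then show False using ny by blast
    next
      case False
      then obtain m where m: "m \<in> M" "m \<in> S" by blast
      have out: "z \<notin> M" if "z \<in> S" "z \<noteq> m" for z using that one m by blast
      have twM: "twin G S m (G w)" if "w \<in> M" for w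
        using hom[of _ m w] out m that by (intro tw) auto
      show False
      proof (cases "x \<in> M")
        case True
        then have "m = s" using twin_unique[OF m(2) s(1) twM] s(2) by blast
        then show False using twM[of y] ny hom[of y x s] True m d by blast
      next
        case nx: False
        then have "y \<in> M" using ab MS one m by blast
        then have ty: "twin G S m (G y)" by (rule twM)
        then have "m \<noteq> s" using ny by blast
        have "G x m = G x y" using hom[of x m y] nx m \<open>y \<in> M\<close> by blast
        moreover have "G x m = G s m" using s \<open>m \<noteq> s\<close> m unfolding twin_def by blast
        moreover have "G y s = G m s" using ty \<open>m \<noteq> s\<close> s unfolding twin_def by blast
        ultimately show False using d gs by blast
      qed
    qed
  qed
qed

text \<open>Primality provides an edge \<open>uv\<close> with \<open>u\<close> a neighbour and
  \<open>v\<close> a non-neighbour of \<open>s\<close>. The P4 on \<open>y\<close>,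
  \<open>x\<close>, \<open>u\<close>, \<open>v\<close> determines how \<open>y\<close> sees
  \<open>x\<close> and \<open>S\<close> in \<open>H\<close>; the quadruple \<open>y\<close>,
  \<open>x\<close>, \<open>u\<close>, \<open>s\<close> then settles the pair
  \<open>xs\<close>.\<close>

lemma agree_null:
  assumes x: "x \<in> V - S" and y: "y \<in> V - S" and xy: "x \<noteq> y" and s: "s \<in> S"
    and tx: "twin G S s (G x)" "twin G S s (H x)"
    and null: "\<And>z. z \<in> S \<Longrightarrow> \<not> G y z" and uy: "unif S (H y)" and yx: "G y x"
  shows "agree G H (insert x (insert y S))"
proof -
  have x1: "G x z = G s z" "H x z = G s z" if "z \<in> S" "z \<noteq> s" for z
    using tx that unfolding twin_def by auto
  \<comment> \<open>Otherwise the closed neighbourhood of \<open>s\<close> in \<open>S\<close> would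
    be homogeneous, hence all of \<open>S\<close> or just \<open>s\<close>.\<close>
  have "\<exists>u\<in>S. \<exists>v\<in>S. G s u \<and> \<not> G s v \<and> v \<noteq> s \<and> G u v"
  proof (rule ccontr)
    assume n: "\<not> ?thesis"
    let ?M = "insert s {u\<in>S. G s u}"
    have "homog G S ?M"
      unfolding homog_def
    proof (intro conjI ballI impI)
      fix z a b assume z: "z \<in> S - ?M" "a \<in> ?M" "G z a"
      then have "\<not> G s z" "z \<noteq> s" "z \<in> S" by auto
      moreover have "\<not> G z s" using \<open>\<not> G s z\<close> gs[of z s] by simp
      ultimately show "G z b" using z n gs[of z a] by auto
    qed (use s in auto)
    then have "?M = S \<or> (\<forall>a\<in>?M. \<forall>b\<in>?M. a = b)" using pr unfolding prime_def by blast
    then have "unif (S - {s}) (G s)" using ugraphD(2)[OF ug, of s] unfolding unif_def by blast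
    then show False using not_unif s by blast
  qed
  then obtain u v where uv: "u \<in> S" "v \<in> S" "G s u" "\<not> G s v" "v \<noteq> s" "G u v" by blast
  have "u \<noteq> s" using uv ugraphD(2)[OF ug] by auto
  have ne: "y \<noteq> u" "y \<noteq> v" "x \<noteq> u" "x \<noteq> v" "u \<noteq> v" "y \<noteq> s" "x \<noteq> s"
    using x y uv s ugraphD(2)[OF ug] by auto
  have inV: "x \<in> V" "y \<in> V" "u \<in> V" "v \<in> V" "s \<in> V" using x y uv s SV by auto
  have bits: "G x u" "H x u" "\<not> G x v" "\<not> H x v" "H u v" "G u s" "H u s"
    using x1[OF uv(1) \<open>u \<noteq> s\<close>] x1[OF uv(2,5)] uv gh[OF uv(1,2)] gh[OF uv(1) s] gs[of u s] by auto
  have uniH: "H y u = H y v" using uy uv unfolding unif_def by blast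
  have 1: "\<not> H y u \<and> H y x"
    using four[of y x u v] ne xy inV bits uniH null[OF uv(1)] null[OF uv(2)] yx uv(6) unfolding p4b_def by auto
  then have nullH: "\<not> H y z" if "z \<in> S" for z using uy uv(1) that unfolding unif_def by blast
  have 2: "G x s = H x s"
    using four[of y x u s] ne xy inV bits null[OF uv(1)] null[OF s] yx 1 nullH[OF s] \<open>u \<noteq> s\<close>
    unfolding p4b_def by auto
  show ?thesis
    unfolding agree_def
  proof (intro ballI)
    have S: "G w z = H w z" if "w \<in> {x, y}" "z \<in> S" for w z
      using that x1[of z] 2 null nullH by (cases "z = s") auto
    fix a b assume "a \<in> insert x (insert y S)" "b \<in> insert x (insert y S)"
    then show "G a b = H a b"
      using S[of a b] S[of b a] gh[of a b] gs[of a b] hs[of a b] 1 yx ugraphD(2)[OF ug] ugraphD(2)[OF uh]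
      by auto
  qed
qed

text \<open>The four vertices \<open>s, x, t, y\<close>, with \<open>x\<close> a copy of \<open>s\<close> and \<open>y\<close> a copy of \<open>t\<close>, are
  related symmetrically; only the adjacencies \<open>xy\<close>, \<open>xs\<close> and \<open>yt\<close> could differ in \<open>H\<close>.\<close>

definition copies where
  "copies s x t y \<longleftrightarrow> x \<in> V - S \<and> y \<in> V - S \<and> x \<noteq> y \<and> s \<in> S \<and> t \<in> S \<and> s \<noteq> t \<and> \<not> G s t \<and> G x y \<and>
    twin G S s (G x) \<and> twin G S s (H x) \<and> twin G S t (G y) \<and> twin G S t (H y)"

lemma copies_sym: "copies s x t y \<Longrightarrow> copies t y s x"
  unfolding copies_def using gs by blast

lemma copiesD:
  assumes "copies s x t y"
  shows "x \<in> V" "y \<in> V" "x \<notin> S" "y \<notin> S" "x \<noteq> y" "s \<in> S" "t \<in> S" "s \<noteq> t" "\<not> G s t" "\<not> G t s" "G x y"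
    "\<And>z. z \<in> S \<Longrightarrow> z \<noteq> s \<Longrightarrow> G x z = G s z" "\<And>z. z \<in> S \<Longrightarrow> z \<noteq> s \<Longrightarrow> H x z = G s z"
    "\<And>z. z \<in> S \<Longrightarrow> z \<noteq> t \<Longrightarrow> G y z = G t z" "\<And>z. z \<in> S \<Longrightarrow> z \<noteq> t \<Longrightarrow> H y z = G t z"
  using assms gs[of s t] unfolding copies_def twin_def by auto

text \<open>A vertex \<open>z\<close> that sees \<open>s\<close> but not \<open>t\<close> yields two
  quadruples, \<open>s z x y\<close> and \<open>z x y t\<close>, whose only open adjacencies are
  \<open>xs\<close>, \<open>yt\<close> and \<open>xy\<close>.\<close>

lemma copies_bits:
  assumes c: "copies s x t y" and z: "z \<in> S" "z \<noteq> s" "z \<noteq> t" "G s z" "\<not> G t z"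
  shows "p4b True (G x s) False True False True \<longleftrightarrow> p4b True (H x s) False True False (H x y)"
    and "p4b True False False True False (G y t) \<longleftrightarrow> p4b True False False (H x y) False (H y t)"
proof -
  note D = copiesD[OF c]
  have ne: "s \<noteq> x" "s \<noteq> y" "z \<noteq> x" "z \<noteq> y" "t \<noteq> x" "t \<noteq> y" using D z by auto
  have inV: "s \<in> V" "t \<in> V" "z \<in> V" using D z SV by auto
  have b: "G z x" "H z x" "\<not> G z y" "\<not> H z y" "\<not> G s y" "\<not> H s y" "\<not> G x t" "\<not> H x t" "H s z" "\<not> G z t" "\<not> H z t"
    using D(12,13)[OF z(1,2)] D(14,15)[OF z(1,3)] D(14,15)[OF D(6) D(8)] D(12,13)[OF D(7)] D(8-10) z
      gs[of z] hs[of z] gs[of s y] hs[of s y] gh[of s z] gh[of t z] D(6,7) by auto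
  show "p4b True (G x s) False True False True \<longleftrightarrow> p4b True (H x s) False True False (H x y)"
    using four[of s z x y] ne inV D b z gs[of s x] hs[of s x] by auto
  show "p4b True False False True False (G y t) \<longleftrightarrow> p4b True False False (H x y) False (H y t)"
    using four[of z x y t] ne inV D b z by auto
qed

text \<open>If \<open>H\<close> loses \<open>xy\<close>, a vertex seeing \<open>s\<close> but not
  \<open>t\<close> forces the edge \<open>xs\<close> and forbids \<open>yt\<close>. By symmetry no
  vertex then sees \<open>t\<close> but not \<open>s\<close>. So \<open>s\<close> together with the
  vertices seen by \<open>s\<close> and not by \<open>t\<close> is homogeneous, although it omits
  \<open>t\<close>.\<close>

lemma copies_no_A:
  assumes c: "copies s x t y" and n: "\<not> H x y"
  shows "\<not> (\<exists>z\<in>S. z \<noteq> s \<and> z \<noteq> t \<and> G s z \<and> \<not> G t z)"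
proof
  assume "\<exists>z\<in>S. z \<noteq> s \<and> z \<noteq> t \<and> G s z \<and> \<not> G t z"
  then obtain z where z: "z \<in> S" "z \<noteq> s" "z \<noteq> t" "G s z" "\<not> G t z" by blast
  note D = copiesD[OF c] and D' = copiesD[OF copies_sym[OF c]]
  have "G x s" "\<not> G y t" using copies_bits[OF c z] n unfolding p4b_def by auto
  have noB: "\<not> (G t w \<and> \<not> G s w)" if w: "w \<in> S" "w \<noteq> s" "w \<noteq> t" for w
    using copies_bits[OF copies_sym[OF c] w(1,3,2)] n hs[of x y] \<open>G x s\<close> unfolding p4b_def by auto
  let ?A = "{z\<in>S. z \<noteq> t \<and> G s z \<and> \<not> G t z}"
  have ne: "x \<noteq> w" "y \<noteq> w" if "w \<in> S" for w using D that by auto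
  have inV: "w \<in> V" if "w \<in> S" for w using SV that by auto
  have join: "G w a = G s w" if w: "w \<in> S" "w \<noteq> s" "w \<noteq> t" "w \<notin> ?A" and a: "a \<in> ?A" for w a
  proof -
    have a': "a \<in> S" "a \<noteq> t" "G s a" "\<not> G t a" using a by auto
    have "a \<noteq> s" using a' ugraphD(2)[OF ug] by auto
    have wa: "w \<noteq> a" using w a by blast
    have b: "G x a" "H x a" "\<not> G y a" "\<not> H y a" "G x w = G s w" "H x w = G s w"
      "G y w = G t w" "H y w = G t w" "H a w = G a w"
      using D(12,13)[OF a'(1) \<open>a \<noteq> s\<close>] D(14,15)[OF a'(1,2)] D(12,13)[OF w(1,2)] D(14,15)[OF w(1,3)]
        a' gh[OF a'(1) w(1)] by auto
    have "G s w = G t w" using noB[OF w(1-3)] w by auto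
    then show ?thesis
      using four[of y x a w] b wa ne[OF a'(1)] ne[OF w(1)] inV[OF a'(1)] inV[OF w(1)] D(1,2,5,11) n
        gs[of x y] hs[of x y] gs[of a w] unfolding p4b_def by auto
  qed
  have "homog G S (insert s ?A)"
    unfolding homog_def
  proof (intro conjI ballI impI)
    fix w a b assume w: "w \<in> S - insert s ?A" "a \<in> insert s ?A" "b \<in> insert s ?A" "G w a"
    show "G w b"
    proof (cases "w = t")
      case True
      then show ?thesis using w D(10) by auto
    next
      case False
      then have "G w c = G s w" if "c \<in> insert s ?A" for c
        using that join[of w c] w(1) gs[of w s] by auto
      then show ?thesis using w by blast
    qed
  qed (use D in auto)
  moreover have "s \<in> insert s ?A" "z \<in> insert s ?A" using z by auto
  ultimately have "insert s ?A = S" using two_homog[of s z] z D(6) by blast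
  then have "t \<in> insert s ?A" using D(7) by simp
  then show False using D(8) by simp
qed

lemma agree_copies:
  assumes c: "copies s x t y"
  shows "agree G H (insert x (insert y S))"
proof -
  note D = copiesD[OF c]
  have "\<exists>z\<in>S. z \<noteq> s \<and> z \<noteq> t \<and> G s z \<noteq> G t z"
  proof (rule ccontr)
    assume n: "\<not> ?thesis"
    have "homog G S {s, t}"
      unfolding homog_def
    proof (intro conjI ballI impI)
      fix z a b assume z: "z \<in> S - {s, t}" "a \<in> {s, t}" "b \<in> {s, t}" "G z a"
      then have "G s z = G t z" using n by auto
      then show "G z b" using z gs[of z] by auto
    qed (use D in auto)
    then have "{s, t} = S" using two_homog[of s t] D by blast
    then show False using three[of s t] by blast
  qed
  then obtain z where z: "z \<in> S" "z \<noteq> s" "z \<noteq> t" "G s z \<noteq> G t z" by blast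
  have hxy: "H x y"
    using copies_no_A[OF c] copies_no_A[OF copies_sym[OF c]] z hs[of x y] by blast
  have "G x s = H x s \<and> G y t = H y t"
  proof (cases "G s z")
    case True
    then show ?thesis using copies_bits[OF c z(1-3)] z hxy unfolding p4b_def by auto
  next
    case False
    then show ?thesis
      using copies_bits[OF copies_sym[OF c] z(1,3,2)] z hxy hs[of x y] unfolding p4b_def by auto
  qed
  then have S: "G w z = H w z" if "w \<in> {x, y}" "z \<in> S" for w z
    using that D(12-15)[of z] by auto
  show ?thesis
    unfolding agree_def
  proof (intro ballI)
    fix a b assume "a \<in> insert x (insert y S)" "b \<in> insert x (insert y S)"
    then show "G a b = H a b"
      using S[of a b] S[of b a] gh[of a b] gs[of a b] hs[of a b] hxy D(11) ugraphD(2)[OF ug] ugraphD(2)[OF uh]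
      by auto
  qed
qed

end

lemma agree_co: "agree (co G) (co H) S \<longleftrightarrow> agree G H S" if "ugraph G" "ugraph H"
  using that unfolding agree_def co_def ugraph_def by blast

lemma twin_co: "x \<notin> S \<Longrightarrow> twin (co E) S t (co F x) \<longleftrightarrow> twin E S t (F x)"
  unfolding twin_def co_def by auto

lemma unif_co: "x \<notin> S \<Longrightarrow> unif S (co F x) \<longleftrightarrow> unif S (F x)"
  unfolding unif_def co_def by auto

context agreeing
begin

text \<open>The two vertices have to enter together, because the copy \<open>x\<close> alone may
  form a homogeneous pair with \<open>s\<close>. When \<open>y\<close> is a copy of a neighbour of
  \<open>s\<close>, or sees all of \<open>S\<close>, the previous lemmas are applied in the
  complement.\<close>

theorem growth:
  assumes x: "x \<in> V - S" and y: "y \<in> V - S" and xy: "x \<noteq> y" and s: "s \<in> S"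
    and tx: "twin G S s (G x)" "twin G S s (H x)" and ny: "\<not> twin G S s (G y)"
    and ty: "tame G H S y" and d: "G y x \<noteq> G y s"
  shows "prime G (insert x (insert y S)) \<and> agree G H (insert x (insert y S))"
proof
  show "prime G (insert x (insert y S))" by (rule prime_two[OF x y xy s tx(1) ny d])
  interpret co: agreeing "co G" "co H" V S by (rule dual)
  have xS: "x \<notin> S" and yS: "y \<notin> S" using x y by auto
  have co_tx: "twin (co G) S s (co G x)" "twin (co G) S s (co H x)" using tx twin_co[OF xS] by auto
  have nes: "y \<noteq> s" using s yS by auto
  from ty consider t where "t \<in> S" "twin G S t (G y)" "twin G S t (H y)"
    | "unif S (G y)" "unif S (H y)" unfolding tame_def by blast
  then show "agree G H (insert x (insert y S))"
  proof cases
    case 1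
    then have "s \<noteq> t" using ny by blast
    have Gys: "G y s = G s t" using 1(2) s \<open>s \<noteq> t\<close> gs[of s t] unfolding twin_def by simp
    show ?thesis
    proof (cases "G s t")
      case False
      then have "copies s x t y"
        unfolding copies_def using x y xy s 1 tx \<open>s \<noteq> t\<close> d Gys gs[of x y] by blast
      then show ?thesis by (rule agree_copies)
    next
      case True
      have "co.copies s x t y"
        unfolding co.copies_def using x y xy s 1(1) co_tx \<open>s \<noteq> t\<close> d Gys gs[of x y] True
          twin_co[OF yS] 1(2,3) by (auto simp: co_def)
      then show ?thesis using co.agree_copies agree_co[OF ug uh] by blast
    qed
  next
    case 2
    show ?thesis
    proof (cases "\<forall>z\<in>S. \<not> G y z")
      case True
      then show ?thesis using agree_null[OF x y xy s tx _ 2(2)] s d by blast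
    next
      case False
      then have "\<forall>z\<in>S. G y z" using 2(1) unfolding unif_def by blast
      then have "agree (co G) (co H) (insert x (insert y S))"
        using d s xy unif_co[OF yS, of H] 2(2)
        by (intro co.agree_null[OF x y xy s co_tx]) (auto simp: co_def)
      then show ?thesis using agree_co[OF ug uh] by blast
    qed
  qed
qed

text \<open>If \<open>G\<close> and \<open>H\<close> agree at \<open>x\<close>, inserting
  \<open>x\<close> keeps agreement, so by maximality it breaks primality, and
  \<open>prime_insert_cases\<close> makes \<open>x\<close> tame.\<close>

lemma tame_or_flips:
  assumes x: "x \<in> V - S" and max: "\<not> (prime G (insert x S) \<and> agree G H (insert x S))"
  shows "tame G H S x \<or> flips G S (G x) (H x) \<or> flips (co G) S (\<lambda>z. \<not> G x z) (\<lambda>z. \<not> H x z)"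
  using ug pr amb[OF x] three
proof (rule ambiguity)
  assume eq: "\<forall>s\<in>S. G x s = H x s"
  have "agree G H (insert x S)"
    unfolding agree_def
  proof (intro ballI)
    fix a b assume "a \<in> insert x S" "b \<in> insert x S"
    then show "G a b = H a b"
      using eq gh[of a b] gs[of a b] hs[of a b] ugraphD(2)[OF ug] ugraphD(2)[OF uh] by auto
  qed
  then have np: "\<not> prime G (insert x S)" using max by blast
  have "unif S (G x) \<or> (\<exists>t\<in>S. twin G S t (G x))"
    by (rule prime_insert_cases[OF ug pr _ np]) (use x in simp)
  moreover have "unif S (G x) \<longleftrightarrow> unif S (H x)" using eq unfolding unif_def by simp
  moreover have "twin G S t (G x) \<longleftrightarrow> twin G S t (H x)" for t using eq unfolding twin_def by simp
  ultimately show ?thesis unfolding tame_def by blast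
qed (unfold tame_def, blast+)

end

context agreeing
begin

text \<open>The copies of \<open>s\<close>, with \<open>s\<close>, are not homogeneous in the prime
  graph on \<open>V\<close>, so some vertex separates a copy from \<open>s\<close>; it lies outside
  \<open>S\<close>, and \<open>growth\<close> contradicts maximality. Tameness is required only of
  the vertices used in this argument, since around a hexagon it is not yet known for all.\<close>

lemma twin_class_trivial:
  assumes fin: "finite V" and prV: "prime G V"
    and max: "\<And>T. S \<subseteq> T \<Longrightarrow> T \<subseteq> V \<Longrightarrow> prime G T \<Longrightarrow> agree G H T \<Longrightarrow> card T \<le> card S"
    and s: "s \<in> S" and x: "x \<in> V - S" "twin G S s (G x)"
    and tm1: "\<And>z. z \<in> V - S \<Longrightarrow> twin G S s (G z) \<Longrightarrow> tame G H S z"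
    and tm2: "\<And>y z. y \<in> V - S \<Longrightarrow> z \<in> V - S \<Longrightarrow> twin G S s (G z) \<Longrightarrow> twin G S s (H z) \<Longrightarrow>
      y \<noteq> z \<Longrightarrow> G y z \<noteq> G y s \<Longrightarrow> tame G H S y"
  shows False
proof -
  have "\<not> homog G V (insert s {z\<in>V - S. twin G S s (G z)})" (is "\<not> homog G V ?X")
  proof
    assume "homog G V ?X"
    then have "?X = V" using primeD[OF prV, of ?X s x] s x by blast
    moreover obtain c where "c \<in> S" "c \<noteq> s" using three by blast
    ultimately show False using SV by blast
  qed
  then obtain y a b where y: "y \<in> V" "y \<notin> ?X" and ab: "a \<in> ?X" "b \<in> ?X" "G y a" "\<not> G y b"
    using s SV unfolding homog_def by blast
  then obtain x' where x': "x' \<in> ?X" "x' \<noteq> s" "G y x' \<noteq> G y s" by (metis insertCI)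
  then have x'2: "x' \<in> V - S" "twin G S s (G x')" by auto
  have "y \<notin> S"
  proof
    assume "y \<in> S"
    then have "G x' y = G s y" using y x'2 unfolding twin_def by blast
    then show False using x'(3) gs[of y] by blast
  qed
  then have yS: "y \<in> V - S" "\<not> twin G S s (G y)" using y by auto
  have txH: "twin G S s (H x')"
  proof -
    have "\<not> unif S (G x')" using twin_not_unif[OF s x'2(2)] .
    then obtain t where t: "t \<in> S" "twin G S t (G x')" "twin G S t (H x')"
      using tm1[OF x'2] unfolding tame_def by blast
    then have "t = s" using twin_unique s x'2(2) by blast
    then show ?thesis using t by blast
  qed
  have "x' \<noteq> y" using x'(1) y(2) by blast
  have ty: "tame G H S y" by (rule tm2[OF yS(1) x'2 txH]) (use \<open>x' \<noteq> y\<close> x'(3) in auto)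
  have "prime G (insert x' (insert y S)) \<and> agree G H (insert x' (insert y S))"
    by (rule growth[OF x'2(1) yS(1) \<open>x' \<noteq> y\<close> s x'2(2) txH yS(2) ty x'(3)])
  then have "card (insert x' (insert y S)) \<le> card S"
    using x'2 yS SV by (intro max) auto
  moreover have "finite S" using fin SV finite_subset by blast
  ultimately show False using x'2 yS \<open>x' \<noteq> y\<close> by simp
qed

text \<open>Without copies of vertices of \<open>S\<close>, all outer vertices are uniform, and then
  \<open>S\<close> is homogeneous in \<open>V\<close>.\<close>

lemma maximal_agreeing:
  assumes fin: "finite V" and prV: "prime G V"
    and max: "\<And>T. S \<subseteq> T \<Longrightarrow> T \<subseteq> V \<Longrightarrow> prime G T \<Longrightarrow> agree G H T \<Longrightarrow> card T \<le> card S"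
    and tm: "\<And>x. x \<in> V - S \<Longrightarrow> tame G H S x"
  shows "S = V"
proof (rule ccontr)
  assume "S \<noteq> V"
  show False
  proof (cases "\<exists>s\<in>S. \<exists>x\<in>V - S. twin G S s (G x)")
    case True
    then obtain s x where sx: "s \<in> S" "x \<in> V - S" "twin G S s (G x)" by blast
    show False
    proof (rule twin_class_trivial[OF fin prV _ sx])
      fix T assume "S \<subseteq> T" "T \<subseteq> V" "prime G T" "agree G H T"
      then show "card T \<le> card S" by (rule max)
    qed (rule tm, assumption)+
  next
    case False
    then have un: "unif S (G x)" if "x \<in> V - S" for x using tm[OF that] that unfolding tame_def by blast
    have "homog G V S"
      unfolding homog_def
    proof (intro conjI ballI impI)
      fix x a b assume "x \<in> V - S" "a \<in> S" "b \<in> S" "G x a"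
      then show "G x b" using un[of x] unfolding unif_def by blast
    qed (rule SV)
    moreover obtain a where a: "a \<in> S" using three by blast
    moreover obtain b where "b \<in> S" "b \<noteq> a" using three by blast
    ultimately have "S = V" using primeD[OF prV] by blast
    then show False using \<open>S \<noteq> V\<close> by blast
  qed
qed

end

lemma agreeing_superset:
  assumes "agreeing G H V S" "S \<subseteq> T" "T \<subseteq> V" "prime G T" "agree G H T"
  shows "agreeing G H V T"
proof -
  interpret agreeing G H V S by fact
  show ?thesis
  proof
    show "\<exists>c\<in>T. c \<noteq> a \<and> c \<noteq> b" for a b using three[of a b] assms(2) by blast
  qed (use ug uh iso assms in auto)
qed

lemma maximal_superset:
  assumes "agreeing G H V S0" "finite V"
  obtains S where "S0 \<subseteq> S" "agreeing G H V S"
    "\<And>T. S \<subseteq> T \<Longrightarrow> T \<subseteq> V \<Longrightarrow> prime G T \<Longrightarrow> agree G H T \<Longrightarrow> card T \<le> card S"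
proof -
  interpret agreeing G H V S0 by fact
  let ?P = "\<lambda>T. S0 \<subseteq> T \<and> T \<subseteq> V \<and> prime G T \<and> agree G H T"
  show thesis
  proof (rule max_card_subset[of ?P S0 V])
    show "?P S0" using SV pr ag by simp
    fix S assume S: "?P S" and m: "\<And>T. ?P T \<Longrightarrow> card T \<le> card S"
    show thesis
    proof (rule that)
      show "S0 \<subseteq> S" using S by simp
      show "agreeing G H V S" using agreeing_superset[OF assms(1)] S by simp
      fix T assume "S \<subseteq> T" "T \<subseteq> V" "prime G T" "agree G H T"
      then show "card T \<le> card S" using S by (intro m) auto
    qed
  qed (use assms(2) in auto)
qed

lemma flips_rev:
  assumes "flips G S g h" "s \<in> S" "t \<in> S" "s \<noteq> t" "ugraph G" "h s" "g t"
  shows "\<not> G s t"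
  using assms ugraphD(1)[OF assms(5), of s t] unfolding flips_def by metis

lemma flips_mono: "flips G S g h \<Longrightarrow> D \<subseteq> S \<Longrightarrow> flips G D g h"
  unfolding flips_def by blast

text \<open>A flip of a larger set restricts to a flip of the seed, so excluding flips on the seed
  alone makes all vertices tame.\<close>

theorem agree_from_seed:
  assumes S0: "agreeing G H V S0" and "finite V" and prV: "prime G V"
    and nf: "\<And>g h. \<not> flips G S0 g h" "\<And>g h. \<not> flips (co G) S0 g h"
  shows "agree G H V"
proof -
  obtain S where S: "S0 \<subseteq> S" "agreeing G H V S"
    and max: "\<And>T. S \<subseteq> T \<Longrightarrow> T \<subseteq> V \<Longrightarrow> prime G T \<Longrightarrow> agree G H T \<Longrightarrow> card T \<le> card S"
    using maximal_superset[OF S0 assms(2)] by metis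
  interpret agreeing G H V S by fact
  have "tame G H S x" if x: "x \<in> V - S" for x
  proof -
    have "\<not> (prime G (insert x S) \<and> agree G H (insert x S))"
    proof
      assume "prime G (insert x S) \<and> agree G H (insert x S)"
      then have "card (insert x S) \<le> card S" using x SV by (intro max) auto
      moreover have "finite S" using assms(2) SV finite_subset by blast
      ultimately show False using x by simp
    qed
    then show ?thesis using tame_or_flips[OF x] flips_mono[OF _ S(1)] nf by blast
  qed
  then have "S = V" using maximal_agreeing[OF assms(2) prV max] by blast
  then show ?thesis using ag by simp
qed

subsection \<open>Seeds given by lists of vertices\<close>

definition adj_list :: "('a \<Rightarrow> 'a \<Rightarrow> bool) \<Rightarrow> 'a list \<Rightarrow> (nat \<Rightarrow> nat \<Rightarrow> bool) \<Rightarrow> bool" where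
  "adj_list G ys e \<longleftrightarrow> distinct ys \<and> (\<forall>j<length ys. \<forall>i<j. G (ys ! i) (ys ! j) \<longleftrightarrow> e i j)"

definition path_adj :: "nat \<Rightarrow> nat \<Rightarrow> bool" where
  "path_adj i j \<longleftrightarrow> j = i + 1 \<or> i = j + 1"

definition cycle_adj :: "nat \<Rightarrow> nat \<Rightarrow> nat \<Rightarrow> bool" where
  "cycle_adj n i j \<longleftrightarrow> j = i + 1 \<or> i = j + 1 \<or> i = 0 \<and> j = n - 1 \<or> j = 0 \<and> i = n - 1"

lemma adj_listD:
  assumes "ugraph G" "adj_list G ys e" "\<And>i j. e i j \<longleftrightarrow> e j i" "i < length ys" "j < length ys" "i \<noteq> j"
  shows "G (ys ! i) (ys ! j) \<longleftrightarrow> e i j"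
proof (cases "i < j")
  case True then show ?thesis using assms by (simp add: adj_list_def)
next
  case False
  then have "G (ys ! j) (ys ! i) \<longleftrightarrow> e j i" using assms by (simp add: adj_list_def)
  then show ?thesis using ugraphD(1)[OF assms(1)] assms(3) by blast
qed

text \<open>\<open>m\<close> is the trace of a candidate homogeneous set on the indices, so that for
  concrete \<open>n\<close> and \<open>e\<close> the hypothesis \<open>P\<close> is a propositional
  tautology.\<close>

lemma prime_list:
  assumes u: "ugraph G" and ys: "adj_list G ys e" and es: "\<And>i j. e i j \<longleftrightarrow> e j i"
    and n: "length ys = n"
    and P: "\<And>m. \<forall>x<n. \<forall>a<n. \<forall>b<n. x \<noteq> a \<and> x \<noteq> b \<and> e x a \<and> \<not> e x b \<longrightarrow> m a \<and> m b \<longrightarrow> m x \<Longrightarrow>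
      (\<forall>i<n. m i) \<or> (\<forall>j<n. \<forall>i<j. \<not> (m i \<and> m j))"
  shows "prime G (set ys)"
  unfolding prime_def
proof (intro allI impI)
  fix M assume M: "homog G (set ys) M"
  let ?m = "\<lambda>i. ys ! i \<in> M"
  have "\<forall>x<n. \<forall>a<n. \<forall>b<n. x \<noteq> a \<and> x \<noteq> b \<and> e x a \<and> \<not> e x b \<longrightarrow> ?m a \<and> ?m b \<longrightarrow> ?m x"
  proof (intro allI impI, rule ccontr)
    fix x a b assume *: "x < n" "a < n" "b < n" "x \<noteq> a \<and> x \<noteq> b \<and> e x a \<and> \<not> e x b" "?m a \<and> ?m b" "\<not> ?m x"
    then have "G (ys ! x) (ys ! a)" "\<not> G (ys ! x) (ys ! b)"
      using adj_listD[OF u ys es] n by auto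
    moreover have "ys ! x \<in> set ys - M" using * n by simp
    ultimately show False using M * unfolding homog_def by blast
  qed
  from P[OF this] show "M = set ys \<or> (\<forall>a\<in>M. \<forall>b\<in>M. a = b)"
  proof
    assume "\<forall>i<n. ?m i"
    then have "set ys \<subseteq> M" using n by (auto simp: in_set_conv_nth)
    then show ?thesis using M by (auto simp: homog_def)
  next
    assume no: "\<forall>j<n. \<forall>i<j. \<not> (?m i \<and> ?m j)"
    have "a = b" if "a \<in> M" "b \<in> M" for a b
    proof -
      have "a \<in> set ys" "b \<in> set ys" using that M by (auto simp: homog_def)
      then obtain i j where ij: "i < n" "j < n" "a = ys ! i" "b = ys ! j" using n by (metis in_set_conv_nth)
      then have "\<not> i < j" "\<not> j < i" using no that by blast+
      then show ?thesis using ij by (metis linorder_neqE_nat)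
    qed
    then show ?thesis by blast
  qed
qed

lemma flips_list:
  assumes "flips G (set ys) g h" "adj_list G ys e" "length ys = n" "ugraph G"
  defines "g' \<equiv> \<lambda>i. g (ys ! i)" and "h' \<equiv> \<lambda>i. h (ys ! i)"
  shows "(\<forall>i<n. \<not> (g' i \<and> h' i)) \<and> (\<forall>j<n. \<forall>i<j. (g' i \<and> g' j \<or> h' i \<and> h' j \<longrightarrow> e i j) \<and>
     (g' i \<and> h' j \<or> h' i \<and> g' j \<longrightarrow> \<not> e i j) \<and> (\<not> g' i \<and> \<not> h' i \<and> \<not> g' j \<and> \<not> h' j \<longrightarrow> \<not> e i j))"
proof (intro conjI allI impI)
  fix i assume "i < n" then show "\<not> (g' i \<and> h' i)" using assms by (simp add: flips_def)
next
  fix j i assume ij: "j < n" "i < j"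
  then have in_ys: "ys ! i \<in> set ys" "ys ! j \<in> set ys" "ys ! i \<noteq> ys ! j" "G (ys ! i) (ys ! j) \<longleftrightarrow> e i j"
    using assms(2,3) by (auto simp: adj_list_def nth_eq_iff_index_eq)
  { assume "g' i \<and> g' j \<or> h' i \<and> h' j"
    then show "e i j" using assms(1) in_ys unfolding flips_def g'_def h'_def by blast }
  { assume "\<not> g' i \<and> \<not> h' i \<and> \<not> g' j \<and> \<not> h' j"
    then show "\<not> e i j" using assms(1) in_ys unfolding flips_def g'_def h'_def by blast }
  { assume *: "g' i \<and> h' j \<or> h' i \<and> g' j"
    show "\<not> e i j"
    proof
      assume e: "e i j"
      have "\<not> (g' i \<and> h' j)" using assms(1) in_ys e unfolding flips_def g'_def h'_def by blast
      then have "h' i \<and> g' j" using * by blast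
      then show False using flips_rev[OF assms(1) in_ys(1-3) assms(4)] in_ys e unfolding g'_def h'_def by blast
    qed }
qed

section \<open>Propositional checks on short paths and cycles\<close>

context notes [simp] = numeral_eq_Suc All_less_Suc begin

lemma prime_path8:
  fixes m :: "nat \<Rightarrow> bool"
  assumes "\<forall>x<8. \<forall>a<8. \<forall>b<8. x \<noteq> a \<and> x \<noteq> b \<and> path_adj x a \<and> \<not> path_adj x b \<longrightarrow> m a \<and> m b \<longrightarrow> m x"
  shows "(\<forall>i<8. m i) \<or> (\<forall>j<8. \<forall>i<j. \<not> (m i \<and> m j))"
  apply simp
  using assms[unfolded path_adj_def, simplified] by satx

lemma prime_cycle6:
  fixes m :: "nat \<Rightarrow> bool"
  assumes "\<forall>x<6. \<forall>a<6. \<forall>b<6. x \<noteq> a \<and> x \<noteq> b \<and> cycle_adj 6 x a \<and> \<not> cycle_adj 6 x b \<longrightarrow> m a \<and> m b \<longrightarrow> m x"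
  shows "(\<forall>i<6. m i) \<or> (\<forall>j<6. \<forall>i<j. \<not> (m i \<and> m j))"
  apply simp
  using assms[unfolded cycle_adj_def, simplified] by satx

lemma prime_cycle7:
  fixes m :: "nat \<Rightarrow> bool"
  assumes "\<forall>x<7. \<forall>a<7. \<forall>b<7. x \<noteq> a \<and> x \<noteq> b \<and> cycle_adj 7 x a \<and> \<not> cycle_adj 7 x b \<longrightarrow> m a \<and> m b \<longrightarrow> m x"
  shows "(\<forall>i<7. m i) \<or> (\<forall>j<7. \<forall>i<j. \<not> (m i \<and> m j))"
  apply simp
  using assms[unfolded cycle_adj_def, simplified] by satx

lemma prime_cycle8:
  fixes m :: "nat \<Rightarrow> bool"
  assumes "\<forall>x<8. \<forall>a<8. \<forall>b<8. x \<noteq> a \<and> x \<noteq> b \<and> cycle_adj 8 x a \<and> \<not> cycle_adj 8 x b \<longrightarrow> m a \<and> m b \<longrightarrow> m x"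
  shows "(\<forall>i<8. m i) \<or> (\<forall>j<8. \<forall>i<j. \<not> (m i \<and> m j))"
  apply simp
  using assms[unfolded cycle_adj_def, simplified] by satx

definition flip_labels :: "nat \<Rightarrow> (nat \<Rightarrow> nat \<Rightarrow> bool) \<Rightarrow> (nat \<Rightarrow> bool) \<Rightarrow> (nat \<Rightarrow> bool) \<Rightarrow> bool" where
  "flip_labels n e g h \<longleftrightarrow> (\<forall>i<n. \<not> (g i \<and> h i)) \<and> (\<forall>j<n. \<forall>i<j. (g i \<and> g j \<or> h i \<and> h j \<longrightarrow> e i j) \<and>
     (g i \<and> h j \<or> h i \<and> g j \<longrightarrow> \<not> e i j) \<and> (\<not> g i \<and> \<not> h i \<and> \<not> g j \<and> \<not> h j \<longrightarrow> \<not> e i j))"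

lemma no_flip_path8: "\<not> flip_labels 8 path_adj g h"
proof
  assume "flip_labels 8 path_adj g h"
  from this[unfolded flip_labels_def path_adj_def, simplified] show False by satx
qed

lemma no_flip_co_path8: "\<not> flip_labels 8 (\<lambda>i j. \<not> path_adj i j) g h"
proof
  assume "flip_labels 8 (\<lambda>i j. \<not> path_adj i j) g h"
  from this[unfolded flip_labels_def path_adj_def, simplified] show False by satx
qed

lemma no_flip_cycle7: "\<not> flip_labels 7 (cycle_adj 7) g h"
proof
  assume "flip_labels 7 (cycle_adj 7) g h"
  from this[unfolded flip_labels_def cycle_adj_def, simplified] show False by satx
qed

lemma no_flip_co_cycle7: "\<not> flip_labels 7 (\<lambda>i j. \<not> cycle_adj 7 i j) g h"
proof
  assume "flip_labels 7 (\<lambda>i j. \<not> cycle_adj 7 i j) g h"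
  from this[unfolded flip_labels_def cycle_adj_def, simplified] show False by satx
qed

lemma no_flip_cycle8: "\<not> flip_labels 8 (cycle_adj 8) g h"
proof
  assume "flip_labels 8 (cycle_adj 8) g h"
  from this[unfolded flip_labels_def cycle_adj_def, simplified] show False by satx
qed

lemma no_flip_co_cycle8: "\<not> flip_labels 8 (\<lambda>i j. \<not> cycle_adj 8 i j) g h"
proof
  assume "flip_labels 8 (\<lambda>i j. \<not> cycle_adj 8 i j) g h"
  from this[unfolded flip_labels_def cycle_adj_def, simplified] show False by satx
qed

lemma no_flip_co_cycle6: "\<not> flip_labels 6 (\<lambda>i j. \<not> cycle_adj 6 i j) g h"
proof
  assume "flip_labels 6 (\<lambda>i j. \<not> cycle_adj 6 i j) g h"
  from this[unfolded flip_labels_def cycle_adj_def, simplified] show False by satx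
qed

text \<open>The cliques are two opposite edges of the hexagon; the two vertices left over are
  opposite, hence non-adjacent.\<close>

lemma flip_cycle6:
  assumes "flip_labels 6 (cycle_adj 6) g h"
  shows "\<exists>(p, q, r, s)\<in>{(0, 1, 3, 4), (1, 2, 4, 5), (2, 3, 5, 0), (3, 4, 0, 1), (4, 5, 1, 2), (5, 0, 2, 3)}.
    \<forall>j<6. (g j \<longleftrightarrow> j = p \<or> j = q) \<and> (h j \<longleftrightarrow> j = r \<or> j = s)"
  apply simp
  using assms[unfolded flip_labels_def cycle_adj_def, simplified] by satx

text \<open>The P4s of an induced path are its runs of four consecutive vertices. Apart from the
  path and its complement, a realisation is twisted towards one end; the last two alternatives
  record only what is needed of this. The comparisons of pairs starting at 0 and 1 make the two
  twists incompatible in windows shifted by one.\<close>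

lemma path8_structure:
  fixes h :: "nat \<Rightarrow> nat \<Rightarrow> bool"
  assumes "\<forall>d<8. \<forall>c<d. \<forall>b<c. \<forall>a<b. p4b (h a b) (h a c) (h a d) (h b c) (h b d) (h c d) \<longleftrightarrow> d = a + 3"
  shows "(\<forall>j<8. \<forall>i<j. h i j \<longleftrightarrow> path_adj i j) \<or> (\<forall>j<8. \<forall>i<j. h i j \<longleftrightarrow> \<not> path_adj i j) \<or>
    h 0 1 \<noteq> h 0 2 \<and> h 0 3 = h 0 2 \<and> h 0 4 = h 0 2 \<and> h 1 3 \<noteq> h 0 2 \<and> h 1 3 = h 1 4 \<or>
    h 6 7 \<noteq> h 5 7 \<and> h 4 7 = h 5 7 \<and> h 3 7 = h 5 7 \<and> h 4 6 \<noteq> h 5 7 \<and> h 0 2 \<noteq> h 0 3 \<and> h 1 3 \<noteq> h 1 4"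
  unfolding path_adj_def apply simp
  using assms[simplified] unfolding p4b_def by satx

lemma cycle7_structure:
  fixes h :: "nat \<Rightarrow> nat \<Rightarrow> bool"
  assumes "\<forall>d<7. \<forall>c<d. \<forall>b<c. \<forall>a<b. p4b (h a b) (h a c) (h a d) (h b c) (h b d) (h c d) \<longleftrightarrow>
     p4b (cycle_adj 7 a b) (cycle_adj 7 a c) (cycle_adj 7 a d) (cycle_adj 7 b c) (cycle_adj 7 b d) (cycle_adj 7 c d)"
  shows "(\<forall>j<7. \<forall>i<j. h i j \<longleftrightarrow> cycle_adj 7 i j) \<or> (\<forall>j<7. \<forall>i<j. h i j \<longleftrightarrow> \<not> cycle_adj 7 i j)"
  unfolding cycle_adj_def apply simp
  using assms[unfolded cycle_adj_def, simplified] unfolding p4b_def by satx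

lemma cycle8_structure:
  fixes h :: "nat \<Rightarrow> nat \<Rightarrow> bool"
  assumes "\<forall>d<8. \<forall>c<d. \<forall>b<c. \<forall>a<b. p4b (h a b) (h a c) (h a d) (h b c) (h b d) (h c d) \<longleftrightarrow>
     p4b (cycle_adj 8 a b) (cycle_adj 8 a c) (cycle_adj 8 a d) (cycle_adj 8 b c) (cycle_adj 8 b d) (cycle_adj 8 c d)"
  shows "(\<forall>j<8. \<forall>i<j. h i j \<longleftrightarrow> cycle_adj 8 i j) \<or> (\<forall>j<8. \<forall>i<j. h i j \<longleftrightarrow> \<not> cycle_adj 8 i j)"
  unfolding cycle_adj_def apply simp
  using assms[unfolded cycle_adj_def, simplified] unfolding p4b_def by satx

text \<open>The remaining realisations are dominoes and their complements: a pair of opposite edges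
  gives way to the three long diagonals.\<close>

lemma cycle6_structure:
  fixes h :: "nat \<Rightarrow> nat \<Rightarrow> bool"
  assumes "\<forall>d<6. \<forall>c<d. \<forall>b<c. \<forall>a<b. p4b (h a b) (h a c) (h a d) (h b c) (h b d) (h c d) \<longleftrightarrow>
     p4b (cycle_adj 6 a b) (cycle_adj 6 a c) (cycle_adj 6 a d) (cycle_adj 6 b c) (cycle_adj 6 b d) (cycle_adj 6 c d)"
  shows "(\<forall>j<6. \<forall>i<j. h i j \<longleftrightarrow> cycle_adj 6 i j) \<or> (\<forall>j<6. \<forall>i<j. h i j \<longleftrightarrow> \<not> cycle_adj 6 i j) \<or>
    (\<exists>(p, q, r, s)\<in>{(0, 1, 3, 4), (1, 2, 4, 5), (2, 3, 0, 5)}.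
      (\<forall>j<6. \<forall>i<j. h i j \<longleftrightarrow> j = i + 3 \<or> cycle_adj 6 i j \<and> (i, j) \<notin> {(p, q), (r, s)}) \<or>
      (\<forall>j<6. \<forall>i<j. h i j \<longleftrightarrow> \<not> (j = i + 3 \<or> cycle_adj 6 i j \<and> (i, j) \<notin> {(p, q), (r, s)})))"
  apply (simp add: cycle_adj_def)
  using assms[unfolded cycle_adj_def, simplified] unfolding p4b_def by satx

end

text \<open>If \<open>H\<close> induces the complement of the pattern on the list, \<open>H\<close>
  is replaced by its complement, which has the same P4-structure.\<close>

theorem agree_from_list:
  assumes "ugraph G" "ugraph H" "p4iso G H V" "finite V" "prime G V" "set ys \<subseteq> V"
    and ys: "adj_list G ys e" "length ys = n" "n \<ge> 3" and es: "\<And>i j. e i j \<longleftrightarrow> e j i"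
    and P: "\<And>m. \<forall>x<n. \<forall>a<n. \<forall>b<n. x \<noteq> a \<and> x \<noteq> b \<and> e x a \<and> \<not> e x b \<longrightarrow> m a \<and> m b \<longrightarrow> m x \<Longrightarrow>
      (\<forall>i<n. m i) \<or> (\<forall>j<n. \<forall>i<j. \<not> (m i \<and> m j))"
    and F: "\<And>g h. \<not> flip_labels n e g h" "\<And>g h. \<not> flip_labels n (\<lambda>i j. \<not> e i j) g h"
    and h: "(\<forall>j<n. \<forall>i<j. H (ys ! i) (ys ! j) \<longleftrightarrow> e i j) \<or> (\<forall>j<n. \<forall>i<j. H (ys ! i) (ys ! j) \<longleftrightarrow> \<not> e i j)"
  shows "agree G H V \<or> agree G (co H) V"
proof -
  have pr: "prime G (set ys)" by (rule prime_list[OF assms(1) ys(1) es ys(2) P])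
  have d: "distinct ys" using ys by (simp add: adj_list_def)
  have three: "\<exists>c\<in>set ys. c \<noteq> a \<and> c \<noteq> b" for a b
  proof (rule ccontr)
    assume "\<not> ?thesis"
    then have "set ys \<subseteq> {a, b}" by blast
    then have "card (set ys) \<le> card {a, b}" by (intro card_mono) auto
    also have "\<dots> \<le> 2" by (simp add: card_insert_if)
    finally show False using d ys by (simp add: distinct_card)
  qed
  have nf: "\<not> flips G (set ys) g h" for g h
  proof
    assume "flips G (set ys) g h"
    from flips_list[OF this ys(1,2) assms(1)] show False
      using F(1)[of "\<lambda>i. g (ys ! i)" "\<lambda>i. h (ys ! i)"] by (simp add: flip_labels_def)
  qed
  have ysc: "adj_list (co G) ys (\<lambda>i j. \<not> e i j)"
    using ys(1) by (auto simp: adj_list_def co_def nth_eq_iff_index_eq)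
  have nfc: "\<not> flips (co G) (set ys) g h" for g h
  proof
    assume "flips (co G) (set ys) g h"
    from flips_list[OF this ysc ys(2) ugraph_co[OF assms(1)]] show False
      using F(2)[of "\<lambda>i. g (ys ! i)" "\<lambda>i. h (ys ! i)"] by (simp add: flip_labels_def)
  qed
  have main: "agree G K V" if K: "ugraph K" "p4iso G K V" "\<forall>j<n. \<forall>i<j. K (ys ! i) (ys ! j) \<longleftrightarrow> e i j" for K
  proof (rule agree_from_seed[OF _ assms(4,5) nf nfc])
    have K': "adj_list K ys e" using K(3) d ys(2) by (simp add: adj_list_def)
    show "agreeing G K V (set ys)"
    proof
      show "agree G K (set ys)"
        unfolding agree_def
      proof (intro ballI)
        fix a b assume "a \<in> set ys" "b \<in> set ys"
        then obtain i j where ij: "i < n" "j < n" "a = ys ! i" "b = ys ! j" using ys(2) by (metis in_set_conv_nth)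
        show "G a b = K a b"
        proof (cases "i = j")
          case True
          then show ?thesis using ij ugraphD(2)[OF assms(1)] ugraphD(2)[OF K(1)] by simp
        next
          case False
          then show ?thesis
            using adj_listD[OF assms(1) ys(1) es, of i j] adj_listD[OF K(1) K' es, of i j] ij ys(2) by simp
        qed
      qed
    qed (use assms K pr three in auto)
  qed
  from h show ?thesis
  proof
    assume "\<forall>j<n. \<forall>i<j. H (ys ! i) (ys ! j) \<longleftrightarrow> e i j"
    then show ?thesis using main assms(2,3) by blast
  next
    assume *: "\<forall>j<n. \<forall>i<j. H (ys ! i) (ys ! j) \<longleftrightarrow> \<not> e i j"
    have "\<forall>j<n. \<forall>i<j. co H (ys ! i) (ys ! j) \<longleftrightarrow> e i j"
    proof (intro allI impI)
      fix j i assume "j < n" "i < j"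
      then show "co H (ys ! i) (ys ! j) \<longleftrightarrow> e i j"
        using * d ys(2) by (simp add: co_def nth_eq_iff_index_eq)
    qed
    then show ?thesis using main[OF ugraph_co[OF assms(2)]] assms(3) by (simp add: p4iso_co2)
  qed
qed

subsection \<open>Long cycles\<close>

text \<open>In an alternative realisation of the P4-structure of a long path, the adjacency of a vertex
  to all later vertices but the next one is constant, and this constant alternates along the path.
  Going once around a cycle this is contradictory.\<close>

lemma alternating_chain_impossible:
  fixes f :: "int \<Rightarrow> int \<Rightarrow> bool"
  assumes k: "k \<ge> 9" and sym: "\<And>i j. f i j \<longleftrightarrow> f j i" and per: "\<And>i j. f i (j + k) \<longleftrightarrow> f i j"
    and X: "\<And>i. f i (i + 1) \<noteq> f i (i + 2) \<and> f i (i + 3) = f i (i + 2) \<and> f i (i + 4) = f i (i + 2) \<and>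
      f (i + 1) (i + 3) \<noteq> f i (i + 2)"
    and np: "\<And>i m. 5 \<le> m \<Longrightarrow> m < k \<Longrightarrow> \<not> p4b (f i (i + 2)) (f i (i + 3)) (f i (i + m))
      (f (i + 2) (i + 3)) (f (i + 2) (i + m)) (f (i + 3) (i + m))"
  shows False
proof -
  have alt: "f (i + 1) (i + 1 + 2) \<noteq> f i (i + 2)" for i using X[of i] by (simp add: add.commute)
  have alt2: "f (i + 2) (i + 2 + 2) = f i (i + 2)" for i using alt[of i] alt[of "i + 1"] by (simp add: add.assoc) 
  have alt3: "f (i + 3) (i + 3 + 2) \<noteq> f i (i + 2)" for i using alt2[of i] alt[of "i + 2"] by (simp add: add.assoc)
  have main: "f i (i + int m) = f i (i + 2)" if "2 \<le> m" "int m < k" for m i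
    using that
  proof (induction m arbitrary: i rule: less_induct)
    case (less m)
    show ?case
    proof (cases "m \<le> 4")
      case True
      then have "m = 2 \<or> m = 3 \<or> m = 4" using less.prems by auto
      then show ?thesis using X[of i] by auto
    next
      case False
      have 1: "f (i + 2) (i + int m) = f i (i + 2)"
      proof -
        have "f (i + 2) (i + 2 + int (m - 2)) = f (i + 2) (i + 2 + 2)"
          using False less.prems by (intro less.IH) auto
        moreover have "i + 2 + int (m - 2) = i + int m" using False by simp
        ultimately show ?thesis using alt2[of i] by simp
      qed
      have 2: "f (i + 3) (i + int m) \<noteq> f i (i + 2)"
      proof -
        have "f (i + 3) (i + 3 + int (m - 3)) = f (i + 3) (i + 3 + 2)"
          using False less.prems by (intro less.IH) auto
        moreover have "i + 3 + int (m - 3) = i + int m" using False by simp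
        ultimately show ?thesis using alt3[of i] by simp
      qed
      have 3: "f (i + 2) (i + 3) \<noteq> f i (i + 2)" using X[of "i + 2"] alt2[of i] by (simp add: add.assoc)
      have 4: "f i (i + 3) = f i (i + 2)" using X[of i] by simp
      \<comment> \<open>If \<open>f i (i + m)\<close> differed from \<open>f i (i + 2)\<close>, the
        four vertices at \<open>i\<close>, \<open>i + 2\<close>, \<open>i + 3\<close>,
        \<open>i + m\<close> would form a P4.\<close>
      show ?thesis
        using np[of "int m" i] False less.prems 1 2 3 4 unfolding p4b_def by auto
    qed
  qed
  \<comment> \<open>Index \<open>k\<close> names the same vertex as 0, but the constants at 0 and at
    3 are opposite.\<close>
  have "f 3 (3 + int (nat (k - 3))) = f 3 (3 + 2)" using k by (intro main) auto
  then have "f 3 k = f 3 5" using k by simp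
  moreover have "f 3 k = f 3 0" using per[of 3 0] by simp
  moreover have "f 0 3 = f 0 2" using X[of 0] by simp
  moreover have "f 3 5 \<noteq> f 0 2" using alt3[of 0] by simp
  ultimately show False using sym[of 0 3] by simp
qed

lemma p4b_reverse: "p4b cd bd ad bc ac ab = p4b ab ac ad bc bd cd"
  unfolding p4b_def by (cases ab; cases ac; cases ad; cases bc; cases bd; cases cd) simp_all

lemma iscycle_adj_list:
  assumes "iscycle G xs" "length xs \<ge> 3"
  shows "adj_list G xs (cycle_adj (length xs))"
  unfolding adj_list_def
proof (intro conjI allI impI)
  show "distinct xs" using assms by (simp add: iscycle_def)
  fix j i assume "j < length xs" "i < j"
  then show "G (xs ! i) (xs ! j) \<longleftrightarrow> cycle_adj (length xs) i j"
    using assms unfolding iscycle_def cycle_adj_def by auto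
qed

lemma path_adj_sym: "path_adj i j \<longleftrightarrow> path_adj j i"
  by (auto simp: path_adj_def)

lemma cycle_adj_sym: "cycle_adj n i j \<longleftrightarrow> cycle_adj n j i"
  by (auto simp: cycle_adj_def)

lemma p4iso_nth:
  assumes "ugraph G" "p4iso G H V" "set ys \<subseteq> V" "adj_list G ys e"
    and "a < b" "b < c" "c < d" "d < length ys"
  shows "p4b (H (ys ! a) (ys ! b)) (H (ys ! a) (ys ! c)) (H (ys ! a) (ys ! d))
    (H (ys ! b) (ys ! c)) (H (ys ! b) (ys ! d)) (H (ys ! c) (ys ! d)) \<longleftrightarrow>
    p4b (e a b) (e a c) (e a d) (e b c) (e b d) (e c d)"
proof -
  have V: "ys ! i \<in> V" if "i < length ys" for i using assms(3) that nth_mem by blast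
  have ne: "ys ! i \<noteq> ys ! j" if "i < j" "j < length ys" for i j
    using assms(4) that by (simp add: adj_list_def nth_eq_iff_index_eq)
  have e: "G (ys ! i) (ys ! j) \<longleftrightarrow> e i j" if "i < j" "j < length ys" for i j
    using assms(4) that by (simp add: adj_list_def)
  have "P4on G (ys ! a) (ys ! b) (ys ! c) (ys ! d) \<longleftrightarrow> P4on H (ys ! a) (ys ! b) (ys ! c) (ys ! d)"
    using assms(2,5-8) V ne unfolding p4iso_def by simp
  then show ?thesis using e assms(5-8) unfolding P4on_def by simp
qed

text \<open>From length 9 on, any eight consecutive vertices induce a path, to which
  \<open>path8_structure\<close> applies; lengths 7 and 8 are checked directly. A window realised as
  a path or its complement is itself a seed. Otherwise all windows are twisted, and all towards the
  same end.\<close>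

theorem agree_from_long_cycle:
  assumes ug: "ugraph G" and uh: "ugraph H" and iso: "p4iso G H V" and fin: "finite V" and pr: "prime G V"
    and xs: "iscycle G xs" "set xs \<subseteq> V" "length xs \<ge> 7"
  shows "agree G H V \<or> agree G (co H) V"
proof -
  let ?k = "length xs"
  have adj: "adj_list G xs (cycle_adj ?k)" by (rule iscycle_adj_list[OF xs(1)]) (use xs(3) in simp)
  consider "?k = 7" | "?k = 8" | "?k \<ge> 9" using xs(3) by linarith
  then show ?thesis
  proof cases
    case 1
    have "\<forall>d<7. \<forall>c<d. \<forall>b<c. \<forall>a<b. p4b (H (xs ! a) (xs ! b)) (H (xs ! a) (xs ! c)) (H (xs ! a) (xs ! d))
      (H (xs ! b) (xs ! c)) (H (xs ! b) (xs ! d)) (H (xs ! c) (xs ! d)) \<longleftrightarrow>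
      p4b (cycle_adj 7 a b) (cycle_adj 7 a c) (cycle_adj 7 a d) (cycle_adj 7 b c) (cycle_adj 7 b d) (cycle_adj 7 c d)"
      using p4iso_nth[OF ug iso xs(2) adj] 1 by simp
    from cycle7_structure[OF this] adj show ?thesis unfolding 1
      by (intro agree_from_list[OF ug uh iso fin pr xs(2) _ 1 _ cycle_adj_sym prime_cycle7
        no_flip_cycle7 no_flip_co_cycle7]) auto
  next
    case 2
    have "\<forall>d<8. \<forall>c<d. \<forall>b<c. \<forall>a<b. p4b (H (xs ! a) (xs ! b)) (H (xs ! a) (xs ! c)) (H (xs ! a) (xs ! d))
      (H (xs ! b) (xs ! c)) (H (xs ! b) (xs ! d)) (H (xs ! c) (xs ! d)) \<longleftrightarrow>
      p4b (cycle_adj 8 a b) (cycle_adj 8 a c) (cycle_adj 8 a d) (cycle_adj 8 b c) (cycle_adj 8 b d) (cycle_adj 8 c d)"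
      using p4iso_nth[OF ug iso xs(2) adj] 2 by simp
    from cycle8_structure[OF this] adj show ?thesis unfolding 2
      by (intro agree_from_list[OF ug uh iso fin pr xs(2) _ 2 _ cycle_adj_sym prime_cycle8
        no_flip_cycle8 no_flip_co_cycle8]) auto
  next
    case 3
    define k where "k = int ?k"
    \<comment> \<open>Integer indices modulo the length let windows wrap around and allow the cycle
      to be read backwards.\<close>
    define v where "v i = xs ! nat (i mod k)" for i
    have k9: "k \<ge> 9" using 3 by (simp add: k_def)
    have idx: "nat (i mod k) < ?k" for i
      using k9 pos_mod_bound[of k i] pos_mod_sign[of k i] unfolding k_def by linarith
    have vV: "v i \<in> V" for i unfolding v_def using idx xs(2) nth_mem by blast
    have step: "v i \<noteq> v (i + m) \<and> (G (v i) (v (i + m)) \<longleftrightarrow> m = 1 \<or> m = k - 1)"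
      if m: "0 < m" "m < k" for i m
    proof -
      let ?p = "i mod k"
      have p: "0 \<le> ?p" "?p < k" using k9 by auto
      have pm: "(i + m) mod k = (?p + m) mod k" by (simp add: mod_add_left_eq)
      have d: "distinct xs" using xs by (simp add: iscycle_def)
      have cyc: "xs ! a \<noteq> xs ! b \<and> (G (xs ! a) (xs ! b) \<longleftrightarrow> int b - int a = 1 \<or> int b - int a = k - 1)"
        if "a < b" "b < ?k" for a b
      proof -
        have "G (xs ! a) (xs ! b) \<longleftrightarrow> b = Suc a \<or> a = 0 \<and> b = ?k - 1"
          using xs(1) that unfolding iscycle_def by blast
        moreover have "b = Suc a \<or> a = 0 \<and> b = ?k - 1 \<longleftrightarrow> int b - int a = 1 \<or> int b - int a = k - 1"
          using that unfolding k_def by linarith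
        ultimately show ?thesis using d that by (simp add: nth_eq_iff_index_eq)
      qed
      show ?thesis
      proof (cases "?p + m < k")
        case True
        then have q: "(i + m) mod k = ?p + m" using p m pm by simp
        have lt: "nat ?p < nat (?p + m)" using p(1) m(1) by linarith
        have ub: "nat (?p + m) < ?k" using idx[of "i + m"] q by simp
        have e: "int (nat (?p + m)) - int (nat ?p) = m" using p(1) m(1) by linarith
        from cyc[OF lt ub, unfolded e] show ?thesis unfolding v_def q .
      next
        case False
        have "(?p + m) mod k = (?p + m - k) mod k" by simp
        also have "\<dots> = ?p + m - k" by (rule mod_pos_pos_trivial) (use False p m in linarith)+
        finally have q: "(i + m) mod k = ?p + m - k" using pm by simp
        have lt: "nat (?p + m - k) < nat ?p" using p m False by linarith
        have e: "int (nat ?p) - int (nat (?p + m - k)) = k - m" using p(1) False by linarith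
        have "(k - m = 1 \<or> k - m = k - 1) \<longleftrightarrow> (m = 1 \<or> m = k - 1)" by linarith
        then show ?thesis
          using cyc[OF lt idx, unfolded e] ugraphD(1)[OF ug, of "v i"] unfolding v_def q by metis
      qed
    qed
    define f where "f i j = H (v i) (v j)" for i j
    have f_sym: "f i j \<longleftrightarrow> f j i" for i j unfolding f_def by (rule ugraphD(1)[OF uh])
    have f_per: "f i (j + k) \<longleftrightarrow> f i j" "f (i + k) j \<longleftrightarrow> f i j" for i j by (auto simp: f_def v_def)
    have P: "p4b (f i (i + a)) (f i (i + b)) (f i (i + c)) (f (i + a) (i + b)) (f (i + a) (i + c)) (f (i + b) (i + c))
      \<longleftrightarrow> p4b (a = 1 \<or> a = k - 1) (b = 1 \<or> b = k - 1) (c = 1 \<or> c = k - 1)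
        (b - a = 1 \<or> b - a = k - 1) (c - a = 1 \<or> c - a = k - 1) (c - b = 1 \<or> c - b = k - 1)"
      if abc: "0 < a" "a < b" "b < c" "c < k" for i a b c
    proof -
      have s: "v i \<noteq> v (i + a) \<and> (G (v i) (v (i + a)) \<longleftrightarrow> a = 1 \<or> a = k - 1)"
        "v i \<noteq> v (i + b) \<and> (G (v i) (v (i + b)) \<longleftrightarrow> b = 1 \<or> b = k - 1)"
        "v i \<noteq> v (i + c) \<and> (G (v i) (v (i + c)) \<longleftrightarrow> c = 1 \<or> c = k - 1)"
        "v (i + a) \<noteq> v (i + b) \<and> (G (v (i + a)) (v (i + b)) \<longleftrightarrow> b - a = 1 \<or> b - a = k - 1)"
        "v (i + a) \<noteq> v (i + c) \<and> (G (v (i + a)) (v (i + c)) \<longleftrightarrow> c - a = 1 \<or> c - a = k - 1)"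
        "v (i + b) \<noteq> v (i + c) \<and> (G (v (i + b)) (v (i + c)) \<longleftrightarrow> c - b = 1 \<or> c - b = k - 1)"
        using step[of a i] step[of b i] step[of c i] step[of "b - a" "i + a"] step[of "c - a" "i + a"]
          step[of "c - b" "i + b"] abc by auto
      have "P4on G (v i) (v (i + a)) (v (i + b)) (v (i + c)) \<longleftrightarrow> P4on H (v i) (v (i + a)) (v (i + b)) (v (i + c))"
        using iso vV s unfolding p4iso_def by simp
      then show ?thesis unfolding P4on_def f_def using s by simp
    qed
    define h where "h i a b = f (i + int a) (i + int b)" for i a b
    have win: "(\<forall>q<8. \<forall>p<q. h i p q \<longleftrightarrow> path_adj p q) \<or> (\<forall>q<8. \<forall>p<q. h i p q \<longleftrightarrow> \<not> path_adj p q) \<or>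
      h i 0 1 \<noteq> h i 0 2 \<and> h i 0 3 = h i 0 2 \<and> h i 0 4 = h i 0 2 \<and> h i 1 3 \<noteq> h i 0 2 \<and> h i 1 3 = h i 1 4 \<or>
      h i 6 7 \<noteq> h i 5 7 \<and> h i 4 7 = h i 5 7 \<and> h i 3 7 = h i 5 7 \<and> h i 4 6 \<noteq> h i 5 7 \<and> h i 0 2 \<noteq> h i 0 3 \<and>
      h i 1 3 \<noteq> h i 1 4" for i
    proof (rule path8_structure, intro allI impI)
      fix d c b a :: nat assume o: "d < 8" "c < d" "b < c" "a < b"
      have "p4b (h i a b) (h i a c) (h i a d) (h i b c) (h i b d) (h i c d) \<longleftrightarrow>
        p4b (b = a + 1) (c = a + 1) (d = a + 1) (c = b + 1) (d = b + 1) (d = c + 1)"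
      proof -
        have E: "(int y - int x = 1 \<or> int y - int x = k - 1) = (y = x + 1)" if "x < y" "y < 8" for x y
          using that k9 by linarith
        have E6: "(int b - int a = 1 \<or> int b - int a = k - 1) = (b = a + 1)"
          "(int c - int a = 1 \<or> int c - int a = k - 1) = (c = a + 1)"
          "(int d - int a = 1 \<or> int d - int a = k - 1) = (d = a + 1)"
          "(int c - int b = 1 \<or> int c - int b = k - 1) = (c = b + 1)"
          "(int d - int b = 1 \<or> int d - int b = k - 1) = (d = b + 1)"
          "(int d - int c = 1 \<or> int d - int c = k - 1) = (d = c + 1)"
          using o by (intro E; simp)+
        have e: "i + int a + (int x - int a) = i + int x" "int x - int a - (int y - int a) = int x - int y" for x y
          by simp_all
        have "0 < int b - int a" "int b - int a < int c - int a" "int c - int a < int d - int a" "int d - int a < k"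
          using o k9 by auto
        from P[OF this, of "i + int a", unfolded e E6] show ?thesis unfolding h_def .
      qed
      also have "\<dots> \<longleftrightarrow> d = a + 3" using o unfolding p4b_def by auto
      finally show "p4b (h i a b) (h i a c) (h i a d) (h i b c) (h i b d) (h i c d) \<longleftrightarrow> d = a + 3" .
    qed
    show ?thesis
    proof (cases "\<exists>i. (\<forall>q<8. \<forall>p<q. h i p q \<longleftrightarrow> path_adj p q) \<or> (\<forall>q<8. \<forall>p<q. h i p q \<longleftrightarrow> \<not> path_adj p q)")
      case True
      then obtain i where i: "(\<forall>q<8. \<forall>p<q. h i p q \<longleftrightarrow> path_adj p q) \<or> (\<forall>q<8. \<forall>p<q. h i p q \<longleftrightarrow> \<not> path_adj p q)"
        by blast
      define ys where "ys = map (\<lambda>a. v (i + int a)) [0..<8]"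
      have len: "length ys = 8" and nth: "\<And>a. a < 8 \<Longrightarrow> ys ! a = v (i + int a)" by (auto simp: ys_def)
      have st: "v (i + int p) \<noteq> v (i + int q) \<and> (G (v (i + int p)) (v (i + int q)) \<longleftrightarrow> path_adj p q)"
        if "q < 8" "p < q" for p q
        using step[of "int q - int p" "i + int p"] that k9 by (auto simp: path_adj_def)
      have "adj_list G ys path_adj"
        unfolding adj_list_def
      proof (intro conjI allI impI)
        show "distinct ys" unfolding distinct_conv_nth len
        proof (intro allI impI)
          fix p q :: nat assume "p < 8" "q < 8" "p \<noteq> q"
          then show "ys ! p \<noteq> ys ! q" using st[of p q] st[of q p] nth by (cases "p < q") auto
        qed
        fix q p assume "q < length ys" "p < q"
        then show "G (ys ! p) (ys ! q) \<longleftrightarrow> path_adj p q" using st[of q p] nth len by simp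
      qed
      moreover have "set ys \<subseteq> V" using vV by (auto simp: ys_def)
      moreover have "(\<forall>j<8. \<forall>i<j. H (ys ! i) (ys ! j) \<longleftrightarrow> path_adj i j) \<or>
        (\<forall>j<8. \<forall>i<j. H (ys ! i) (ys ! j) \<longleftrightarrow> \<not> path_adj i j)"
        using i nth unfolding h_def f_def by simp
      ultimately show ?thesis
        by (intro agree_from_list[OF ug uh iso fin pr _ _ len _ path_adj_sym prime_path8
          no_flip_path8 no_flip_co_path8]) auto
    next
      case False
      define X where "X i \<longleftrightarrow> h i 0 1 \<noteq> h i 0 2 \<and> h i 0 3 = h i 0 2 \<and> h i 0 4 = h i 0 2 \<and>
        h i 1 3 \<noteq> h i 0 2 \<and> h i 1 3 = h i 1 4" for i
      define Y where "Y i \<longleftrightarrow> h i 6 7 \<noteq> h i 5 7 \<and> h i 4 7 = h i 5 7 \<and> h i 3 7 = h i 5 7 \<and>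
        h i 4 6 \<noteq> h i 5 7 \<and> h i 0 2 \<noteq> h i 0 3 \<and> h i 1 3 \<noteq> h i 1 4" for i
      have XY: "X i \<or> Y i" for i using win[of i] False unfolding X_def Y_def by blast
      have sh: "h (i + 1) 0 2 = h i 1 3" "h (i + 1) 0 3 = h i 1 4" for i
        unfolding h_def by (simp_all add: add.assoc)
      \<comment> \<open>The pairs 1, 3 and 1, 4 of one window are the pairs 0, 2 and 0, 3 of the
        next, so a window of the other kind cannot follow.\<close>
      have XX: "X i \<Longrightarrow> X (i + 1)" and YY: "Y i \<Longrightarrow> Y (i + 1)" for i
        using XY[of "i + 1"] sh[of i] unfolding X_def Y_def by auto
      have per: "h (i + k) a b = h i a b" for i a b
        using f_per(2)[of "i + int a" "i + k + int b"] f_per(1)[of "i + int a" "i + int b"]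
        unfolding h_def by (simp add: algebra_simps)
      \<comment> \<open>The property propagates forward only; a negative index is reached by adding
        enough multiples of \<open>k\<close>.\<close>
      have all: "Q j" if Q0: "Q 0" and suc: "\<And>i. Q i \<Longrightarrow> Q (i + 1)" and pq: "\<And>i. Q (i + k) \<longleftrightarrow> Q i" for Q and j :: int
      proof -
        have nn: "Q (int n)" for n
        proof (induction n)
          case (Suc n) then show ?case using suc[of "int n"] by (simp add: add.commute)
        qed (simp add: Q0)
        have "Q (j + int n * k) \<longleftrightarrow> Q j" for n
        proof (induction n)
          case (Suc n)
          have "j + int (Suc n) * k = (j + int n * k) + k" by (simp add: algebra_simps)
          then show ?case using pq[of "j + int n * k"] Suc by metis
        qed simp
        moreover have "j + int (nat \<bar>j\<bar>) * k \<ge> 0"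
        proof -
          have "\<bar>j\<bar> * 1 \<le> \<bar>j\<bar> * k" using k9 by (intro mult_left_mono) auto
          then show ?thesis by simp
        qed
        ultimately show ?thesis using nn[of "nat (j + int (nat \<bar>j\<bar>) * k)"] by (metis int_nat_eq)
      qed
      have np: "\<not> p4b (f i (i + 2)) (f i (i + 3)) (f i (i + m)) (f (i + 2) (i + 3)) (f (i + 2) (i + m)) (f (i + 3) (i + m))"
        if "5 \<le> m" "m < k" for i m
        using P[of 2 3 m i] that k9 unfolding p4b_def by auto
      have False
      proof (cases "X 0")
        case True
        have allX: "X i" for i
        proof (rule all[of X])
          show "X (i + k) \<longleftrightarrow> X i" for i by (simp add: X_def per)
        qed (rule True, rule XX)
        have "f i (i + 1) \<noteq> f i (i + 2) \<and> f i (i + 3) = f i (i + 2) \<and> f i (i + 4) = f i (i + 2) \<and>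
          f (i + 1) (i + 3) \<noteq> f i (i + 2)" for i
          using allX[of i] unfolding X_def h_def by simp
        then show False by (rule alternating_chain_impossible[OF k9 f_sym f_per(1) _ np])
      next
        case False
        then have "Y 0" using XY by blast
        have allY: "Y i" for i
        proof (rule all[of Y])
          show "Y (i + k) \<longleftrightarrow> Y i" for i by (simp add: Y_def per)
        qed (rule \<open>Y 0\<close>, rule YY)
        \<comment> \<open>Read backwards, a twist at the last vertex of each window becomes a twist
          at the first.\<close>
        let ?f = "\<lambda>i j. f (- i) (- j)"
        have 1: "?f i (i + 1) \<noteq> ?f i (i + 2) \<and> ?f i (i + 3) = ?f i (i + 2) \<and> ?f i (i + 4) = ?f i (i + 2) \<and>
          ?f (i + 1) (i + 3) \<noteq> ?f i (i + 2)" for i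
        proof -
          have e: "- i - 7 + 7 = - i" "- i - 7 + 6 = - (i + 1)" "- i - 7 + 5 = - (i + 2)"
            "- i - 7 + 4 = - (i + 3)" "- i - 7 + 3 = - (i + 4)" by simp_all
          have "f (- (i + 1)) (- i) \<noteq> f (- (i + 2)) (- i) \<and> f (- (i + 3)) (- i) = f (- (i + 2)) (- i) \<and>
            f (- (i + 4)) (- i) = f (- (i + 2)) (- i) \<and> f (- (i + 3)) (- (i + 1)) \<noteq> f (- (i + 2)) (- i)"
            using allY[of "- i - 7"] unfolding Y_def h_def of_nat_numeral e by blast
          then show ?thesis using f_sym by blast
        qed
        have 2: "?f i (j + k) \<longleftrightarrow> ?f i j" for i j
          using f_per(1)[of "- i" "- j - k"] by simp
        have 3: "\<not> p4b (?f i (i + 2)) (?f i (i + 3)) (?f i (i + m)) (?f (i + 2) (i + 3)) (?f (i + 2) (i + m)) (?f (i + 3) (i + m))"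
          if "5 \<le> m" "m < k" for i m
        proof -
          have e: "- (i + m) + (m - 3) = - (i + 3)" "- (i + m) + (m - 2) = - (i + 2)" "- (i + m) + m = - i" by simp_all
          have "\<not> p4b (f (- (i + m)) (- (i + 3))) (f (- (i + m)) (- (i + 2))) (f (- (i + m)) (- i))
            (f (- (i + 3)) (- (i + 2))) (f (- (i + 3)) (- i)) (f (- (i + 2)) (- i))"
            using P[of "m - 3" "m - 2" m "- (i + m)", unfolded e] that k9 unfolding p4b_def by auto
          then show ?thesis
            unfolding f_sym[of "- (i + m)" "- (i + 3)"] f_sym[of "- (i + m)" "- (i + 2)"] f_sym[of "- (i + m)" "- i"]
              f_sym[of "- (i + 3)" "- (i + 2)"] f_sym[of "- (i + 3)" "- i"] f_sym[of "- (i + 2)" "- i"]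
            by (simp add: p4b_reverse)
        qed
        show False by (rule alternating_chain_impossible[OF k9 f_sym 2 1 3])
      qed
      then show ?thesis by blast
    qed
  qed
qed

subsection \<open>Hexagons\<close>

definition hexagon :: "('a \<Rightarrow> 'a \<Rightarrow> bool) \<Rightarrow> 'a \<Rightarrow> 'a \<Rightarrow> 'a \<Rightarrow> 'a \<Rightarrow> 'a \<Rightarrow> 'a \<Rightarrow> bool" where
  "hexagon G a b c d e f \<longleftrightarrow> distinct [a, b, c, d, e, f] \<and>
     G a b \<and> \<not> G a c \<and> \<not> G a d \<and> \<not> G a e \<and> G a f \<and> G b c \<and> \<not> G b d \<and> \<not> G b e \<and> \<not> G b f \<and> G c d \<and> \<not> G c e \<and> \<not> G c f \<and> G d e \<and> \<not> G d f \<and> G e f"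

text \<open>The squares \<open>a d c f\<close> and \<open>b c f e\<close> sharing the edge
  \<open>cf\<close>. Compared with the hexagon, the edges \<open>ab\<close> and \<open>de\<close>
  are missing and the three long diagonals are present.\<close>

definition domino :: "('a \<Rightarrow> 'a \<Rightarrow> bool) \<Rightarrow> 'a \<Rightarrow> 'a \<Rightarrow> 'a \<Rightarrow> 'a \<Rightarrow> 'a \<Rightarrow> 'a \<Rightarrow> bool" where
  "domino H a b c d e f \<longleftrightarrow>
     \<not> H a b \<and> \<not> H a c \<and> H a d \<and> \<not> H a e \<and> H a f \<and> H b c \<and> \<not> H b d \<and> H b e \<and> \<not> H b f \<and> H c d \<and> \<not> H c e \<and> H c f \<and> \<not> H d e \<and> \<not> H d f \<and> H e f"

definition pentagon :: "('a \<Rightarrow> 'a \<Rightarrow> bool) \<Rightarrow> 'a \<Rightarrow> 'a \<Rightarrow> 'a \<Rightarrow> 'a \<Rightarrow> 'a \<Rightarrow> bool" where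
  "pentagon G a b c d e \<longleftrightarrow> distinct [a, b, c, d, e] \<and>
     G a b \<and> G b c \<and> G c d \<and> G d e \<and> G a e \<and> \<not> G a c \<and> \<not> G a d \<and> \<not> G b d \<and> \<not> G b e \<and> \<not> G c e"

text \<open>A flip of the hexagon: the vertex sees the edge \<open>ab\<close> in one reading and the
  opposite edge \<open>de\<close> in the other.\<close>

definition edge_flip :: "('a \<Rightarrow> bool) \<Rightarrow> ('a \<Rightarrow> bool) \<Rightarrow> 'a \<Rightarrow> 'a \<Rightarrow> 'a \<Rightarrow> 'a \<Rightarrow> 'a \<Rightarrow> 'a \<Rightarrow> bool" where
  "edge_flip g h a b c d e f \<longleftrightarrow> g a \<and> g b \<and> \<not> g c \<and> \<not> g d \<and> \<not> g e \<and> \<not> g f \<and>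
     \<not> h a \<and> \<not> h b \<and> \<not> h c \<and> h d \<and> h e \<and> \<not> h f"

definition pentagon_free :: "('a \<Rightarrow> 'a \<Rightarrow> bool) \<Rightarrow> 'a set \<Rightarrow> bool" where
  "pentagon_free G V \<longleftrightarrow> (\<forall>p\<in>V. \<forall>q\<in>V. \<forall>r\<in>V. \<forall>s\<in>V. \<forall>t\<in>V. \<not> pentagon G p q r s t)"

lemma hexagon_rotate: "ugraph G \<Longrightarrow> hexagon G a b c d e f \<Longrightarrow> hexagon G b c d e f a"
  unfolding hexagon_def ugraph_def by auto

lemma hexagon_reflect: "ugraph G \<Longrightarrow> hexagon G a b c d e f \<Longrightarrow> hexagon G b a f e d c"
  unfolding hexagon_def ugraph_def by auto

lemma domino_reflect: "ugraph H \<Longrightarrow> domino H a b c d e f \<Longrightarrow> domino H b a f e d c"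
  unfolding domino_def ugraph_def by auto

lemma hexagon_adj_list: "hexagon G a b c d e f \<longleftrightarrow> adj_list G [a, b, c, d, e, f] (cycle_adj 6)"
  unfolding hexagon_def adj_list_def cycle_adj_def by (simp add: numeral_eq_Suc All_less_Suc) blast

lemma adj_list_co: "adj_list G ys e \<Longrightarrow> adj_list (co G) ys (\<lambda>i j. \<not> e i j)"
  by (auto simp: adj_list_def co_def nth_eq_iff_index_eq)

lemma hexagon_flips:
  assumes u: "ugraph G" and x: "hexagon G a b c d e f" and "flips G S g h" "{a, b, c, d, e, f} \<subseteq> S"
  shows "edge_flip g h a b c d e f \<or>
    edge_flip g h b c d e f a \<or>
    edge_flip g h c d e f a b \<or>
    edge_flip g h d e f a b c \<or>
    edge_flip g h e f a b c d \<or>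
    edge_flip g h f a b c d e"
proof -
  have 1: "flips G (set [a, b, c, d, e, f]) g h" using flips_mono[OF assms(3,4)] by simp
  let ?ys = "[a, b, c, d, e, f]"
  have "flip_labels 6 (cycle_adj 6) (\<lambda>i. g (?ys ! i)) (\<lambda>i. h (?ys ! i))"
    using flips_list[OF 1 x[unfolded hexagon_adj_list] _ u, of 6] unfolding flip_labels_def by simp
  from flip_cycle6[OF this] show ?thesis
    by (simp add: numeral_eq_Suc All_less_Suc edge_flip_def) satx
qed

lemma hexagon_no_co_flips:
  assumes u: "ugraph G" and x: "hexagon G a b c d e f" and "{a, b, c, d, e, f} \<subseteq> S"
  shows "\<not> flips (co G) S g h"
proof
  assume "flips (co G) S g h"
  then have 1: "flips (co G) (set [a, b, c, d, e, f]) g h" using flips_mono[OF _ assms(3)] by simp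
  let ?ys = "[a, b, c, d, e, f]"
  have 2: "adj_list (co G) ?ys (\<lambda>i j. \<not> cycle_adj 6 i j)"
    using x[unfolded hexagon_adj_list] by (rule adj_list_co)
  have "flip_labels 6 (\<lambda>i j. \<not> cycle_adj 6 i j) (\<lambda>i. g (?ys ! i)) (\<lambda>i. h (?ys ! i))"
    using flips_list[OF 1 2 _ ugraph_co[OF u], of 6] unfolding flip_labels_def by simp
  then show False using no_flip_co_cycle6 by blast
qed

lemma hexagon_prime:
  assumes "ugraph G" "hexagon G a b c d e f" shows "prime G {a, b, c, d, e, f}"
  using prime_list[OF assms(1) assms(2)[unfolded hexagon_adj_list] cycle_adj_sym _ prime_cycle6] by simp

lemma p4isoD:
  assumes "p4iso G H V" "a \<in> V" "b \<in> V" "c \<in> V" "d \<in> V" "distinct [a, b, c, d]"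
  shows "p4b (G a b) (G a c) (G a d) (G b c) (G b d) (G c d) \<longleftrightarrow> p4b (H a b) (H a c) (H a d) (H b c) (H b d) (H c d)"
  using assms unfolding p4iso_def P4on_def by blast


lemma no_pentagon_hexagon:
  assumes "ugraph G" "hexagon G a b c d e f" "{a, b, c, d, e, f} \<subseteq> V" "y \<in> V" "y \<notin> {a, b, c, d, e, f}"
    and np: "pentagon_free G V"
  shows "\<not> (G y a \<and> \<not> G y b \<and> \<not> G y c \<and> G y d)"
  
proof
  assume "G y a \<and> \<not> G y b \<and> \<not> G y c \<and> G y d"
  then have "pentagon G y a b c d"
    using assms(2,5) unfolding pentagon_def hexagon_def by auto
  then show False using np assms(3,4) unfolding pentagon_free_def by blast
qed

lemma no_pentagon_hexagon_all:
  assumes u: "ugraph G" and x: "hexagon G a b c d e f" and V: "{a, b, c, d, e, f} \<subseteq> V" "y \<in> V" "y \<notin> {a, b, c, d, e, f}"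
    and np: "pentagon_free G V"
  shows "\<not> (G y a \<and> \<not> G y b \<and> \<not> G y c \<and> G y d)"
    "\<not> (G y b \<and> \<not> G y c \<and> \<not> G y d \<and> G y e)"
    "\<not> (G y c \<and> \<not> G y d \<and> \<not> G y e \<and> G y f)"
    "\<not> (G y d \<and> \<not> G y e \<and> \<not> G y f \<and> G y a)"
    "\<not> (G y e \<and> \<not> G y f \<and> \<not> G y a \<and> G y b)"
    "\<not> (G y f \<and> \<not> G y a \<and> \<not> G y b \<and> G y c)"
proof -
  note x1 = hexagon_rotate[OF u x] note x2 = hexagon_rotate[OF u x1] note x3 = hexagon_rotate[OF u x2]
  note x4 = hexagon_rotate[OF u x3] note x5 = hexagon_rotate[OF u x4]
  show "\<not> (G y a \<and> \<not> G y b \<and> \<not> G y c \<and> G y d)"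
    "\<not> (G y b \<and> \<not> G y c \<and> \<not> G y d \<and> G y e)"
    "\<not> (G y c \<and> \<not> G y d \<and> \<not> G y e \<and> G y f)"
    "\<not> (G y d \<and> \<not> G y e \<and> \<not> G y f \<and> G y a)"
    "\<not> (G y e \<and> \<not> G y f \<and> \<not> G y a \<and> G y b)"
    "\<not> (G y f \<and> \<not> G y a \<and> \<not> G y b \<and> G y c)"
    using no_pentagon_hexagon[OF u x _ V(2) _ np] no_pentagon_hexagon[OF u x1 _ V(2) _ np]
      no_pentagon_hexagon[OF u x2 _ V(2) _ np] no_pentagon_hexagon[OF u x3 _ V(2) _ np]
      no_pentagon_hexagon[OF u x4 _ V(2) _ np] no_pentagon_hexagon[OF u x5 _ V(2) _ np] V by auto
qed

text \<open>A copy \<open>z\<close> of the vertex \<open>a\<close> of the hexagon cannot be told apart from \<open>a\<close> by a flipped vertex.\<close>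

lemma flipped_respects_copies:
  assumes ug: "ugraph G" and uh: "ugraph H" and iso: "p4iso G H V"
    and x: "hexagon G a b c d e f" and D: "{a, b, c, d, e, f} \<subseteq> V" and ag: "agree G H {a, b, c, d, e, f}"
    and y: "y \<in> V" "y \<notin> {a, b, c, d, e, f}" and z: "z \<in> V" "z \<notin> {a, b, c, d, e, f}" "y \<noteq> z"
    and zt: "G z b" "\<not> G z c" "\<not> G z d" "\<not> G z e" "G z f" "H z b" "\<not> H z c" "\<not> H z d" "\<not> H z e" "H z f"
    and fl: "edge_flip (G y) (H y) a b c d e f \<or>
    edge_flip (G y) (H y) b c d e f a \<or>
    edge_flip (G y) (H y) c d e f a b \<or>
    edge_flip (G y) (H y) d e f a b c \<or>
    edge_flip (G y) (H y) e f a b c d \<or>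
    edge_flip (G y) (H y) f a b c d e"
  shows "G y z = G y a"
proof -
  note X = x[unfolded hexagon_def]
  have hb: "H b c = G b c" "H b d = G b d" "H b e = G b e" "H b f = G b f" "H c d = G c d" "H c e = G c e" "H c f = G c f" "H d e = G d e" "H d f = G d f" "H e f = G e f"
    using ag unfolding agree_def by simp_all
  have F: "p4b (G y z) (G y u) (G y v) (G z u) (G z v) (G u v) \<longleftrightarrow> p4b (H y z) (H y u) (H y v) (H z u) (H z v) (H u v)"
    if "u \<in> {b, c, d, e, f}" "v \<in> {b, c, d, e, f}" "u \<noteq> v" for u v
    by (rule p4isoD[OF iso]) (use that D y z in auto)
  have Q: "p4b (G y z) (G y b) (G y c) (G z b) (G z c) (G b c) \<longleftrightarrow> p4b (H y z) (H y b) (H y c) (H z b) (H z c) (H b c)"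
    "p4b (G y z) (G y b) (G y d) (G z b) (G z d) (G b d) \<longleftrightarrow> p4b (H y z) (H y b) (H y d) (H z b) (H z d) (H b d)"
    "p4b (G y z) (G y b) (G y e) (G z b) (G z e) (G b e) \<longleftrightarrow> p4b (H y z) (H y b) (H y e) (H z b) (H z e) (H b e)"
    "p4b (G y z) (G y b) (G y f) (G z b) (G z f) (G b f) \<longleftrightarrow> p4b (H y z) (H y b) (H y f) (H z b) (H z f) (H b f)"
    "p4b (G y z) (G y c) (G y d) (G z c) (G z d) (G c d) \<longleftrightarrow> p4b (H y z) (H y c) (H y d) (H z c) (H z d) (H c d)"
    "p4b (G y z) (G y c) (G y e) (G z c) (G z e) (G c e) \<longleftrightarrow> p4b (H y z) (H y c) (H y e) (H z c) (H z e) (H c e)"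
    "p4b (G y z) (G y c) (G y f) (G z c) (G z f) (G c f) \<longleftrightarrow> p4b (H y z) (H y c) (H y f) (H z c) (H z f) (H c f)"
    "p4b (G y z) (G y d) (G y e) (G z d) (G z e) (G d e) \<longleftrightarrow> p4b (H y z) (H y d) (H y e) (H z d) (H z e) (H d e)"
    "p4b (G y z) (G y d) (G y f) (G z d) (G z f) (G d f) \<longleftrightarrow> p4b (H y z) (H y d) (H y f) (H z d) (H z f) (H d f)"
    "p4b (G y z) (G y e) (G y f) (G z e) (G z f) (G e f) \<longleftrightarrow> p4b (H y z) (H y e) (H y f) (H z e) (H z f) (H e f)"
    by (rule F, simp, simp, use X in simp)+
  note Xf = X[simplified]
  show ?thesis
    using Q[unfolded hb p4b_def, simplified Xf zt simp_thms] fl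
    unfolding edge_flip_def by satx
qed

context agreeing
begin

text \<open>The star formed by \<open>a\<close> and its neighbours other than \<open>x\<close> must
  not cut off \<open>x\<close>, so \<open>x\<close> has a neighbour \<open>y\<close> that misses
  \<open>a\<close>. Whether \<open>y\<close> is a copy, uniform or flipped, some quadruple through
  \<open>a\<close>, \<open>x\<close>, \<open>y\<close> is a P4 in \<open>G\<close> but not in
  \<open>H\<close>, or a pentagon arises.\<close>

lemma flipped_vertex_star_cutset:
  assumes mi: "minimp G V"
    and np: "pentagon_free G V"
    and max: "\<And>T. S \<subseteq> T \<Longrightarrow> T \<subseteq> V \<Longrightarrow> prime G T \<Longrightarrow> agree G H T \<Longrightarrow> card T \<le> card S"
    and hex: "hexagon G a b c d e f" and D: "{a, b, c, d, e, f} \<subseteq> S"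
    and x: "x \<in> V - S" and fx: "flips G S (G x) (H x)" and ex: "edge_flip (G x) (H x) a b c d e f"
    and tf: "\<And>y. y \<in> V - S \<Longrightarrow> tame G H S y \<or> flips G S (G y) (H y)"
  shows False
proof -
  have fin: "finite V" and prV: "prime G V" using mi minimp_prime by (auto simp: minimp_def)
  note X = hex[unfolded hexagon_def]
  have DV: "{a, b, c, d, e, f} \<subseteq> V" using D SV by blast
  have inS: "a \<in> S" "b \<in> S" "c \<in> S" "d \<in> S" "e \<in> S" "f \<in> S" using D by auto
  have aD: "agree G H {a, b, c, d, e, f}" using D ag unfolding agree_def by blast
  have pat: "edge_flip (G y) (H y) a b c d e f \<or>
    edge_flip (G y) (H y) b c d e f a \<or>
    edge_flip (G y) (H y) c d e f a b \<or>
    edge_flip (G y) (H y) d e f a b c \<or>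
    edge_flip (G y) (H y) e f a b c d \<or>
    edge_flip (G y) (H y) f a b c d e"
    if "flips G S (G y) (H y)" for y
    by (rule hexagon_flips[OF ug hex that D])
  have copy: "G z b" "\<not> G z c" "\<not> G z d" "\<not> G z e" "G z f" if z: "twin G S a (G z)" for z
    using z X inS unfolding twin_def by auto
  have copyH: "H z b" "\<not> H z c" "\<not> H z d" "\<not> H z e" "H z f" if z: "twin G S a (H z)" for z
    using z X inS unfolding twin_def by auto
  \<comment> \<open>A copy of \<open>a\<close> is not flipped, and flipped vertices do not separate
    copies of \<open>a\<close> from \<open>a\<close>; so every vertex that enters the growth
    argument is tame.\<close>
  have no_copy: False if z: "z \<in> V - S" "twin G S a (G z)" for z
  proof (rule twin_class_trivial[OF fin prV _ inS(1) z])
    fix T assume "S \<subseteq> T" "T \<subseteq> V" "prime G T" "agree G H T"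
    then show "card T \<le> card S" by (rule max)
  next
    fix z assume z: "z \<in> V - S" "twin G S a (G z)"
    have "\<not> flips G S (G z) (H z)"
      using pat[of z] copy[OF z(2)] unfolding edge_flip_def by satx
    then show "tame G H S z" using tf[OF z(1)] by blast
  next
    fix y z assume y: "y \<in> V - S" and z: "z \<in> V - S" "twin G S a (G z)" "twin G S a (H z)"
      and ne: "y \<noteq> z" "G y z \<noteq> G y a"
    have "\<not> flips G S (G y) (H y)"
    proof
      assume "flips G S (G y) (H y)"
      from pat[OF this] have "G y z = G y a"
        using y z(1) D ne(1)
        by (intro flipped_respects_copies[OF ug uh iso hex DV aD _ _ _ _ _ copy[OF z(2)] copyH[OF z(3)]]) auto
      then show False using ne by blast
    qed
    then show "tame G H S y" using tf[OF y] by blast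
  qed
  have irr: "\<not> G v v" for v using ugraphD(2)[OF ug] .
  let ?C = "insert a {w\<in>V. G a w \<and> w \<noteq> x}"
  let ?B = "V - ?C - {x}"
  have xa: "x \<noteq> a" using x inS by auto
  have "\<exists>y\<in>?B. G x y"
  proof (rule ccontr)
    assume n: "\<not> ?thesis"
    show False
    proof (rule minimp_star_cutset[OF mi, of a ?C "{x}" ?B])
      have "d \<in> ?B" using X inS SV x by auto
      then show "?B \<noteq> {}" by blast
      show "V = ?C \<union> {x} \<union> ?B" using inS SV x by auto
    qed (use n xa in auto)
  qed
  then obtain y where y: "y \<in> V" "y \<noteq> a" "\<not> G a y" "y \<noteq> x" "G x y" by auto
  have ya: "\<not> G y a" using y(3) gs[of a y] by simp
  have flx: "\<And>s. s \<in> S \<Longrightarrow> \<not> (G x s \<and> H x s)"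
    "\<And>s t. s \<in> S \<Longrightarrow> t \<in> S \<Longrightarrow> s \<noteq> t \<Longrightarrow> G x s \<and> G x t \<or> H x s \<and> H x t \<Longrightarrow> G s t"
    "\<And>s t. s \<in> S \<Longrightarrow> t \<in> S \<Longrightarrow> s \<noteq> t \<Longrightarrow> \<not> G x s \<Longrightarrow> \<not> H x s \<Longrightarrow> \<not> G x t \<Longrightarrow> \<not> H x t \<Longrightarrow> \<not> G s t"
    using fx unfolding flips_def by blast+
  note E = ex[unfolded edge_flip_def]
  have "y \<notin> S"
  proof
    assume "y \<in> S"
    then show False using flx(2)[of a y] y inS E by auto
  qed
  then have yS: "y \<in> V - S" using y by blast
  have neS: "w \<noteq> x" "w \<noteq> y" "x \<noteq> w" "y \<noteq> w" if "w \<in> S" for w using that x yS by auto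
  have inV: "a \<in> V" "b \<in> V" "c \<in> V" "d \<in> V" "e \<in> V" "f \<in> V" "x \<in> V" "y \<in> V" using inS SV x y by auto
  have hD: "H a f = G a f" "H f a = G f a" using gh inS by auto
  have fa: "G f a" using X gs[of a f] by simp
  have sw: "G w x = G x w" "G w y = G y w" "H w x = H x w" "H w y = H y w" for w
    using gs hs by blast+
  have d: "a \<noteq> f" "a \<noteq> c" "a \<noteq> e" "\<not> G a c" "\<not> G a e" using X by auto
  have Hac: "\<not> H a c" "\<not> H a e" using gh[OF inS(1,3)] gh[OF inS(1,5)] d by auto
  have q_axyc: "p4b (G a x) (G a y) (G a w) (G x y) (G x w) (G y w) = p4b (H a x) (H a y) (H a w) (H x y) (H x w) (H y w)"
    if "w \<in> S" "w \<noteq> a" for w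
    by (rule four) (use that inS SV x yS y neS in auto)
  have q_faxy: "p4b (G f a) (G f x) (G f y) (G a x) (G a y) (G x y) = p4b (H f a) (H f x) (H f y) (H a x) (H a y) (H x y)"
    by (rule four) (use inV inS neS d y in auto)
  from tf[OF yS] show False
  proof
    assume "tame G H S y"
    then consider t where "t \<in> S" "twin G S t (G y)" "twin G S t (H y)" | "unif S (G y)" "unif S (H y)"
      unfolding tame_def by blast
    then show False
    proof cases
      case 1
      have "t \<noteq> a" using no_copy[OF yS] 1(2) by blast
      have yw: "G y w = G t w" "H y w = G t w" if "w \<in> S" "w \<noteq> t" for w
        using 1 that unfolding twin_def by auto
      have ta: "\<not> G t a" using yw(1)[OF inS(1)] \<open>t \<noteq> a\<close> ya by simp
      have "\<not> G x t" using flx(2)[of t a] 1(1) inS(1) \<open>t \<noteq> a\<close> E ta by auto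
      have yaH: "\<not> H y a" using yw(2)[OF inS(1)] \<open>t \<noteq> a\<close> ta by simp
      show False
      proof (cases "H x t")
        case True
        \<comment> \<open>This is \<open>d\<close> or \<open>e\<close>, whichever differs from
          \<open>t\<close>. In \<open>G\<close> the path runs \<open>a\<close>, \<open>x\<close>,
          \<open>y\<close>, \<open>w\<close>, while in \<open>H\<close> the vertex \<open>a\<close>
          is isolated among these four.\<close>
        obtain w where w: "w \<in> S" "w \<noteq> t" "w \<noteq> a" "H x w" "\<not> G a w" "\<not> G x w"
          using X E inS by metis
        have "G t w" using flx(2)[of t w] 1(1) w True by auto
        then have "G y w" using yw(1)[OF w(1,2)] by simp
        moreover have "\<not> H a w" using gh[OF inS(1) w(1)] w by simp
        ultimately show False
          using q_axyc[OF w(1,3)] w E y(5) ya yaH sw[of a] unfolding p4b_def by auto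
      next
        case False
        have "t \<noteq> f" using ta fa by blast
        then have "\<not> G t f" using flx(3)[of t f] 1(1) inS(6) \<open>\<not> G x t\<close> False E by blast
        then have "\<not> G y f" "\<not> H y f" using yw[OF inS(6)] \<open>t \<noteq> f\<close> by auto
        then show False using q_faxy E y(5) ya yaH fa hD sw[of a] sw[of f] unfolding p4b_def by auto
      qed
    next
      case 2
      have "\<not> G y f" using 2(1) ya inS unfolding unif_def by blast
      moreover have "H y f = H y a" using 2(2) inS unfolding unif_def by blast
      ultimately show False using q_faxy E y(5) ya fa hD sw[of a] sw[of f] unfolding p4b_def by auto
    qed
  next
    assume "flips G S (G y) (H y)"
    have pen: "\<not> (G y d \<and> \<not> G y b \<and> \<not> G y c)"
    proof
      assume "G y d \<and> \<not> G y b \<and> \<not> G y c"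
      then have "pentagon G x b c d y"
        using y(4,5) X E neS inS sw(2)[of b] sw(2)[of c] sw(2)[of d] unfolding pentagon_def by simp
      then show False using np inV unfolding pentagon_free_def by blast
    qed
    from pat[OF \<open>flips G S (G y) (H y)\<close>] show False
      using pen ya q_axyc[OF inS(3) d(2)[symmetric]] q_axyc[OF inS(5) d(3)[symmetric]] q_faxy E y(5) fa hD Hac d sw[of a] sw[of f]
      unfolding edge_flip_def p4b_def by auto
  qed
qed

end

theorem agree_from_hexagon:
  assumes mi: "minimp G V" and uh: "ugraph H" and iso: "p4iso G H V"
    and np: "pentagon_free G V"
    and hex: "hexagon G a b c d e f" and DV: "{a, b, c, d, e, f} \<subseteq> V" and aD: "agree G H {a, b, c, d, e, f}"
  shows "agree G H V"
proof -
  have ug: "ugraph G" and fin: "finite V" and prV: "prime G V" using mi minimp_prime by (auto simp: minimp_def)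
  have D0: "agreeing G H V {a, b, c, d, e, f}"
  proof
    fix u v
    have "\<not> {a, b, c, d, e, f} \<subseteq> {u, v}" using hex unfolding hexagon_def by auto
    then show "\<exists>w\<in>{a, b, c, d, e, f}. w \<noteq> u \<and> w \<noteq> v" by blast
  qed (use ug uh iso DV aD hexagon_prime[OF ug hex] in auto)
  obtain S where S: "{a, b, c, d, e, f} \<subseteq> S" "agreeing G H V S"
    and max: "\<And>T. S \<subseteq> T \<Longrightarrow> T \<subseteq> V \<Longrightarrow> prime G T \<Longrightarrow> agree G H T \<Longrightarrow> card T \<le> card S"
    using maximal_superset[OF D0 fin] by metis
  interpret agreeing G H V S by fact
  have tf: "tame G H S y \<or> flips G S (G y) (H y)" if y: "y \<in> V - S" for y
  proof -
    have "\<not> (prime G (insert y S) \<and> agree G H (insert y S))"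
    proof
      assume "prime G (insert y S) \<and> agree G H (insert y S)"
      then have "card (insert y S) \<le> card S" using y SV by (intro max) auto
      moreover have "finite S" using fin SV finite_subset by blast
      ultimately show False using y by simp
    qed
    then show ?thesis using tame_or_flips[OF y] hexagon_no_co_flips[OF ug hex S(1)] by blast
  qed
  note h1 = hexagon_rotate[OF ug hex] note h2 = hexagon_rotate[OF ug h1] note h3 = hexagon_rotate[OF ug h2]
  note h4 = hexagon_rotate[OF ug h3] note h5 = hexagon_rotate[OF ug h4]
  have F: "\<not> edge_flip (G x) (H x) p q r s t u"
    if "hexagon G p q r s t u" "{p, q, r, s, t, u} \<subseteq> S" "x \<in> V - S" "flips G S (G x) (H x)" for p q r s t u x
  proof
    assume e: "edge_flip (G x) (H x) p q r s t u"
    show False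
    proof (rule flipped_vertex_star_cutset[OF mi np _ that e])
      show "card T \<le> card S" if "S \<subseteq> T" "T \<subseteq> V" "prime G T" "agree G H T" for T
        using that by (rule max)
    qed (rule tf)
  qed
  have "tame G H S x" if x: "x \<in> V - S" for x
  proof (rule ccontr)
    assume "\<not> tame G H S x"
    then have fx: "flips G S (G x) (H x)" using tf[OF x] by blast
    from hexagon_flips[OF ug hex fx S(1)] show False
      using F[OF hex _ x fx] F[OF h1 _ x fx] F[OF h2 _ x fx] F[OF h3 _ x fx] F[OF h4 _ x fx] F[OF h5 _ x fx] S(1)
      by (elim disjE) simp_all
  qed
  then have "S = V" using maximal_agreeing[OF fin prV max] by blast
  then show ?thesis using ag by simp
qed

subsection \<open>Dominoes\<close>

text \<open>Colour everything except \<open>d\<close> with \<open>omega G V\<close> colours, then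
  give \<open>e\<close> the colour of \<open>a\<close> and \<open>d\<close> that of
  \<open>b\<close>. The neighbourhood conditions keep the colouring proper, and the edge
  \<open>ab\<close> makes the colours of \<open>d\<close> and \<open>e\<close> differ.\<close>

lemma minimp_no_dominated_edges:
  assumes mi: "minimp G V" and V: "a \<in> V" "b \<in> V" "d \<in> V" "e \<in> V" "distinct [a, b, d, e]" and ab: "G a b"
    and de: "\<And>y. y \<in> V \<Longrightarrow> G y e \<Longrightarrow> y = d \<or> G y a" "\<And>y. y \<in> V \<Longrightarrow> G y d \<Longrightarrow> y = e \<or> G y b"
  shows False
proof -
  have u: "ugraph G" and fin: "finite V" using mi by (auto simp: minimp_def)
  note sym = ugraphD(1)[OF u] and irr = ugraphD(2)[OF u]
  have sub: "V - {d} \<subset> V" using V by blast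
  then have "colorable G (V - {d}) (omega G (V - {d}))" using mi by (simp add: minimp_def)
  moreover have "omega G (V - {d}) \<le> omega G V" by (rule omega_mono[OF fin]) auto
  ultimately have "colorable G (V - {d}) (omega G V)" by (rule colorable_mono)
  then obtain c where c': "\<forall>x\<in>V - {d}. c x < omega G V"
    "\<forall>x\<in>V - {d}. \<forall>y\<in>V - {d}. G x y \<longrightarrow> c x \<noteq> c y"
    unfolding colorable_def by (elim exE conjE)
  have c: "c x < omega G V" if "x \<in> V - {d}" for x using c'(1) that by blast
  have c2: "c x \<noteq> c y" if "x \<in> V - {d}" "y \<in> V - {d}" "G x y" for x y using c'(2) that by blast
  have ne: "a \<noteq> b" "a \<noteq> d" "a \<noteq> e" "b \<noteq> d" "b \<noteq> e" "d \<noteq> e" "e \<noteq> d" using V(5) by auto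
  let ?c = "c(e := c a, d := c b)"
  have A: "?c x \<noteq> ?c y" if xy: "x \<in> V" "y \<in> V" "G x y" "y = d \<or> y = e" for x y
  proof (cases "y = d")
    case True
    show ?thesis
    proof (cases "x = e")
      case True
      then show ?thesis using c2[of a b] V(1-4) ne ab \<open>y = d\<close> by simp
    next
      case False
      then have "G x b" using de(2)[OF xy(1)] xy(3) True by blast
      then show ?thesis using c2[of x b] V(1-4) ne True False xy irr[of d] by auto
    qed
  next
    case False
    then have ye: "y = e" using xy by blast
    show ?thesis
    proof (cases "x = d")
      case True
      then show ?thesis using c2[of a b] V(1-4) ne ab ye by simp
    next
      case False
      then have "G x a" using de(1)[OF xy(1)] xy(3) ye by blast
      then show ?thesis using c2[of x a] V(1-4) ne ye False xy irr[of e] by auto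
    qed
  qed
  have "\<forall>x\<in>V. \<forall>y\<in>V. G x y \<longrightarrow> ?c x \<noteq> ?c y"
  proof (intro ballI impI)
    fix x y assume xy: "x \<in> V" "y \<in> V" "G x y"
    consider "y = d \<or> y = e" | "x = d \<or> x = e" | "x \<noteq> d" "x \<noteq> e" "y \<noteq> d" "y \<noteq> e" by blast
    then show "?c x \<noteq> ?c y"
    proof cases
      case 1 then show ?thesis by (rule A[OF xy])
    next
      case 2 
      have "?c y \<noteq> ?c x" by (rule A[OF xy(2,1) _ 2]) (use xy sym[of x y] in simp)
      then show ?thesis by metis
    next
      case 3 then show ?thesis using c2[OF _ _ xy(3)] xy(1,2) by simp
    qed
  qed
  moreover have "\<forall>x\<in>V. ?c x < omega G V" using c V(1-4) ne by auto
  ultimately have "colorable G V (omega G V)" unfolding colorable_def by (intro exI[of _ ?c] conjI)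
  then show False using mi by (simp add: minimp_def)
qed

text \<open>All twenty triples of the hexagon are written out so that, with the known adjacencies
  substituted, purely propositional constraints remain.\<close>

lemma domino_quads:
  assumes iso: "p4iso G H V" and x: "hexagon G a b c d e f" and D: "{a, b, c, d, e, f} \<subseteq> V"
    and y: "y \<in> V" "y \<notin> {a, b, c, d, e, f}"
  shows "p4b (G y a) (G y b) (G y c) (G a b) (G a c) (G b c) \<longleftrightarrow> p4b (H y a) (H y b) (H y c) (H a b) (H a c) (H b c)"
    "p4b (G y a) (G y b) (G y d) (G a b) (G a d) (G b d) \<longleftrightarrow> p4b (H y a) (H y b) (H y d) (H a b) (H a d) (H b d)"
    "p4b (G y a) (G y b) (G y e) (G a b) (G a e) (G b e) \<longleftrightarrow> p4b (H y a) (H y b) (H y e) (H a b) (H a e) (H b e)"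
    "p4b (G y a) (G y b) (G y f) (G a b) (G a f) (G b f) \<longleftrightarrow> p4b (H y a) (H y b) (H y f) (H a b) (H a f) (H b f)"
    "p4b (G y a) (G y c) (G y d) (G a c) (G a d) (G c d) \<longleftrightarrow> p4b (H y a) (H y c) (H y d) (H a c) (H a d) (H c d)"
    "p4b (G y a) (G y c) (G y e) (G a c) (G a e) (G c e) \<longleftrightarrow> p4b (H y a) (H y c) (H y e) (H a c) (H a e) (H c e)"
    "p4b (G y a) (G y c) (G y f) (G a c) (G a f) (G c f) \<longleftrightarrow> p4b (H y a) (H y c) (H y f) (H a c) (H a f) (H c f)"
    "p4b (G y a) (G y d) (G y e) (G a d) (G a e) (G d e) \<longleftrightarrow> p4b (H y a) (H y d) (H y e) (H a d) (H a e) (H d e)"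
    "p4b (G y a) (G y d) (G y f) (G a d) (G a f) (G d f) \<longleftrightarrow> p4b (H y a) (H y d) (H y f) (H a d) (H a f) (H d f)"
    "p4b (G y a) (G y e) (G y f) (G a e) (G a f) (G e f) \<longleftrightarrow> p4b (H y a) (H y e) (H y f) (H a e) (H a f) (H e f)"
    "p4b (G y b) (G y c) (G y d) (G b c) (G b d) (G c d) \<longleftrightarrow> p4b (H y b) (H y c) (H y d) (H b c) (H b d) (H c d)"
    "p4b (G y b) (G y c) (G y e) (G b c) (G b e) (G c e) \<longleftrightarrow> p4b (H y b) (H y c) (H y e) (H b c) (H b e) (H c e)"
    "p4b (G y b) (G y c) (G y f) (G b c) (G b f) (G c f) \<longleftrightarrow> p4b (H y b) (H y c) (H y f) (H b c) (H b f) (H c f)"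
    "p4b (G y b) (G y d) (G y e) (G b d) (G b e) (G d e) \<longleftrightarrow> p4b (H y b) (H y d) (H y e) (H b d) (H b e) (H d e)"
    "p4b (G y b) (G y d) (G y f) (G b d) (G b f) (G d f) \<longleftrightarrow> p4b (H y b) (H y d) (H y f) (H b d) (H b f) (H d f)"
    "p4b (G y b) (G y e) (G y f) (G b e) (G b f) (G e f) \<longleftrightarrow> p4b (H y b) (H y e) (H y f) (H b e) (H b f) (H e f)"
    "p4b (G y c) (G y d) (G y e) (G c d) (G c e) (G d e) \<longleftrightarrow> p4b (H y c) (H y d) (H y e) (H c d) (H c e) (H d e)"
    "p4b (G y c) (G y d) (G y f) (G c d) (G c f) (G d f) \<longleftrightarrow> p4b (H y c) (H y d) (H y f) (H c d) (H c f) (H d f)"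
    "p4b (G y c) (G y e) (G y f) (G c e) (G c f) (G e f) \<longleftrightarrow> p4b (H y c) (H y e) (H y f) (H c e) (H c f) (H e f)"
    "p4b (G y d) (G y e) (G y f) (G d e) (G d f) (G e f) \<longleftrightarrow> p4b (H y d) (H y e) (H y f) (H d e) (H d f) (H e f)"
proof -
  note X = x[unfolded hexagon_def]
  have F: "p4b (G y u) (G y v) (G y w) (G u v) (G u w) (G v w) \<longleftrightarrow> p4b (H y u) (H y v) (H y w) (H u v) (H u w) (H v w)"
    if "u \<in> {a, b, c, d, e, f}" "v \<in> {a, b, c, d, e, f}" "w \<in> {a, b, c, d, e, f}" "distinct [u, v, w]" for u v w
    by (rule p4isoD[OF iso]) (use that D y in auto)
  show "p4b (G y a) (G y b) (G y c) (G a b) (G a c) (G b c) \<longleftrightarrow> p4b (H y a) (H y b) (H y c) (H a b) (H a c) (H b c)"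
    "p4b (G y a) (G y b) (G y d) (G a b) (G a d) (G b d) \<longleftrightarrow> p4b (H y a) (H y b) (H y d) (H a b) (H a d) (H b d)"
    "p4b (G y a) (G y b) (G y e) (G a b) (G a e) (G b e) \<longleftrightarrow> p4b (H y a) (H y b) (H y e) (H a b) (H a e) (H b e)"
    "p4b (G y a) (G y b) (G y f) (G a b) (G a f) (G b f) \<longleftrightarrow> p4b (H y a) (H y b) (H y f) (H a b) (H a f) (H b f)"
    "p4b (G y a) (G y c) (G y d) (G a c) (G a d) (G c d) \<longleftrightarrow> p4b (H y a) (H y c) (H y d) (H a c) (H a d) (H c d)"
    "p4b (G y a) (G y c) (G y e) (G a c) (G a e) (G c e) \<longleftrightarrow> p4b (H y a) (H y c) (H y e) (H a c) (H a e) (H c e)"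
    "p4b (G y a) (G y c) (G y f) (G a c) (G a f) (G c f) \<longleftrightarrow> p4b (H y a) (H y c) (H y f) (H a c) (H a f) (H c f)"
    "p4b (G y a) (G y d) (G y e) (G a d) (G a e) (G d e) \<longleftrightarrow> p4b (H y a) (H y d) (H y e) (H a d) (H a e) (H d e)"
    "p4b (G y a) (G y d) (G y f) (G a d) (G a f) (G d f) \<longleftrightarrow> p4b (H y a) (H y d) (H y f) (H a d) (H a f) (H d f)"
    "p4b (G y a) (G y e) (G y f) (G a e) (G a f) (G e f) \<longleftrightarrow> p4b (H y a) (H y e) (H y f) (H a e) (H a f) (H e f)"
    "p4b (G y b) (G y c) (G y d) (G b c) (G b d) (G c d) \<longleftrightarrow> p4b (H y b) (H y c) (H y d) (H b c) (H b d) (H c d)"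
    "p4b (G y b) (G y c) (G y e) (G b c) (G b e) (G c e) \<longleftrightarrow> p4b (H y b) (H y c) (H y e) (H b c) (H b e) (H c e)"
    "p4b (G y b) (G y c) (G y f) (G b c) (G b f) (G c f) \<longleftrightarrow> p4b (H y b) (H y c) (H y f) (H b c) (H b f) (H c f)"
    "p4b (G y b) (G y d) (G y e) (G b d) (G b e) (G d e) \<longleftrightarrow> p4b (H y b) (H y d) (H y e) (H b d) (H b e) (H d e)"
    "p4b (G y b) (G y d) (G y f) (G b d) (G b f) (G d f) \<longleftrightarrow> p4b (H y b) (H y d) (H y f) (H b d) (H b f) (H d f)"
    "p4b (G y b) (G y e) (G y f) (G b e) (G b f) (G e f) \<longleftrightarrow> p4b (H y b) (H y e) (H y f) (H b e) (H b f) (H e f)"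
    "p4b (G y c) (G y d) (G y e) (G c d) (G c e) (G d e) \<longleftrightarrow> p4b (H y c) (H y d) (H y e) (H c d) (H c e) (H d e)"
    "p4b (G y c) (G y d) (G y f) (G c d) (G c f) (G d f) \<longleftrightarrow> p4b (H y c) (H y d) (H y f) (H c d) (H c f) (H d f)"
    "p4b (G y c) (G y e) (G y f) (G c e) (G c f) (G e f) \<longleftrightarrow> p4b (H y c) (H y e) (H y f) (H c e) (H c f) (H e f)"
    "p4b (G y d) (G y e) (G y f) (G d e) (G d f) (G e f) \<longleftrightarrow> p4b (H y d) (H y e) (H y f) (H d e) (H d f) (H e f)"
    by (rule F, simp, simp, simp, use X in simp)+
qed

text \<open>A vertex that would prevent the edge \<open>de\<close> from being dominated by
  \<open>ab\<close> is a copy of \<open>e\<close> or of \<open>d\<close>; and a copy of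
  \<open>e\<close> in the hexagon is also a copy of \<open>e\<close> in the domino. In both cases
  the adjacency to the original remains open.\<close>

lemma domino_outside:
  assumes ug: "ugraph G" and iso: "p4iso G H V" and np: "pentagon_free G V"
    and x: "hexagon G a b c d e f" and D: "{a, b, c, d, e, f} \<subseteq> V" and dom: "domino H a b c d e f"
    and y: "y \<in> V" "y \<notin> {a, b, c, d, e, f}"
  shows "G y d \<and> G y f \<and> \<not> G y a \<and> \<not> G y b \<and> \<not> G y c \<Longrightarrow> H y b \<and> H y f \<and> \<not> H y a \<and> \<not> H y c \<and> \<not> H y d"
    and "G y e \<and> \<not> G y a \<or> G y d \<and> \<not> G y b \<Longrightarrow>
      G y d \<and> G y f \<and> \<not> G y a \<and> \<not> G y b \<and> \<not> G y c \<or> G y c \<and> G y e \<and> \<not> G y a \<and> \<not> G y b \<and> \<not> G y f"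
proof -
  note P = no_pentagon_hexagon_all[OF ug x D y np]
  note Xf = x[unfolded hexagon_def, simplified] and Yf = dom[unfolded domino_def, simplified]
  note Q = domino_quads[OF iso x D y, unfolded p4b_def, simplified Xf Yf simp_thms]
  show "G y d \<and> G y f \<and> \<not> G y a \<and> \<not> G y b \<and> \<not> G y c \<Longrightarrow> H y b \<and> H y f \<and> \<not> H y a \<and> \<not> H y c \<and> \<not> H y d"
    using Q P by satx
  show "G y e \<and> \<not> G y a \<or> G y d \<and> \<not> G y b \<Longrightarrow>
      G y d \<and> G y f \<and> \<not> G y a \<and> \<not> G y b \<and> \<not> G y c \<or> G y c \<and> G y e \<and> \<not> G y a \<and> \<not> G y b \<and> \<not> G y f"
    using Q P by satx
qed

text \<open>Serves to show that the copies of \<open>e\<close> form a homogeneous set. With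
  \<open>z\<close> in place of \<open>e\<close> there is a second hexagon, so the absence of
  pentagons constrains \<open>y\<close> twice, in addition to the P4s through \<open>y\<close> and
  \<open>z\<close>.\<close>

lemma domino_copies:
  assumes ug: "ugraph G" and iso: "p4iso G H V" and np: "pentagon_free G V"
    and x: "hexagon G a b c d e f" and D: "{a, b, c, d, e, f} \<subseteq> V" and dom: "domino H a b c d e f"
    and y: "y \<in> V" "y \<notin> {a, b, c, d, e, f}" and z: "z \<in> V" "z \<notin> {a, b, c, d, e, f}" "y \<noteq> z"
    and zt: "G z d \<and> G z f \<and> \<not> G z a \<and> \<not> G z b \<and> \<not> G z c" and yt: "\<not> (G y d \<and> G y f \<and> \<not> G y a \<and> \<not> G y b \<and> \<not> G y c)"
  shows "G y z = G y e"
proof -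
  note P = no_pentagon_hexagon_all[OF ug x D y np]
  note sym = ugraphD(1)[OF ug]
  have xz: "hexagon G a b c d z f"
    using x zt z(2) sym[of d z] sym[of a z] sym[of b z] sym[of c z] unfolding hexagon_def by auto
  have dz: "{a, b, c, d, z, f} \<subseteq> V" "y \<notin> {a, b, c, d, z, f}" using D y z by auto
  note Pz = no_pentagon_hexagon_all[OF ug xz dz(1) y(1) dz(2) np]
  note Xf = x[unfolded hexagon_def, simplified] and Yf = dom[unfolded domino_def, simplified]
  have Hz: "H z b" "H z f" "\<not> H z a" "\<not> H z c" "\<not> H z d"
    using domino_outside(1)[OF ug iso np x D dom z(1,2) zt] by auto
  have F: "p4b (G y z) (G y v) (G y w) (G z v) (G z w) (G v w) \<longleftrightarrow> p4b (H y z) (H y v) (H y w) (H z v) (H z w) (H v w)"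
    if "v \<in> {a, b, c, d, e, f}" "w \<in> {a, b, c, d, e, f}" "v \<noteq> w" for v w
    by (rule p4isoD[OF iso]) (use that D y z in auto)
  have R: "p4b (G y z) (G y a) (G y b) (G z a) (G z b) (G a b) \<longleftrightarrow> p4b (H y z) (H y a) (H y b) (H z a) (H z b) (H a b)"
    "p4b (G y z) (G y a) (G y c) (G z a) (G z c) (G a c) \<longleftrightarrow> p4b (H y z) (H y a) (H y c) (H z a) (H z c) (H a c)"
    "p4b (G y z) (G y a) (G y d) (G z a) (G z d) (G a d) \<longleftrightarrow> p4b (H y z) (H y a) (H y d) (H z a) (H z d) (H a d)"
    "p4b (G y z) (G y a) (G y f) (G z a) (G z f) (G a f) \<longleftrightarrow> p4b (H y z) (H y a) (H y f) (H z a) (H z f) (H a f)"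
    "p4b (G y z) (G y b) (G y c) (G z b) (G z c) (G b c) \<longleftrightarrow> p4b (H y z) (H y b) (H y c) (H z b) (H z c) (H b c)"
    "p4b (G y z) (G y b) (G y d) (G z b) (G z d) (G b d) \<longleftrightarrow> p4b (H y z) (H y b) (H y d) (H z b) (H z d) (H b d)"
    "p4b (G y z) (G y b) (G y f) (G z b) (G z f) (G b f) \<longleftrightarrow> p4b (H y z) (H y b) (H y f) (H z b) (H z f) (H b f)"
    "p4b (G y z) (G y c) (G y d) (G z c) (G z d) (G c d) \<longleftrightarrow> p4b (H y z) (H y c) (H y d) (H z c) (H z d) (H c d)"
    "p4b (G y z) (G y c) (G y f) (G z c) (G z f) (G c f) \<longleftrightarrow> p4b (H y z) (H y c) (H y f) (H z c) (H z f) (H c f)"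
    "p4b (G y z) (G y d) (G y f) (G z d) (G z f) (G d f) \<longleftrightarrow> p4b (H y z) (H y d) (H y f) (H z d) (H z f) (H d f)"
    by (rule F, simp, simp, use Xf in simp)+
  note Q = domino_quads[OF iso x D y, unfolded p4b_def, simplified Xf Yf simp_thms]
  note R' = R[unfolded p4b_def, simplified Xf Yf zt[simplified] Hz simp_thms]
  show ?thesis using Q R' P Pz yt by satx
qed

text \<open>The copies of \<open>e\<close>, with \<open>e\<close>, are homogeneous, so by primality
  \<open>e\<close> is the only one. The reflection that exchanges \<open>d\<close> and
  \<open>e\<close> gives the same for \<open>d\<close>. No vertex is then left that violates the
  domination of \<open>de\<close> by \<open>ab\<close>.\<close>

theorem no_domino:
  assumes mi: "minimp G V" and uh: "ugraph H" and iso: "p4iso G H V" and np: "pentagon_free G V"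
    and x: "hexagon G a b c d e f" and D: "{a, b, c, d, e, f} \<subseteq> V" and dom: "domino H a b c d e f"
  shows False
proof -
  have ug: "ugraph G" and prV: "prime G V" using mi minimp_prime by (auto simp: minimp_def)
  have only: "z = e" if x: "hexagon G a b c d e f" and D: "{a, b, c, d, e, f} \<subseteq> V" and dom: "domino H a b c d e f"
    and z: "z \<in> V" "G z d \<and> G z f \<and> \<not> G z a \<and> \<not> G z b \<and> \<not> G z c" for a b c d e f z
  proof -
    note X = x[unfolded hexagon_def, simplified]
    note sym = ugraphD(1)[OF ug] and irr = ugraphD(2)[OF ug]
    let ?T = "{z\<in>V. G z d \<and> G z f \<and> \<not> G z a \<and> \<not> G z b \<and> \<not> G z c}"
    have eT: "e \<in> ?T" using X D sym[of e] by auto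
    have notin: "w \<notin> {a, b, c, d, f}" if "w \<in> ?T" for w
      using that X irr sym[of b a] sym[of c b] sym[of d c] sym[of f a] by auto
    have key: "G y w = G y e" if y: "y \<in> V - ?T" and w: "w \<in> ?T" for y w
    proof (cases "w = e")
      case we: False
      have wD: "w \<notin> {a, b, c, d, e, f}" using notin[OF w] we by auto
      show ?thesis
      proof (cases "y \<in> {a, b, c, d, e, f}")
        case True
        then have "y \<in> {a, b, c, d, f}" using y eT by auto
        then show ?thesis using w X sym[of y w] sym[of f e] by auto
      next
        case False
        show ?thesis
          by (rule domino_copies[OF ug iso np x D dom _ False _ wD]) (use y w in auto)
      qed
    qed simp
    have "homog G V ?T"
      unfolding homog_def
    proof (intro conjI ballI impI)
      fix y u v assume "y \<in> V - ?T" "u \<in> ?T" "v \<in> ?T" "G y u"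
      then show "G y v" using key[of y u] key[of y v] by blast
    qed blast
    moreover have "?T \<noteq> V" using notin D by blast
    ultimately show ?thesis using primeD[OF prV, of ?T z e] eT z by blast
  qed
  note x' = hexagon_reflect[OF ug x] and dom' = domino_reflect[OF uh dom]
  have D': "{b, a, f, e, d, c} \<subseteq> V" using D by auto
  note X = x[unfolded hexagon_def, simplified]
  note sym = ugraphD(1)[OF ug] and irr = ugraphD(2)[OF ug]
  have out: "\<not> (G y e \<and> \<not> G y a \<or> G y d \<and> \<not> G y b)" if y: "y \<in> V" "y \<notin> {a, b, c, d, e, f}" for y
  proof
    assume "G y e \<and> \<not> G y a \<or> G y d \<and> \<not> G y b"
    from domino_outside(2)[OF ug iso np x D dom y this] show False
      using only[OF x D dom y(1)] only[OF x' D' dom' y(1)] y(2) by auto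
  qed
  show False
  proof (rule minimp_no_dominated_edges[OF mi, of a b d e])
    show "y = d \<or> G y a" if "y \<in> V" "G y e" for y
    proof (cases "y \<in> {a, b, c, d, e, f}")
      case True
      then show ?thesis using that(2) X irr[of e] sym[of f a] by (elim insertE emptyE) simp_all
    next
      case False
      then show ?thesis using out[OF that(1) False] that(2) by blast
    qed
    show "y = e \<or> G y b" if "y \<in> V" "G y d" for y
    proof (cases "y \<in> {a, b, c, d, e, f}")
      case True
      then show ?thesis using that(2) X irr[of d] sym[of c b] sym[of f d] by (elim insertE emptyE) simp_all
    next
      case False
      then show ?thesis using out[OF that(1) False] that(2) by blast
    qed
  qed (use X D in auto)
qed

subsection \<open>The semi-strong perfect graph theorem\<close>

lemma three_elements:
  assumes "3 \<le> card A" obtains a b c where "a \<in> A" "b \<in> A" "c \<in> A" "distinct [a, b, c]"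
proof -
  obtain T where T: "T \<subseteq> A" "card T = 3" using obtain_subset_with_card_n[OF assms] by blast
  obtain a b c where abc: "T = {a, b, c}" "a \<noteq> b" "b \<noteq> c" "a \<noteq> c" using card_3_iff[THEN iffD1, OF T(2)] by auto
  show ?thesis by (rule that[of a b c]) (use T(1) abc in auto)
qed

text \<open>Any three of the five vertices lie in a P4, so there is neither a triangle nor a stable
  set of size three, and two colours cannot suffice. As the hypothesis speaks of P4s only, it
  carries over from a pentagon of \<open>G\<close> to \<open>H\<close>.\<close>

lemma all_P4_not_colorable:
  assumes u: "ugraph E" and W: "card W = 5"
    and P: "\<And>a b c d. a \<in> W \<Longrightarrow> b \<in> W \<Longrightarrow> c \<in> W \<Longrightarrow> d \<in> W \<Longrightarrow> distinct [a, b, c, d] \<Longrightarrow> P4on E a b c d"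
  shows "\<not> colorable E W (omega E W)"
proof
  have fin: "finite W" using W by (metis card.infinite zero_neq_numeral)
  have triple: "\<exists>d. P4on E a b c d" if "a \<in> W" "b \<in> W" "c \<in> W" "distinct [a, b, c]" for a b c
  proof -
    have "\<not> W \<subseteq> {a, b, c}" using card_mono[of "{a, b, c}" W] W by (auto simp: card_insert_if split: if_splits)
    then obtain d where "d \<in> W" "d \<notin> {a, b, c}" by blast
    then show ?thesis using P[of a b c d] that by auto
  qed
  have om: "omega E W \<le> 2"
    unfolding omega_le_iff[OF fin]
  proof (intro allI impI, rule ccontr)
    fix K assume K: "K \<subseteq> W" "clq E K" "\<not> card K \<le> 2"
    then have "3 \<le> card K" by simp
    then obtain a b c where abc: "a \<in> K" "b \<in> K" "c \<in> K" "distinct [a, b, c]" by (rule three_elements)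
    then have "E a b" "E a c" "E b c" using K(2) by (auto simp: clq_def)
    moreover obtain d where "P4on E a b c d" using triple[of a b c] abc K(1) by blast
    ultimately show False unfolding P4on_def p4b_def by simp
  qed
  assume "colorable E W (omega E W)"
  then have "colorable E W 2" using colorable_mono om by blast
  then obtain k where k: "\<And>x. x \<in> W \<Longrightarrow> k x < (2::nat)" "\<And>x y. x \<in> W \<Longrightarrow> y \<in> W \<Longrightarrow> E x y \<Longrightarrow> k x \<noteq> k y"
    unfolding colorable_def by blast
  have small: "card {x\<in>W. k x = i} \<le> 2" for i
  proof (rule ccontr)
    assume "\<not> ?thesis"
    then have "3 \<le> card {x\<in>W. k x = i}" by simp
    then obtain a b c where abc: "a \<in> {x\<in>W. k x = i}" "b \<in> {x\<in>W. k x = i}" "c \<in> {x\<in>W. k x = i}" "distinct [a, b, c]"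
      by (rule three_elements)
    then have "\<not> E a b" "\<not> E a c" "\<not> E b c" using k(2) by fastforce+
    moreover obtain d where "P4on E a b c d" using triple[of a b c] abc by blast
    ultimately show False unfolding P4on_def p4b_def by simp
  qed
  have "W = {x\<in>W. k x = 0} \<union> {x\<in>W. k x = 1}" using k(1) by (auto simp: less_2_cases_iff)
  then have "card W \<le> card {x\<in>W. k x = 0} + card {x\<in>W. k x = 1}" by (metis card_Un_le)
  then show False using small[of 0] small[of 1] W by simp
qed

lemma pentagon_P4s:
  assumes "ugraph G" "pentagon G p q r s t"
    and "a \<in> {p, q, r, s, t}" "b \<in> {p, q, r, s, t}" "c \<in> {p, q, r, s, t}" "d \<in> {p, q, r, s, t}" "distinct [a, b, c, d]"
  shows "P4on G a b c d"
proof -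
  note X = assms(2)[unfolded pentagon_def, simplified]
  have s: "G q p" "G r q" "G s r" "G t s" "G t p" "\<not> G r p" "\<not> G s p" "\<not> G s q" "\<not> G t q" "\<not> G t r"
    using X assms(1) unfolding ugraph_def by blast+
  show ?thesis using assms(3-7) X s unfolding P4on_def by (elim insertE emptyE; simp add: p4b_def)
qed

lemma colorable_agree:
  assumes "agree G H V" shows "colorable G V (omega G V) \<longleftrightarrow> colorable H V (omega H V)"
proof -
  have "clq G K \<longleftrightarrow> clq H K" if "K \<subseteq> V" for K
    using assms that unfolding agree_def clq_def by blast
  then have "omega G V = omega H V" unfolding omega_def by (metis (no_types, lifting) Collect_cong)
  then show ?thesis using assms unfolding agree_def colorable_def by simp
qed

lemma p4iso_sym: "p4iso G H V \<Longrightarrow> p4iso H G V"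
  unfolding p4iso_def by blast

lemma minimp_P4_isomorphic_cycle:
  assumes mi: "minimp G V" and uh: "ugraph H" and iso: "p4iso G H V"
    and xs: "iscycle G xs" "set xs \<subseteq> V" "5 \<le> length xs"
  shows "\<not> perf H V"
proof
  assume pH: "perf H V"
  have ug: "ugraph G" and fin: "finite V" and prV: "prime G V" and nc: "\<not> colorable G V (omega G V)"
    using mi minimp_prime by (auto simp: minimp_def)
  \<comment> \<open>Were \<open>H\<close> perfect, so would be its complement; it therefore suffices
    to show that \<open>G\<close> agrees with one of the two.\<close>
  have nG: "\<not> agree G H V" using pH nc colorable_agree unfolding perf_def by blast
  have "perf (co H) V" by (rule perfect_graph_theorem[OF fin pH uh])
  then have nC: "\<not> agree G (co H) V" using nc colorable_agree unfolding perf_def by blast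
  have adj: "adj_list G xs (cycle_adj (length xs))" by (rule iscycle_adj_list[OF xs(1)]) (use xs(3) in simp)
  have np0: "\<not> pentagon G p q r s t" if V: "p \<in> V" "q \<in> V" "r \<in> V" "s \<in> V" "t \<in> V" for p q r s t
  proof
    assume pen: "pentagon G p q r s t"
    let ?W = "{p, q, r, s, t}"
    have c5: "card ?W = 5" using pen by (simp add: pentagon_def)
    have "\<not> colorable G ?W (omega G ?W)"
      by (rule all_P4_not_colorable[OF ug c5]) (rule pentagon_P4s[OF ug pen])
    \<comment> \<open>A pentagon is not perfect, so minimality of \<open>G\<close> makes it the
      whole vertex set.\<close>
    then have "\<not> ?W \<subset> V" using mi unfolding minimp_def by blast
    then have WV: "?W = V" using V by auto
    have "P4on H a b c d" if "a \<in> V" "b \<in> V" "c \<in> V" "d \<in> V" "distinct [a, b, c, d]" for a b c d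
      using pentagon_P4s[OF ug pen, of a b c d] that iso unfolding WV p4iso_def by blast
    then have "\<not> colorable H V (omega H V)"
      using all_P4_not_colorable[OF uh] c5 WV by metis
    then show False using pH by (simp add: perf_def)
  qed
  have np: "pentagon_free G V" unfolding pentagon_free_def using np0 by blast
  consider "length xs = 5" | "length xs = 6" | "7 \<le> length xs" using xs(3) by linarith
  then show False
  proof cases
    case 1
    then obtain p q r s t where l: "xs = [p, q, r, s, t]"
      by (auto simp: numeral_eq_Suc length_Suc_conv)
    have "pentagon G p q r s t"
      using adj unfolding l pentagon_def adj_list_def cycle_adj_def by (simp add: numeral_eq_Suc All_less_Suc)
    then show False using np0 xs(2) l by simp
  next
    case 2
    then obtain a b c d e f where l: "xs = [a, b, c, d, e, f]"
      by (auto simp: numeral_eq_Suc length_Suc_conv)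
    have adj6: "adj_list G [a, b, c, d, e, f] (cycle_adj 6)" using adj unfolding 2 unfolding l .
    then have hex: "hexagon G a b c d e f" by (simp add: hexagon_adj_list)
    have D: "set [a, b, c, d, e, f] \<subseteq> V" using xs(2) l by simp
    then have D': "{a, b, c, d, e, f} \<subseteq> V" by simp
    let ?h = "\<lambda>i j. H ([a, b, c, d, e, f] ! i) ([a, b, c, d, e, f] ! j)"
    have "\<forall>q<6. \<forall>p<q. \<forall>n<p. \<forall>m<n. p4b (?h m n) (?h m p) (?h m q) (?h n p) (?h n q) (?h p q) \<longleftrightarrow>
       p4b (cycle_adj 6 m n) (cycle_adj 6 m p) (cycle_adj 6 m q) (cycle_adj 6 n p) (cycle_adj 6 n q) (cycle_adj 6 p q)"
      using p4iso_nth[OF ug iso D adj6] by simp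
    note S = cycle6_structure[OF this]
    have agr: "agree G K V" if K: "ugraph K" "p4iso G K V" "hexagon K a b c d e f" for K
    proof (rule agree_from_hexagon[OF mi K(1,2) np hex D'])
      show "agree G K {a, b, c, d, e, f}"
        using hex K(1,3) ug unfolding agree_def hexagon_def ugraph_def by simp blast
    qed
    have nd: "\<not> domino K a b c d e f" "\<not> domino K b c d e f a" "\<not> domino K c d e f a b"
      if K: "ugraph K" "p4iso G K V" for K
    proof -
      note h1 = hexagon_rotate[OF ug hex] note h2 = hexagon_rotate[OF ug h1]
      show "\<not> domino K a b c d e f" using no_domino[OF mi K np hex D'] by blast
      show "\<not> domino K b c d e f a" using no_domino[OF mi K np h1] D' by auto
      show "\<not> domino K c d e f a b" using no_domino[OF mi K np h2] D' by auto
    qed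
    have uc: "ugraph (co H)" "p4iso G (co H) V" using uh iso ugraph_co by (auto simp: p4iso_co2)
    note dist = hex[unfolded hexagon_def, THEN conjunct1, simplified]
    have "hexagon H a b c d e f \<or> hexagon (co H) a b c d e f \<or>
      domino H a b c d e f \<or> domino H b c d e f a \<or> domino H c d e f a b \<or>
      domino (co H) a b c d e f \<or> domino (co H) b c d e f a \<or> domino (co H) c d e f a b"
    proof -
      have s: "H b a = H a b" "H c a = H a c" "H d a = H a d" "H e a = H a e" "H f a = H a f" "H c b = H b c" "H d b = H b d" "H e b = H b e" "H f b = H b f" "H d c = H c d" "H e c = H c e" "H f c = H c f" "H e d = H d e" "H f d = H d f" "H f e = H e f"
        using uh unfolding ugraph_def by blast+
      have T: "(H a b \<and> \<not> H a c \<and> \<not> H a d \<and> \<not> H a e \<and> H a f \<and> H b c \<and> \<not> H b d \<and> \<not> H b e \<and> \<not> H b f \<and> H c d \<and> \<not> H c e \<and> \<not> H c f \<and> H d e \<and> \<not> H d f \<and> H e f) \<or>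
      (\<not> H a b \<and> H a c \<and> H a d \<and> H a e \<and> \<not> H a f \<and> \<not> H b c \<and> H b d \<and> H b e \<and> H b f \<and> \<not> H c d \<and> H c e \<and> H c f \<and> \<not> H d e \<and> H d f \<and> \<not> H e f) \<or>
      (\<not> H a b \<and> \<not> H a c \<and> H a d \<and> \<not> H a e \<and> H a f \<and> H b c \<and> \<not> H b d \<and> H b e \<and> \<not> H b f \<and> H c d \<and> \<not> H c e \<and> H c f \<and> \<not> H d e \<and> \<not> H d f \<and> H e f) \<or>
      (H a b \<and> H a c \<and> \<not> H a d \<and> H a e \<and> \<not> H a f \<and> \<not> H b c \<and> H b d \<and> \<not> H b e \<and> H b f \<and> \<not> H c d \<and> H c e \<and> \<not> H c f \<and> H d e \<and> H d f \<and> \<not> H e f) \<or>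
      (H a b \<and> \<not> H a c \<and> H a d \<and> \<not> H a e \<and> H a f \<and> \<not> H b c \<and> \<not> H b d \<and> H b e \<and> \<not> H b f \<and> H c d \<and> \<not> H c e \<and> H c f \<and> H d e \<and> \<not> H d f \<and> \<not> H e f) \<or>
      (\<not> H a b \<and> H a c \<and> \<not> H a d \<and> H a e \<and> \<not> H a f \<and> H b c \<and> H b d \<and> \<not> H b e \<and> H b f \<and> \<not> H c d \<and> H c e \<and> \<not> H c f \<and> \<not> H d e \<and> H d f \<and> H e f) \<or>
      (H a b \<and> \<not> H a c \<and> H a d \<and> \<not> H a e \<and> \<not> H a f \<and> H b c \<and> \<not> H b d \<and> H b e \<and> \<not> H b f \<and> \<not> H c d \<and> \<not> H c e \<and> H c f \<and> H d e \<and> \<not> H d f \<and> H e f) \<or>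
      (\<not> H a b \<and> H a c \<and> \<not> H a d \<and> H a e \<and> H a f \<and> \<not> H b c \<and> H b d \<and> \<not> H b e \<and> H b f \<and> H c d \<and> H c e \<and> \<not> H c f \<and> \<not> H d e \<and> H d f \<and> \<not> H e f)"
        using S by (simp add: numeral_eq_Suc All_less_Suc cycle_adj_def) satx
      have ne: "a \<noteq> b" "b \<noteq> a" "a \<noteq> c" "c \<noteq> a" "a \<noteq> d" "d \<noteq> a" "a \<noteq> e" "e \<noteq> a" "a \<noteq> f" "f \<noteq> a" "b \<noteq> c" "c \<noteq> b" "b \<noteq> d" "d \<noteq> b" "b \<noteq> e" "e \<noteq> b" "b \<noteq> f" "f \<noteq> b" "c \<noteq> d" "d \<noteq> c" "c \<noteq> e" "e \<noteq> c" "c \<noteq> f" "f \<noteq> c" "d \<noteq> e" "e \<noteq> d" "d \<noteq> f" "f \<noteq> d" "e \<noteq> f" "f \<noteq> e"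
        using dist by auto
      show ?thesis
        using T unfolding hexagon_def domino_def co_def by (simp only: s ne simp_thms distinct.simps list.set insert_iff empty_iff) satx
    qed
    then show False using agr[OF uh iso] agr[OF uc] nd[OF uh iso] nd[OF uc] nG nC by blast
  next
    case 3
    then show False using agree_from_long_cycle[OF ug uh iso fin prV xs(1,2)] nG nC by blast
  qed
qed

theorem semi_strong_perfect_graph_theorem:
  assumes "ugraph G" "ugraph H" "finite V" "p4iso G H V"
  shows "perf G V \<longleftrightarrow> perf H V"
proof -
  have *: "perf G V" if u: "ugraph G" "ugraph H" "p4iso G H V" and p: "perf H V" for G H
  proof (rule ccontr)
    assume "\<not> perf G V"
    then obtain W where W: "W \<subseteq> V" "minimp G W" using minimp_exists[OF u(1) assms(3)] by metis
    have iso: "p4iso G H W" using u(3) W(1) unfolding p4iso_def by blast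
    obtain xs where xs: "5 \<le> length xs" "set xs \<subseteq> W" "iscycle G xs \<or> iscycle (co G) xs"
      using minimp_disc[OF W(2)] by metis
    have "\<not> perf H W"
    proof (cases "iscycle G xs")
      case True
      then show ?thesis using minimp_P4_isomorphic_cycle[OF W(2) u(2) iso _ xs(2,1)] by blast
    next
      case False
      then have "iscycle (co G) xs" using xs(3) by blast
      then show ?thesis
        using minimp_P4_isomorphic_cycle[OF minimp_co[OF W(2)] u(2) _ _ xs(2,1)] iso by (simp add: p4iso_co1)
    qed
    then show False using perf_mono[OF p W(1)] by blast
  qed
  show ?thesis using *[OF assms(1,2,4)] *[OF assms(2,1) p4iso_sym[OF assms(4)]] by blast
qed

section \<open>Closed walks and induced directed cycles\<close>

definition sym_arc :: "('a \<Rightarrow> 'a \<Rightarrow> bool) \<Rightarrow> 'a \<Rightarrow> 'a \<Rightarrow> bool" where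
  "sym_arc A u v \<longleftrightarrow> A u v \<and> A v u"

definition single_arc :: "('a \<Rightarrow> 'a \<Rightarrow> bool) \<Rightarrow> 'a \<Rightarrow> 'a \<Rightarrow> bool" where
  "single_arc A u v \<longleftrightarrow> A u v \<and> \<not> A v u"

definition dicycle :: "('a \<Rightarrow> 'a \<Rightarrow> bool) \<Rightarrow> 'a list \<Rightarrow> bool" where
  "dicycle A ys \<longleftrightarrow> 3 \<le> length ys \<and> distinct ys \<and> (\<forall>i<length ys. \<forall>j<length ys.
     A (ys ! i) (ys ! j) \<longleftrightarrow> j = Suc i \<or> Suc i = length ys \<and> j = 0)"

text \<open>A closed walk listed without its return to the start; repetitions are allowed, so that
  pieces cut out of it are again of this kind.\<close>

definition closed_list :: "('a \<Rightarrow> 'a \<Rightarrow> bool) \<Rightarrow> 'a set \<Rightarrow> 'a list \<Rightarrow> bool" where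
  "closed_list A C ys \<longleftrightarrow> ys \<noteq> [] \<and> set ys \<subseteq> C \<and> successively A ys \<and> A (last ys) (hd ys)"

lemma ugraph_sym_arc: "(\<And>v. \<not> A v v) \<Longrightarrow> ugraph (sym_arc A)"
  unfolding ugraph_def sym_arc_def by blast

lemma closed_list_sublist:
  assumes ys: "closed_list A C ys" and ij: "i \<le> j" "j < length ys" and a: "A (ys ! j) (ys ! i)"
  shows "closed_list A C (drop i (take (Suc j) ys))" "length (drop i (take (Suc j) ys)) = Suc j - i"
proof -
  let ?zs = "drop i (take (Suc j) ys)"
  show len: "length ?zs = Suc j - i" using ij by simp
  have "set ?zs \<subseteq> C" using ys unfolding closed_list_def by (meson order_trans set_drop_subset set_take_subset)
  moreover have "successively A ?zs"
    using ys ij unfolding closed_list_def successively_conv_nth by simp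
  moreover have "?zs \<noteq> []" using ij by simp
  moreover have "hd ?zs = ys ! i" using ij by (simp add: hd_drop_conv_nth)
  moreover have "last ?zs = ys ! j" using ij by (simp add: last_conv_nth)
  ultimately show "closed_list A C ?zs" using a by (simp add: closed_list_def)
qed

text \<open>In a shortest closed walk any further arc, forward or backward, would close a shorter
  one. Length one would be a loop, and length two an antiparallel pair, which \<open>st\<close>
  excludes.\<close>

lemma closed_list_imp_dicycle:
  assumes "closed_list A C xs" and st: "stab (sym_arc A) C" and irr: "\<And>v. \<not> A v v"
  obtains ys where "dicycle A ys" "set ys \<subseteq> C"
proof -
  have "\<exists>ys. closed_list A C ys \<and> (\<forall>zs. closed_list A C zs \<longrightarrow> length ys \<le> length zs)"
    using assms(1) by (rule ex_has_least_nat)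
  then obtain ys where ys: "closed_list A C ys" and min: "\<And>zs. closed_list A C zs \<Longrightarrow> length ys \<le> length zs"
    by blast
  let ?n = "length ys"
  have Y: "ys \<noteq> []" "set ys \<subseteq> C" "successively A ys" "A (last ys) (hd ys)"
    using ys by (auto simp: closed_list_def)
  have suc: "A (ys ! i) (ys ! Suc i)" if "Suc i < ?n" for i
    using Y(3) that unfolding successively_conv_nth by blast
  have wrap: "A (ys ! (?n - 1)) (ys ! 0)" using Y by (simp add: last_conv_nth hd_conv_nth)
  \<comment> \<open>An arc from position \<open>j\<close> back to \<open>i\<close> closes the
    segment between them, which by minimality is the whole list.\<close>
  have bck: "i = 0 \<and> Suc j = ?n" if "i \<le> j" "j < ?n" "A (ys ! j) (ys ! i)" for i j
    using min[OF closed_list_sublist(1)[OF ys that]] closed_list_sublist(2)[OF ys that] that by linarith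
  have dist: "ys ! i \<noteq> ys ! j" if "i < j" "j < ?n" for i j
  proof
    assume e: "ys ! i = ys ! j"
    have "A (ys ! (j - 1)) (ys ! i)" using suc[of "j - 1"] that e by simp
    then have "i = 0 \<and> Suc (j - 1) = ?n" using that by (intro bck) auto
    then show False using that by simp
  qed
  have fwd: "j = Suc i" if "i < j" "j < ?n" "A (ys ! i) (ys ! j)" for i j
  proof (rule ccontr)
    assume ne: "j \<noteq> Suc i"
    let ?zs = "take (Suc i) ys @ drop j ys"
    have "successively A (take (Suc i) ys)" "successively A (drop j ys)"
      using Y(3) that unfolding successively_conv_nth by simp_all
    moreover have "last (take (Suc i) ys) = ys ! i" using that by (simp add: take_Suc_conv_app_nth)
    moreover have "hd (drop j ys) = ys ! j" using that by (simp add: hd_drop_conv_nth)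
    ultimately have "successively A ?zs" using that by (simp add: successively_append_iff)
    moreover have "set ?zs \<subseteq> C" using Y(2) set_take_subset[of "Suc i" ys] set_drop_subset[of j ys] by auto
    moreover have "hd ?zs = hd ys" using Y(1) by (cases ys) auto
    moreover have "last ?zs = last ys" using that by simp
    ultimately have "closed_list A C ?zs" using Y that unfolding closed_list_def by simp
    from min[OF this] show False using that ne by simp
  qed
  have "3 \<le> ?n"
  proof (rule ccontr)
    assume "\<not> 3 \<le> ?n"
    then have "?n = 1 \<or> ?n = 2" using Y(1) by (cases ys) (auto simp: le_Suc_eq numeral_eq_Suc not_le less_Suc_eq)
    then show False
    proof
      assume "?n = 1" then show False using wrap irr by simp
    next
      assume n2: "?n = 2"
      then have "A (ys ! 0) (ys ! 1)" "A (ys ! 1) (ys ! 0)" using suc[of 0] wrap by auto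
      moreover have "ys ! 0 \<in> C" "ys ! 1 \<in> C" using Y(2) n2 by (auto simp: subset_iff)
      ultimately show False using st unfolding stab_def sym_arc_def by blast
    qed
  qed
  moreover have "distinct ys" unfolding distinct_conv_nth using dist by (metis linorder_neqE_nat)
  moreover have "A (ys ! i) (ys ! j) \<longleftrightarrow> j = Suc i \<or> Suc i = ?n \<and> j = 0" if "i < ?n" "j < ?n" for i j
  proof
    assume a: "A (ys ! i) (ys ! j)"
    show "j = Suc i \<or> Suc i = ?n \<and> j = 0"
    proof (cases "i < j")
      case True then show ?thesis using fwd a that by blast
    next
      case False then show ?thesis using bck[of j i] a that by auto
    qed
  next
    assume "j = Suc i \<or> Suc i = ?n \<and> j = 0"
    then show "A (ys ! i) (ys ! j)"
    proof
      assume "j = Suc i" then show ?thesis using suc that by simp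
    next
      assume "Suc i = ?n \<and> j = 0"
      then have "i = ?n - 1" "j = 0" by auto
      then show ?thesis using wrap by simp
    qed
  qed
  ultimately show thesis using that[of ys] Y(2) unfolding dicycle_def by blast
qed

subsection \<open>Induced directed cycles under P4C-isomorphism\<close>

text \<open>The hypotheses express what the induced cycle of the other digraph leaves possible on
  these vertices: an induced directed path only on three consecutive vertices, no directed triangle,
  and none of the mixed paths. Chords are removed by kind: single arcs first, then symmetric
  ones.\<close>

lemma dicycle_rigid:
  fixes v :: "int \<Rightarrow> 'a" and n :: int
  assumes n: "n \<ge> 4" and per: "\<And>i. v (i + n) = v i"
    and arc: "\<And>i. single_arc A (v i) (v (i + 1))"
    and gap: "\<And>i. \<not> A (v i) (v (i + 2)) \<and> \<not> A (v (i + 2)) (v i)"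
    and P3: "\<And>j p q. 0 < p \<Longrightarrow> p < n \<Longrightarrow> 0 < q \<Longrightarrow> q < n \<Longrightarrow> p \<noteq> q \<Longrightarrow>
      single_arc A (v (j + p)) (v j) \<Longrightarrow> single_arc A (v j) (v (j + q)) \<Longrightarrow>
      \<not> A (v (j + p)) (v (j + q)) \<Longrightarrow> \<not> A (v (j + q)) (v (j + p)) \<Longrightarrow> p = 1 \<and> q = n - 1 \<or> p = n - 1 \<and> q = 1"
    and C3: "\<And>i p q. 0 < p \<Longrightarrow> p < n \<Longrightarrow> 0 < q \<Longrightarrow> q < n \<Longrightarrow> p \<noteq> q \<Longrightarrow>
      \<not> (single_arc A (v i) (v (i + p)) \<and> single_arc A (v (i + p)) (v (i + q)) \<and> single_arc A (v (i + q)) (v i))"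
    and pm: "\<And>j p q. 0 < p \<Longrightarrow> p < n \<Longrightarrow> 0 < q \<Longrightarrow> q < n \<Longrightarrow> p \<noteq> q \<Longrightarrow> sym_arc A (v (j + p)) (v j) \<Longrightarrow>
      single_arc A (v j) (v (j + q)) \<or> single_arc A (v (j + q)) (v j) \<Longrightarrow> A (v (j + p)) (v (j + q)) \<or> A (v (j + q)) (v (j + p))"
    and m: "0 < m" "m < n"
  shows "A (v i) (v (i + m)) \<longleftrightarrow> m = 1"
proof -
  let ?O = "\<lambda>i j. single_arc A (v i) (v j)" and ?S = "\<lambda>i j. sym_arc A (v i) (v j)"
  have tri: "A (v i) (v j) \<or> A (v j) (v i) \<Longrightarrow> ?O i j \<or> ?O j i \<or> ?S i j" for i j
    unfolding single_arc_def sym_arc_def by blast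
  have ssym: "?S i j \<longleftrightarrow> ?S j i" and excl: "\<not> (?O i j \<and> ?O j i)" "\<not> (?O i j \<and> ?S i j)" "\<not> (?O j i \<and> ?S i j)" for i j
    unfolding single_arc_def sym_arc_def by blast+
  \<comment> \<open>Let \<open>j\<close> be \<open>i + k\<close>. The path from \<open>j - 1\<close>
    through \<open>j\<close> to \<open>i\<close> cannot be induced, and neither a directed triangle
    nor a shorter backward arc may arise, so \<open>j - 1\<close> and \<open>i\<close> are joined
    symmetrically. The mixed path condition at \<open>j - 1\<close> then joins \<open>j - 2\<close>
    to \<open>i\<close>. Since \<open>j - 2\<close> and \<open>j\<close> are not joined, each kind
    of connection there is forbidden: by induction, by \<open>P3\<close> at \<open>i\<close>, or by
    \<open>pm\<close> at \<open>i\<close>.\<close>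
  have c1: "\<not> ?O (i + int k) i" if "1 \<le> k" "int k \<le> n - 2" for i k
    using that
  proof (induction k rule: less_induct)
    case (less k)
    show ?case
    proof
      assume Ok: "?O (i + int k) i"
      have IH: "\<not> ?O (i + (int k - l)) i" if "0 < l" "l < int k" for l
      proof -
        have "int (nat (int k - l)) = int k - l" using that by simp
        then show ?thesis using less.IH[of "nat (int k - l)"] that less.prems by auto
      qed
      have "k \<noteq> 1" using Ok arc[of i] excl(1) by auto
      then have k2: "int k \<ge> 2" using less.prems by simp
      let ?j = "i + int k"
      have O1: "?O (?j - 1) ?j" using arc[of "?j - 1"] by simp
      have a1: "A (v (?j - 1)) (v i) \<or> A (v i) (v (?j - 1))"
      proof (rule ccontr)
        assume na: "\<not> ?thesis"
        have e: "?j + (n - int k) = i + n" "?j + (n - 1) = ?j - 1 + n" by simp_all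
        have "n - 1 = 1 \<and> n - int k = n - 1 \<or> n - 1 = n - 1 \<and> n - int k = 1"
          using P3[of "n - 1" "n - int k" ?j, unfolded e per] n k2 less.prems O1 Ok na by auto
        then show False using n k2 less.prems by linarith
      qed
      have "\<not> ?O i (?j - 1)"
      proof
        assume "?O i (?j - 1)"
        then show False using C3[of "int k - 1" "int k" i] O1 Ok k2 less.prems n by (simp add: algebra_simps)
      qed
      moreover have "\<not> ?O (?j - 1) i" using IH[of 1] k2 by (simp add: algebra_simps)
      ultimately have S1: "?S (?j - 1) i" using tri[OF a1] ssym by blast
      have "int k \<noteq> 2"
      proof
        assume "int k = 2"
        then show False using S1 arc[of i] excl(2)[of i "i + 1"] ssym[of i "i + 1"] by (simp add: algebra_simps)
      qed
      then have k3: "int k \<ge> 3" using k2 by simp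
      have a2: "A (v i) (v (?j - 2)) \<or> A (v (?j - 2)) (v i)"
      proof -
        have e: "?j - 1 + (n - int k + 1) = i + n" "?j - 1 + (n - 1) = ?j - 2 + n" by simp_all
        have "?O (?j - 2) (?j - 1)" using arc[of "?j - 2"] by (simp add: algebra_simps)
        then show ?thesis
          using pm[of "n - int k + 1" "n - 1" "?j - 1", unfolded e per] S1 ssym k3 less.prems n by auto
      qed
      have g: "\<not> A (v (?j - 2)) (v ?j)" "\<not> A (v ?j) (v (?j - 2))" using gap[of "?j - 2"] by auto
      have "\<not> ?O (?j - 2) i" using IH[of 2] k3 by (simp add: algebra_simps)
      moreover have "\<not> ?O i (?j - 2)"
      proof
        assume o: "?O i (?j - 2)"
        have "int k = 1 \<and> int k - 2 = n - 1 \<or> int k = n - 1 \<and> int k - 2 = 1"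
          by (rule P3[of "int k" "int k - 2" i]) (use o Ok g k3 less.prems n in \<open>auto simp: algebra_simps\<close>)
        then show False using k3 less.prems by linarith
      qed
      moreover have "\<not> ?S i (?j - 2)"
      proof
        assume "?S i (?j - 2)"
        then have "?S (i + (int k - 2)) i" using ssym[of i] by (simp add: algebra_simps)
        then have "A (v (i + (int k - 2))) (v ?j) \<or> A (v ?j) (v (i + (int k - 2)))"
          using pm[of "int k - 2" "int k" i] Ok k3 less.prems n by auto
        then show False using g by (simp add: algebra_simps)
      qed
      ultimately show False using tri[OF a2] by blast
    qed
  qed
  \<comment> \<open>A single arc forward by \<open>m\<close> is one backward by
    \<open>n - m\<close>, read around the other side of the cycle.\<close>
  have c2: "m = 1" if "?O i (i + m)" "0 < m" "m < n" for i m
  proof (rule ccontr)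
    assume "m \<noteq> 1"
    have "int (nat (n - m)) = n - m" "1 \<le> nat (n - m)" using that by linarith+
    moreover have "?O (i + m + (n - m)) (i + m)" using that(1) per[of i] by simp
    ultimately show False using c1[of "nat (n - m)" "i + m"] that \<open>m \<noteq> 1\<close> by (auto simp: per)
  qed
  \<comment> \<open>A symmetric chord forces the next one with its far end moved forward, until that
    end is one or two steps before \<open>i\<close>; \<open>k\<close> is the distance still to
    go.\<close>
  have c3: "\<not> ?S i (i + (n - int k))" if "1 \<le> k" "int k < n" for i k
    using that
  proof (induction k rule: less_induct)
    case (less k)
    show ?case
    proof
      assume S: "?S i (i + (n - int k))"
      let ?m = "n - int k"
      have "k \<noteq> 1"
      proof
        assume "k = 1"
        moreover have "?O (i + (n - 1)) (i + (n - 1) + 1)" by (rule arc)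
        then have "?O (i + (n - 1)) i" using per[of i] by (simp add: algebra_simps)
        ultimately show False using S excl by auto
      qed
      moreover have "k \<noteq> 2"
      proof
        assume "k = 2"
        then have "i + ?m + 2 = i + n" by simp
        then show False using gap[of "i + ?m"] S per[of i] unfolding sym_arc_def by metis
      qed
      ultimately have k3: "int k \<ge> 3" using less.prems by simp
      have e: "i + ?m + int k = i + n" "i + ?m + 1 = i + (?m + 1)" by simp_all
      have "A (v i) (v (i + (?m + 1))) \<or> A (v (i + (?m + 1))) (v i)"
        using pm[of "int k" 1 "i + ?m", unfolded e per] S arc[of "i + ?m", unfolded e] k3 less.prems n by auto
      then consider "?O i (i + (?m + 1))" | "?O (i + (?m + 1)) i" | "?S i (i + (?m + 1))" using tri by blast
      then show False
      proof cases
        case 1 then show False using c2[of i "?m + 1"] k3 less.prems n by auto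
      next
        case 2
        have "int (nat (?m + 1)) = ?m + 1" "1 \<le> nat (?m + 1)" using less.prems by linarith+
        then show False using c1[of "nat (?m + 1)" i] 2 k3 less.prems n by auto
      next
        case 3
        have e: "n - int (k - 1) = ?m + 1" using k3 by simp
        have "\<not> ?S i (i + (n - int (k - 1)))" by (rule less.IH) (use k3 less.prems in auto)
        then show False using 3 unfolding e by blast
      qed
    qed
  qed
  show ?thesis
  proof
    assume "A (v i) (v (i + m))"
    then consider "?O i (i + m)" | "?S i (i + m)" unfolding single_arc_def sym_arc_def by blast
    then show "m = 1"
    proof cases
      case 1 then show ?thesis using c2 m by blast
    next
      case 2
      have "n - int (nat (n - m)) = m" "1 \<le> nat (n - m)" "int (nat (n - m)) < n" using m by auto
      then show ?thesis using c3[of "nat (n - m)" i] 2 by metis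
    qed
  next
    assume "m = 1" then show "A (v i) (v (i + m))" using arc[of i] by (simp add: single_arc_def)
  qed
qed

definition ind_C3 :: "('a \<Rightarrow> 'a \<Rightarrow> bool) \<Rightarrow> 'a \<Rightarrow> 'a \<Rightarrow> 'a \<Rightarrow> bool" where
  "ind_C3 A a b c \<longleftrightarrow> single_arc A a b \<and> single_arc A b c \<and> single_arc A c a \<or>
     single_arc A b a \<and> single_arc A c b \<and> single_arc A a c"

text \<open>The second vertex is the midpoint, as also in the mixed version below.\<close>

definition ind_P3 :: "('a \<Rightarrow> 'a \<Rightarrow> bool) \<Rightarrow> 'a \<Rightarrow> 'a \<Rightarrow> 'a \<Rightarrow> bool" where
  "ind_P3 A a b c \<longleftrightarrow> (single_arc A a b \<and> single_arc A b c \<or> single_arc A c b \<and> single_arc A b a) \<and> \<not> A a c \<and> \<not> A c a"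

definition ind_P3pm :: "('a \<Rightarrow> 'a \<Rightarrow> bool) \<Rightarrow> 'a \<Rightarrow> 'a \<Rightarrow> 'a \<Rightarrow> bool" where
  "ind_P3pm A a b c \<longleftrightarrow> (sym_arc A a b \<and> (single_arc A b c \<or> single_arc A c b) \<or>
     sym_arc A b c \<and> (single_arc A a b \<or> single_arc A b a)) \<and> \<not> A a c \<and> \<not> A c a"

text \<open>A triangle is preserved as such, possibly reversed. On a longer cycle of
  \<open>B\<close>, consecutive triples induce directed paths with the same midpoint in
  \<open>A\<close>, so the arcs of \<open>A\<close> between consecutive vertices run all forward or
  all backward; the latter case is read through negated indices. In both cases
  \<open>dicycle_rigid\<close> excludes chords.\<close>

lemma dicycle_transfer:
  assumes irr: "\<And>v. \<not> A v v"
    and C3: "\<And>a b c. a \<in> V \<Longrightarrow> b \<in> V \<Longrightarrow> c \<in> V \<Longrightarrow> distinct [a, b, c] \<Longrightarrow> ind_C3 A a b c \<longleftrightarrow> ind_C3 B a b c"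
    and P3: "\<And>a b c. a \<in> V \<Longrightarrow> b \<in> V \<Longrightarrow> c \<in> V \<Longrightarrow> distinct [a, b, c] \<Longrightarrow> ind_P3 A a b c \<longleftrightarrow> ind_P3 B a b c"
    and pm: "\<And>a b c. a \<in> V \<Longrightarrow> b \<in> V \<Longrightarrow> c \<in> V \<Longrightarrow> distinct [a, b, c] \<Longrightarrow> ind_P3pm A a b c \<longleftrightarrow> ind_P3pm B a b c"
    and ys: "dicycle B ys" "set ys \<subseteq> V"
  shows "\<exists>zs. dicycle A zs \<and> set zs \<subseteq> V"
proof (cases "length ys = 3")
  case True
  then obtain a b c where l: "ys = [a, b, c]" by (auto simp: numeral_eq_Suc length_Suc_conv)
  have V: "a \<in> V" "b \<in> V" "c \<in> V" "distinct [a, b, c]" using ys l by (auto simp: dicycle_def)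
  have "ind_C3 B a b c"
    using ys(1) unfolding l dicycle_def ind_C3_def single_arc_def by (simp add: numeral_eq_Suc All_less_Suc)
  then have "ind_C3 A a b c" using C3 V by blast
  then have "dicycle A [a, b, c] \<or> dicycle A [c, b, a]"
    using V irr unfolding dicycle_def ind_C3_def single_arc_def by (simp add: numeral_eq_Suc All_less_Suc) blast
  then show ?thesis using V by auto
next
  case False
  define n where "n = int (length ys)"
  have n: "n \<ge> 4" using ys(1) False by (auto simp: n_def dicycle_def)
  define v where "v i = ys ! nat (i mod n)" for i
  have idx: "nat (i mod n) < length ys" for i
    using n pos_mod_bound[of n i] pos_mod_sign[of n i] unfolding n_def by linarith
  have vV: "v i \<in> V" for i unfolding v_def using idx ys(2) nth_mem by blast
  have per: "v (i + n) = v i" for i by (simp add: v_def)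
  have step: "v i \<noteq> v (i + m) \<and> (B (v i) (v (i + m)) \<longleftrightarrow> m = 1) \<and> (B (v (i + m)) (v i) \<longleftrightarrow> m = n - 1)"
    if m: "0 < m" "m < n" for i m
  proof -
    let ?p = "i mod n"
    have p: "0 \<le> ?p" "?p < n" using n by auto
    have pm: "(i + m) mod n = (?p + m) mod n" by (simp add: mod_add_left_eq)
    have q: "(i + m) mod n = (if ?p + m < n then ?p + m else ?p + m - n)"
    proof (cases "?p + m < n")
      case True then show ?thesis using p m pm by simp
    next
      case False
      have "(?p + m) mod n = (?p + m - n) mod n" by simp
      also have "\<dots> = ?p + m - n" by (rule mod_pos_pos_trivial) (use False p m in linarith)+
      finally show ?thesis using pm False by simp
    qed
    have cyc: "(s = r + 1 \<or> r = n - 1 \<and> s = 0) = (m = 1)" "(r = s + 1 \<or> s = n - 1 \<and> r = 0) = (m = n - 1)"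
      if "0 \<le> r" "r < n" "0 < m" "m < n" "s = (if r + m < n then r + m else r + m - n)" for r s
      using that n by (auto split: if_splits)
    have ix: "int (nat ?p) = ?p" "int (nat ((i + m) mod n)) = (i + m) mod n" using p n by auto
    have B: "B (ys ! r) (ys ! s) \<longleftrightarrow> int s = int r + 1 \<or> int r = n - 1 \<and> int s = 0" if "r < length ys" "s < length ys" for r s
      using ys(1) that unfolding dicycle_def n_def by auto
    have "nat ?p \<noteq> nat ((i + m) mod n)" using ix q p m by (smt (verit))
    then have "v i \<noteq> v (i + m)"
      using ys(1) idx[of i] idx[of "i + m"] unfolding v_def dicycle_def by (simp add: nth_eq_iff_index_eq)
    moreover have "B (v i) (v (i + m)) \<longleftrightarrow> m = 1"
      unfolding v_def B[OF idx idx] ix by (rule cyc(1)[OF p m q])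
    moreover have "B (v (i + m)) (v i) \<longleftrightarrow> m = n - 1"
      unfolding v_def B[OF idx idx] ix by (rule cyc(2)[OF p m q])
    ultimately show ?thesis by blast
  qed
  have adj: "(B (v (j + p)) (v (j + q)) \<or> B (v (j + q)) (v (j + p))) \<longleftrightarrow> \<bar>p - q\<bar> = 1 \<or> \<bar>p - q\<bar> = n - 1"
    if pq: "0 \<le> p" "p < n" "0 \<le> q" "q < n" "p \<noteq> q" for j p q
  proof (cases "p < q")
    case True
    then show ?thesis using step[of "q - p" "j + p"] pq by auto
  next
    case False
    then show ?thesis using step[of "p - q" "j + q"] pq by auto
  qed
  have ne: "v (j + p) \<noteq> v (j + q)" if pq: "0 \<le> p" "p < n" "0 \<le> q" "q < n" "p \<noteq> q" for j p q
  proof (cases "p < q")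
    case True
    then show ?thesis using step[of "q - p" "j + p"] pq by auto
  next
    case False
    then show ?thesis using step[of "p - q" "j + q"] pq by auto
  qed
  have no_sym: "\<not> sym_arc B (v (j + p)) (v (j + q))" if pq: "0 \<le> p" "p < n" "0 \<le> q" "q < n" "p \<noteq> q" for j p q
  proof (cases "p < q")
    case True
    then show ?thesis using step[of "q - p" "j + p"] pq n unfolding sym_arc_def by auto
  next
    case False
    then show ?thesis using step[of "p - q" "j + q"] pq n unfolding sym_arc_def by auto
  qed
  have dist: "distinct [v (j + p), v j, v (j + q)]" if "0 < p" "p < n" "0 < q" "q < n" "p \<noteq> q" for j p q
    using ne[of p 0 j] ne[of 0 q j] ne[of p q j] that n by auto
  have P3': "p = 1 \<and> q = n - 1 \<or> p = n - 1 \<and> q = 1"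
    if pq: "0 < p" "p < n" "0 < q" "q < n" "p \<noteq> q" and "single_arc A (v (j + p)) (v j)" "single_arc A (v j) (v (j + q))"
      "\<not> A (v (j + p)) (v (j + q))" "\<not> A (v (j + q)) (v (j + p))" for j p q
  proof -
    have "ind_P3 A (v (j + p)) (v j) (v (j + q))" using that unfolding ind_P3_def by blast
    then have "ind_P3 B (v (j + p)) (v j) (v (j + q))" using P3[OF vV vV vV dist[OF pq]] by blast
    then have "B (v (j + p)) (v j) \<or> B (v j) (v (j + p))" "B (v (j + q)) (v j) \<or> B (v j) (v (j + q))"
      unfolding ind_P3_def single_arc_def by blast+
    then show ?thesis using adj[of p 0 j] adj[of q 0 j] pq n by auto
  qed
  have C3': "\<not> (single_arc A (v i) (v (i + p)) \<and> single_arc A (v (i + p)) (v (i + q)) \<and> single_arc A (v (i + q)) (v i))"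
    if pq: "0 < p" "p < n" "0 < q" "q < n" "p \<noteq> q" for i p q
  proof
    assume *: "single_arc A (v i) (v (i + p)) \<and> single_arc A (v (i + p)) (v (i + q)) \<and> single_arc A (v (i + q)) (v i)"
    then have "ind_C3 A (v (i + p)) (v i) (v (i + q))" unfolding ind_C3_def by blast
    then have "ind_C3 B (v (i + p)) (v i) (v (i + q))" using C3[OF vV vV vV dist[OF pq]] by blast
    then have "B (v (i + p)) (v i) \<or> B (v i) (v (i + p))" "B (v (i + q)) (v i) \<or> B (v i) (v (i + q))"
      "B (v (i + p)) (v (i + q)) \<or> B (v (i + q)) (v (i + p))"
      unfolding ind_C3_def single_arc_def by blast+
    then show False using adj[of p 0 i] adj[of q 0 i] adj[of p q i] pq n by auto
  qed
  have pm': "A (v (j + p)) (v (j + q)) \<or> A (v (j + q)) (v (j + p))"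
    if pq: "0 < p" "p < n" "0 < q" "q < n" "p \<noteq> q" and s: "sym_arc A (v (j + p)) (v j)"
      "single_arc A (v j) (v (j + q)) \<or> single_arc A (v (j + q)) (v j)" for j p q
  proof (rule ccontr)
    assume "\<not> ?thesis"
    then have "ind_P3pm A (v (j + p)) (v j) (v (j + q))" using s unfolding ind_P3pm_def by blast
    then have "ind_P3pm B (v (j + p)) (v j) (v (j + q))" using pm[OF vV vV vV dist[OF pq]] by blast
    then show False using no_sym[of p 0 j] no_sym[of 0 q j] pq n unfolding ind_P3pm_def by auto
  qed
  have con: "(single_arc A (v i) (v (i + 1)) \<and> single_arc A (v (i + 1)) (v (i + 2)) \<or>
      single_arc A (v (i + 2)) (v (i + 1)) \<and> single_arc A (v (i + 1)) (v i)) \<and> \<not> A (v i) (v (i + 2)) \<and> \<not> A (v (i + 2)) (v i)" for i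
  proof -
    have d: "distinct [v i, v (i + 1), v (i + 2)]"
      using ne[of 0 1 i] ne[of 0 2 i] ne[of 1 2 i] n by auto
    have "ind_P3 B (v i) (v (i + 1)) (v (i + 2))"
      using step[of 1 i] step[of 1 "i + 1"] step[of 2 i] n unfolding ind_P3_def single_arc_def by (auto simp: add.assoc)
    then have "ind_P3 A (v i) (v (i + 1)) (v (i + 2))" using P3[OF vV vV vV d] by blast
    then show ?thesis unfolding ind_P3_def .
  qed
  have spread: "Q j" if "Q 0" "\<And>i. Q i \<Longrightarrow> Q (i + 1)" "\<And>i. Q (i + 1) \<Longrightarrow> Q i" for Q and j :: int
  proof (induction j rule: int_induct[where k = 0])
    case base show ?case by (rule that(1))
  next
    case (step1 i) show ?case by (rule that(2)[OF step1(2)])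
  next
    case (step2 i) show ?case using that(3)[of "i - 1"] step2(2) by simp
  qed
  have final: "dicycle A (map u [0..n - 1]) \<and> set (map u [0..n - 1]) \<subseteq> V"
    if u: "\<And>i m. 0 < m \<Longrightarrow> m < n \<Longrightarrow> A (u i) (u (i + m)) \<longleftrightarrow> m = 1" "\<And>i. u (i + n) = u i"
      "\<And>i. u i \<in> V" "\<And>i m. 0 < m \<Longrightarrow> m < n \<Longrightarrow> u i \<noteq> u (i + m)" for u
  proof -
    have len: "length (map u [0..n - 1]) = nat n" by simp
    have nth: "map u [0..n - 1] ! i = u (int i)" if "i < nat n" for i using that by simp
    have ne: "u (int i) \<noteq> u (int j)" if "i < j" "j < nat n" for i j
      using u(4)[of "int j - int i" "int i"] that by simp
    have "distinct (map u [0..n - 1])"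
      unfolding distinct_conv_nth len using nth ne by (metis linorder_neqE_nat)
    moreover have "A (u (int i)) (u (int j)) \<longleftrightarrow> j = Suc i \<or> Suc i = nat n \<and> j = 0" if ij: "i < nat n" "j < nat n" for i j
    proof -
      consider "i < j" | "j < i" | "i = j" by linarith
      then show ?thesis
      proof cases
        case 1
        then show ?thesis using u(1)[of "int j - int i" "int i"] ij n by auto
      next
        case 2
        have "u (int j + n) = u (int j)" by (rule u(2))
        then have "A (u (int i)) (u (int j)) \<longleftrightarrow> n - (int i - int j) = 1"
          using u(1)[of "n - (int i - int j)" "int i"] 2 ij by (simp add: algebra_simps)
        then show ?thesis using 2 ij n by auto
      next
        case 3
        then show ?thesis using irr ij n by auto
      qed
    qed
    ultimately show ?thesis unfolding dicycle_def len using nth n u(3) by auto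
  qed
  show ?thesis
  proof (cases "single_arc A (v 0) (v 1)")
    case True
    have arc: "single_arc A (v i) (v (i + 1))" for i
    proof (rule spread[of "\<lambda>i. single_arc A (v i) (v (i + 1))"])
      show "single_arc A (v 0) (v (0 + 1))" using True by simp
      fix i
      show "single_arc A (v (i + 1)) (v (i + 1 + 1))" if "single_arc A (v i) (v (i + 1))"
        using con[of i] that unfolding single_arc_def by (auto simp: add.assoc)
      show "single_arc A (v i) (v (i + 1))" if "single_arc A (v (i + 1)) (v (i + 1 + 1))"
        using con[of i] that unfolding single_arc_def by (auto simp: add.assoc)
    qed
    have "A (v i) (v (i + m)) \<longleftrightarrow> m = 1" if "0 < m" "m < n" for i m
    proof (rule dicycle_rigid[where v = v and n = n])
      show "n \<ge> 4" "0 < m" "m < n" by fact+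
      show "v (j + n) = v j" for j by (rule per)
      show "single_arc A (v j) (v (j + 1))" for j by (rule arc)
      show "\<not> A (v j) (v (j + 2)) \<and> \<not> A (v (j + 2)) (v j)" for j using con by blast
      fix j p q assume pq: "0 < p" "p < n" "0 < q" "q < n" "p \<noteq> q"
      show "p = 1 \<and> q = n - 1 \<or> p = n - 1 \<and> q = 1"
        if "single_arc A (v (j + p)) (v j)" "single_arc A (v j) (v (j + q))"
          "\<not> A (v (j + p)) (v (j + q))" "\<not> A (v (j + q)) (v (j + p))"
        by (rule P3'[OF pq that])
      show "\<not> (single_arc A (v j) (v (j + p)) \<and> single_arc A (v (j + p)) (v (j + q)) \<and> single_arc A (v (j + q)) (v j))"
        by (rule C3'[OF pq])
      show "A (v (j + p)) (v (j + q)) \<or> A (v (j + q)) (v (j + p))"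
        if "sym_arc A (v (j + p)) (v j)" "single_arc A (v j) (v (j + q)) \<or> single_arc A (v (j + q)) (v j)"
        by (rule pm'[OF pq that])
    qed
    then show ?thesis using final[of v, OF _ per vV] step by blast
  next
    case False
    let ?v = "\<lambda>i. v (- i)"
    have per': "?v (i + n) = ?v i" for i using per[of "- i - n"] by simp
    \<comment> \<open>Going back by \<open>p\<close> is going forward by \<open>n - p\<close>, so
      the facts established for positive offsets apply to the reversed cycle.\<close>
    have flip: "v (- (j + p)) = v (- j + (n - p))" for j p
      using per[of "- j - p"] by (simp add: algebra_simps)
    have bck: "single_arc A (v (i + 1)) (v i)" for i
    proof (rule spread[of "\<lambda>i. single_arc A (v (i + 1)) (v i)"])
      show "single_arc A (v (0 + 1)) (v 0)" using con[of 0] False by auto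
      fix i
      show "single_arc A (v (i + 1 + 1)) (v (i + 1))" if "single_arc A (v (i + 1)) (v i)"
        using con[of i] that unfolding single_arc_def by (auto simp: add.assoc)
      show "single_arc A (v (i + 1)) (v i)" if "single_arc A (v (i + 1 + 1)) (v (i + 1))"
        using con[of i] that unfolding single_arc_def by (auto simp: add.assoc)
    qed
    have arc: "single_arc A (?v i) (?v (i + 1))" for i using bck[of "- i - 1"] by simp
    have gap: "\<not> A (?v i) (?v (i + 2)) \<and> \<not> A (?v (i + 2)) (?v i)" for i using con[of "- i - 2"] by simp
    have "A (?v i) (?v (i + m)) \<longleftrightarrow> m = 1" if m: "0 < m" "m < n" for i m
    proof (rule dicycle_rigid[where v = ?v and n = n])
      show "n \<ge> 4" "0 < m" "m < n" by fact+
      show "?v (j + n) = ?v j" for j by (rule per')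
      show "single_arc A (?v j) (?v (j + 1))" for j by (rule arc)
      show "\<not> A (?v j) (?v (j + 2)) \<and> \<not> A (?v (j + 2)) (?v j)" for j by (rule gap)
      fix j p q assume pq: "0 < p" "p < n" "0 < q" "q < n" "p \<noteq> q"
      then have pq': "0 < n - p" "n - p < n" "0 < n - q" "n - q < n" "n - p \<noteq> n - q" by auto
      show "p = 1 \<and> q = n - 1 \<or> p = n - 1 \<and> q = 1"
        if "single_arc A (?v (j + p)) (?v j)" "single_arc A (?v j) (?v (j + q))"
          "\<not> A (?v (j + p)) (?v (j + q))" "\<not> A (?v (j + q)) (?v (j + p))"
        using P3'[OF pq', of "- j"] that unfolding flip by auto
      show "\<not> (single_arc A (?v j) (?v (j + p)) \<and> single_arc A (?v (j + p)) (?v (j + q)) \<and> single_arc A (?v (j + q)) (?v j))"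
        using C3'[OF pq', of "- j"] unfolding flip .
      show "A (?v (j + p)) (?v (j + q)) \<or> A (?v (j + q)) (?v (j + p))"
        if "sym_arc A (?v (j + p)) (?v j)" "single_arc A (?v j) (?v (j + q)) \<or> single_arc A (?v (j + q)) (?v j)"
        using pm'[OF pq', of "- j"] that unfolding flip by blast
    qed
    moreover have "?v i \<noteq> ?v (i + m)" if "0 < m" "m < n" for i m
      using step[of m "- i - m"] that by auto
    ultimately show ?thesis using final[of ?v, OF _ per' vV] by blast
  qed
qed

subsection \<open>Arc relations of pair digraphs\<close>

definition arc_rel :: "'a pair_pre_digraph \<Rightarrow> 'a \<Rightarrow> 'a \<Rightarrow> bool" where
  "arc_rel D u v \<longleftrightarrow> (u, v) \<in> parcs D"

lemma arc_rel_record [simp]: "arc_rel \<lparr>pverts = V, parcs = E\<rparr> u v \<longleftrightarrow> (u, v) \<in> E"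
  by (simp add: arc_rel_def)

definition pair_induce :: "'a pair_pre_digraph \<Rightarrow> 'a set \<Rightarrow> 'a pair_pre_digraph" where
  "pair_induce D W = \<lparr>pverts = W, parcs = {e \<in> parcs D. fst e \<in> W \<and> snd e \<in> W}\<rparr>"

definition pair_sym :: "'a pair_pre_digraph \<Rightarrow> 'a pair_pre_digraph" where
  "pair_sym D = \<lparr>pverts = pverts D, parcs = {(u, v). sym_arc (arc_rel D) u v}\<rparr>"

lemma pair_induce_simps [simp]:
  "pverts (pair_induce D W) = W" "(u, v) \<in> parcs (pair_induce D W) \<longleftrightarrow> arc_rel D u v \<and> u \<in> W \<and> v \<in> W"
  by (simp_all add: pair_induce_def arc_rel_def)

lemma induce_with_proj: "with_proj D \<restriction> W = with_proj (pair_induce D W)"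
  by (simp add: induce_subgraph_def with_proj_def pair_induce_def)

lemma symmetric_part_with_proj: "symmetric_part (with_proj D) = with_proj (pair_sym D)"
  by (rule pre_digraph.equality) (auto simp: symmetric_part_def pair_sym_def sym_arc_def arc_rel_def)

lemma wf_pair_induce: "pair_wf_digraph (pair_induce D W)"
  by (auto simp: pair_wf_digraph_def pair_induce_def)

text \<open>Arcs of a pair digraph are pairs of vertices, so the arc part of an isomorphism is
  determined by its vertex part. The predicate \<open>P\<close> allows for a prescribed image of the
  midpoint.\<close>

lemma iso_with_proj:
  assumes K: "pair_wf_digraph K" and F: "parcs F \<subseteq> pverts F \<times> pverts F"
  shows "(\<exists>f. pre_digraph.digraph_isomorphism (with_proj K) f \<and> with_proj F = app_iso f (with_proj K) \<and> P (iso_verts f)) \<longleftrightarrow>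
    (\<exists>g. bij_betw g (pverts K) (pverts F) \<and>
      (\<forall>u\<in>pverts K. \<forall>v\<in>pverts K. arc_rel K u v \<longleftrightarrow> arc_rel F (g u) (g v)) \<and> P g)"
proof
  assume "\<exists>f. pre_digraph.digraph_isomorphism (with_proj K) f \<and> with_proj F = app_iso f (with_proj K) \<and> P (iso_verts f)"
  then obtain f where f: "pre_digraph.digraph_isomorphism (with_proj K) f" "with_proj F = app_iso f (with_proj K)" "P (iso_verts f)"
    by blast
  let ?g = "iso_verts f"
  have inj: "inj_on ?g (pverts K)" and ends: "\<And>a. a \<in> parcs K \<Longrightarrow> ?g (fst a) = iso_tail f (iso_arcs f a) \<and> ?g (snd a) = iso_head f (iso_arcs f a)"
    using f(1) unfolding pre_digraph.digraph_isomorphism_def by auto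
  have im: "pverts F = ?g ` pverts K" "parcs F = iso_arcs f ` parcs K" "fst = iso_tail f" "snd = iso_head f"
    using arg_cong[OF f(2), of verts] arg_cong[OF f(2), of arcs] arg_cong[OF f(2), of tail] arg_cong[OF f(2), of head] by simp_all
  have arc: "iso_arcs f (u, v) = (?g u, ?g v)" if "(u, v) \<in> parcs K" for u v
    using ends[OF that] unfolding im(3,4)[symmetric] by (simp add: prod_eq_iff)
  have "arc_rel K u v \<longleftrightarrow> arc_rel F (?g u) (?g v)" if uv: "u \<in> pverts K" "v \<in> pverts K" for u v
  proof
    assume "arc_rel K u v"
    then show "arc_rel F (?g u) (?g v)" unfolding arc_rel_def im(2) by (metis arc image_eqI)
  next
    assume "arc_rel F (?g u) (?g v)"
    then obtain a where "a \<in> parcs K" "iso_arcs f a = (?g u, ?g v)" unfolding arc_rel_def im(2) by (metis imageE)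
    moreover obtain u' v' where "a = (u', v')" by (cases a)
    ultimately have a: "(u', v') \<in> parcs K" "?g u' = ?g u" "?g v' = ?g v" using arc by auto
    moreover have "u' \<in> pverts K" "v' \<in> pverts K" using a(1) K unfolding pair_wf_digraph_def by force+
    ultimately have "u' = u" "v' = v" using inj uv unfolding inj_on_def by blast+
    then show "arc_rel K u v" using a(1) by (simp add: arc_rel_def)
  qed
  then show "\<exists>g. bij_betw g (pverts K) (pverts F) \<and>
      (\<forall>u\<in>pverts K. \<forall>v\<in>pverts K. arc_rel K u v \<longleftrightarrow> arc_rel F (g u) (g v)) \<and> P g"
    using inj im(1) f(3) by (intro exI[of _ ?g]) (simp add: bij_betw_def)
next
  assume "\<exists>g. bij_betw g (pverts K) (pverts F) \<and>
      (\<forall>u\<in>pverts K. \<forall>v\<in>pverts K. arc_rel K u v \<longleftrightarrow> arc_rel F (g u) (g v)) \<and> P g"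
  then obtain g where g: "inj_on g (pverts K)" "g ` pverts K = pverts F" "P g"
    "\<And>u v. u \<in> pverts K \<Longrightarrow> v \<in> pverts K \<Longrightarrow> arc_rel K u v \<longleftrightarrow> arc_rel F (g u) (g v)"
    unfolding bij_betw_def by blast
  have KV: "u \<in> pverts K \<and> v \<in> pverts K" if "(u, v) \<in> parcs K" for u v
    using that K unfolding pair_wf_digraph_def by force
  let ?f = "\<lparr>iso_verts = g, iso_arcs = map_prod g g, iso_head = snd, iso_tail = fst\<rparr>"
  have "inj_on (map_prod g g) (parcs K)"
  proof (rule inj_onI)
    fix a b assume "a \<in> parcs K" "b \<in> parcs K" "map_prod g g a = map_prod g g b"
    moreover obtain u v u' v' where "a = (u, v)" "b = (u', v')" by fastforce
    ultimately show "a = b" using KV[of u v] KV[of u' v'] inj_onD[OF g(1)] by auto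
  qed
  then have "pre_digraph.digraph_isomorphism (with_proj K) ?f"
    using g(1) K wf_digraph_wp_iff[of K] unfolding pre_digraph.digraph_isomorphism_def by simp
  moreover have "parcs F = map_prod g g ` parcs K"
  proof
    show "map_prod g g ` parcs K \<subseteq> parcs F"
    proof
      fix e assume "e \<in> map_prod g g ` parcs K"
      then obtain u v where "(u, v) \<in> parcs K" "e = (g u, g v)" by auto
      then show "e \<in> parcs F" using g(4)[of u v] KV unfolding arc_rel_def by blast
    qed
    show "parcs F \<subseteq> map_prod g g ` parcs K"
    proof
      fix e assume e: "e \<in> parcs F"
      then have "fst e \<in> g ` pverts K" "snd e \<in> g ` pverts K" using F g(2) by auto
      then obtain u v where uv: "u \<in> pverts K" "v \<in> pverts K" "e = (g u, g v)" by (metis imageE prod.collapse)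
      then have "(u, v) \<in> parcs K" using g(4)[of u v] e unfolding arc_rel_def by blast
      then show "e \<in> map_prod g g ` parcs K" using uv(3) by (metis image_eqI map_prod_simp)
    qed
  qed
  then have "with_proj F = app_iso ?f (with_proj K)"
    using g(2) unfolding app_iso_def with_proj_def by simp
  ultimately show "\<exists>f. pre_digraph.digraph_isomorphism (with_proj K) f \<and> with_proj F = app_iso f (with_proj K) \<and> P (iso_verts f)"
    using g(3) by (intro exI[of _ ?f]) simp
qed

lemma induces_at_with_proj:
  assumes "S \<subseteq> pverts D" "b \<in> S" "parcs F \<subseteq> pverts F \<times> pverts F"
  shows "induces_at (with_proj D) S b (with_proj F) m \<longleftrightarrow>
    (\<exists>g. bij_betw g S (pverts F) \<and> (\<forall>u\<in>S. \<forall>v\<in>S. arc_rel D u v \<longleftrightarrow> arc_rel F (g u) (g v)) \<and> g b = m)"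
proof -
  have e: "arc_rel (pair_induce D S) u v \<longleftrightarrow> arc_rel D u v" if "u \<in> S" "v \<in> S" for u v
    using that unfolding arc_rel_def[of "pair_induce D S"] by simp
  show ?thesis
    unfolding induces_at_def induce_with_proj
      iso_with_proj[OF wf_pair_induce[of D S] assms(3), of "\<lambda>g. g b = m"]
    using assms(1,2) by (simp add: e cong: ball_cong)
qed

lemma induces_with_proj:
  assumes "S \<subseteq> pverts D" "parcs F \<subseteq> pverts F \<times> pverts F"
  shows "induces (with_proj D) S (with_proj F) \<longleftrightarrow>
    (\<exists>g. bij_betw g S (pverts F) \<and> (\<forall>u\<in>S. \<forall>v\<in>S. arc_rel D u v \<longleftrightarrow> arc_rel F (g u) (g v)))"
proof -
  have e: "arc_rel (pair_induce D S) u v \<longleftrightarrow> arc_rel D u v" if "u \<in> S" "v \<in> S" for u v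
    using that unfolding arc_rel_def[of "pair_induce D S"] by simp
  show ?thesis
    unfolding induces_def digraph_iso_def induce_with_proj
    using iso_with_proj[OF wf_pair_induce[of D S] assms(2), of "\<lambda>g. True"] assms(1) by (simp add: e cong: ball_cong)
qed

text \<open>Only the values of a bijection matter, and quantifiers over values in a concrete finite
  set can be expanded.\<close>

lemma ex_bij_betw_3:
  assumes "distinct [a, b, c]" "finite T" "card T = 3"
  shows "(\<exists>g. bij_betw g {a, b, c} T \<and> R (g a) (g b) (g c)) \<longleftrightarrow>
    (\<exists>i\<in>T. \<exists>j\<in>T. i \<noteq> j \<and> (\<exists>k\<in>T. k \<noteq> i \<and> k \<noteq> j \<and> R i j k))" (is "?l \<longleftrightarrow> ?r")
proof
  assume ?l
  then obtain g where g: "bij_betw g {a, b, c} T" "R (g a) (g b) (g c)" by blast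
  then have "g a \<in> T" "g b \<in> T" "g c \<in> T" "g a \<noteq> g b" "g c \<noteq> g a" "g c \<noteq> g b"
    using assms(1) by (auto simp: bij_betw_def)
  then show ?r using g(2) by blast
next
  assume ?r
  then obtain i j k where ijk: "i \<in> T" "j \<in> T" "k \<in> T" "distinct [i, j, k]" "R i j k" by auto
  have "{i, j, k} = T" by (rule card_subset_eq) (use assms ijk in auto)
  then have "bij_betw (\<lambda>x. if x = a then i else if x = b then j else k) {a, b, c} T"
    using assms(1) ijk(4) by (auto simp: bij_betw_def inj_on_def)
  then show ?l using ijk(5) assms(1) by (intro exI[of _ "\<lambda>x. if x = a then i else if x = b then j else k"]) auto
qed

lemma ex_bij_betw_4:
  assumes "distinct [a, b, c, d]" "finite T" "card T = 4"
  shows "(\<exists>g. bij_betw g {a, b, c, d} T \<and> R (g a) (g b) (g c) (g d)) \<longleftrightarrow>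
    (\<exists>i\<in>T. \<exists>j\<in>T. i \<noteq> j \<and> (\<exists>k\<in>T. k \<noteq> i \<and> k \<noteq> j \<and> (\<exists>l\<in>T. l \<noteq> i \<and> l \<noteq> j \<and> l \<noteq> k \<and> R i j k l)))" (is "?l \<longleftrightarrow> ?r")
proof
  assume ?l
  then obtain g where g: "bij_betw g {a, b, c, d} T" "R (g a) (g b) (g c) (g d)" by blast
  then have "g a \<in> T" "g b \<in> T" "g c \<in> T" "g d \<in> T" "g a \<noteq> g b" "g c \<noteq> g a" "g c \<noteq> g b" "g d \<noteq> g a" "g d \<noteq> g b" "g d \<noteq> g c"
    using assms(1) by (auto simp: bij_betw_def)
  then show ?r using g(2) by blast
next
  assume ?r
  then obtain i j k l where ijk: "i \<in> T" "j \<in> T" "k \<in> T" "l \<in> T" "distinct [i, j, k, l]" "R i j k l" by auto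
  have "{i, j, k, l} = T" by (rule card_subset_eq) (use assms ijk in auto)
  then have "bij_betw (\<lambda>x. if x = a then i else if x = b then j else if x = c then k else l) {a, b, c, d} T"
    using assms(1) ijk(5) by (auto simp: bij_betw_def inj_on_def)
  then show ?l using ijk(6) assms(1)
    by (intro exI[of _ "\<lambda>x. if x = a then i else if x = b then j else if x = c then k else l"]) auto
qed

lemma induces_P4_iff:
  assumes d: "distinct [a, b, c, d]" and V: "{a, b, c, d} \<subseteq> pverts D" and irr: "\<And>v. \<not> arc_rel D v v"
  shows "induces (symmetric_part (with_proj D)) {a, b, c, d} (with_proj P4) \<longleftrightarrow> P4on (sym_arc (arc_rel D)) a b c d"
proof -
  let ?S = "sym_arc (arc_rel D)"
  have S: "arc_rel (pair_sym D) = ?S" by (simp add: fun_eq_iff pair_sym_def)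
  have sy: "?S b a = ?S a b" "?S c a = ?S a c" "?S d a = ?S a d" "?S c b = ?S b c" "?S d b = ?S b d" "?S d c = ?S c d"
    and ir: "\<not> ?S v v" for v
    using irr by (auto simp: sym_arc_def)
  define R where "R i j k l \<longleftrightarrow> (?S a b \<longleftrightarrow> arc_rel P4 i j) \<and> (?S a b \<longleftrightarrow> arc_rel P4 j i) \<and> (?S a c \<longleftrightarrow> arc_rel P4 i k) \<and> (?S a c \<longleftrightarrow> arc_rel P4 k i) \<and>
    (?S a d \<longleftrightarrow> arc_rel P4 i l) \<and> (?S a d \<longleftrightarrow> arc_rel P4 l i) \<and> (?S b c \<longleftrightarrow> arc_rel P4 j k) \<and> (?S b c \<longleftrightarrow> arc_rel P4 k j) \<and>
    (?S b d \<longleftrightarrow> arc_rel P4 j l) \<and> (?S b d \<longleftrightarrow> arc_rel P4 l j) \<and> (?S c d \<longleftrightarrow> arc_rel P4 k l) \<and> (?S c d \<longleftrightarrow> arc_rel P4 l k)" for i j k l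
  have irP: "\<not> arc_rel P4 i i" for i by (auto simp: P4_def)
  have "(\<forall>u\<in>{a, b, c, d}. \<forall>v\<in>{a, b, c, d}. ?S u v \<longleftrightarrow> arc_rel P4 (g u) (g v)) \<longleftrightarrow> R (g a) (g b) (g c) (g d)" for g
    unfolding R_def by (simp add: sy ir irP) satx
  moreover have "pverts P4 = {0, 1, 2, 3}" "parcs P4 \<subseteq> pverts P4 \<times> pverts P4" by (auto simp: P4_def)
  moreover have "{a, b, c, d} \<subseteq> pverts (pair_sym D)" using V by (simp add: pair_sym_def)
  ultimately have "induces (symmetric_part (with_proj D)) {a, b, c, d} (with_proj P4) \<longleftrightarrow>
      (\<exists>g. bij_betw g {a, b, c, d} {0, 1, 2, 3} \<and> R (g a) (g b) (g c) (g d))"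
    unfolding symmetric_part_with_proj by (simp only: induces_with_proj S)
  also have "\<dots> \<longleftrightarrow> P4on ?S a b c d"
    by (subst ex_bij_betw_4[OF d])
      (simp_all add: R_def P4_def P4on_def p4b_def, satx)
  finally show ?thesis .
qed

lemma triple_iff:
  fixes R :: "nat \<Rightarrow> nat \<Rightarrow> nat \<Rightarrow> bool"
  shows "(\<exists>i\<in>{0, 1, 2}. \<exists>j\<in>{0, 1, 2}. i \<noteq> j \<and> (\<exists>k\<in>{0, 1, 2}. k \<noteq> i \<and> k \<noteq> j \<and> R i j k)) \<longleftrightarrow>
    R 0 1 2 \<or> R 0 2 1 \<or> R 1 0 2 \<or> R 1 2 0 \<or> R 2 0 1 \<or> R 2 1 0"
  by simp

lemma triple_arcs_iff:
  assumes "\<And>v. \<not> A v v" "\<And>v. \<not> B v v"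
  shows "(\<forall>u\<in>{a, b, c}. \<forall>v\<in>{a, b, c}. A u v \<longleftrightarrow> B (g u) (g v)) \<longleftrightarrow>
    (A a b \<longleftrightarrow> B (g a) (g b)) \<and> (A b a \<longleftrightarrow> B (g b) (g a)) \<and> (A a c \<longleftrightarrow> B (g a) (g c)) \<and>
    (A c a \<longleftrightarrow> B (g c) (g a)) \<and> (A b c \<longleftrightarrow> B (g b) (g c)) \<and> (A c b \<longleftrightarrow> B (g c) (g b))"
  by (simp add: assms) satx

lemma induces_triple_iff:
  assumes d: "distinct [a, b, c]" and V: "{a, b, c} \<subseteq> pverts D" and irr: "\<And>v. \<not> arc_rel D v v"
  shows induces_C3_iff: "induces (with_proj D) {a, b, c} (with_proj dir_C3) \<longleftrightarrow> ind_C3 (arc_rel D) a b c"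
    and induces_P3_iff: "induces_at (with_proj D) {a, b, c} b (with_proj dir_P3) 1 \<longleftrightarrow> ind_P3 (arc_rel D) a b c"
    and induces_P3_pm_iff: "induces_P3_pm_at (with_proj D) {a, b, c} b \<longleftrightarrow> ind_P3pm (arc_rel D) a b c"
proof -
  let ?A = "arc_rel D"
  define R where "R F i j k \<longleftrightarrow> (?A a b \<longleftrightarrow> arc_rel F i j) \<and> (?A b a \<longleftrightarrow> arc_rel F j i) \<and> (?A a c \<longleftrightarrow> arc_rel F i k) \<and>
    (?A c a \<longleftrightarrow> arc_rel F k i) \<and> (?A b c \<longleftrightarrow> arc_rel F j k) \<and> (?A c b \<longleftrightarrow> arc_rel F k j)" for F and i j k :: nat
  have 1: "induces (with_proj D) {a, b, c} (with_proj F) \<longleftrightarrow>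
      R F 0 1 2 \<or> R F 0 2 1 \<or> R F 1 0 2 \<or> R F 1 2 0 \<or> R F 2 0 1 \<or> R F 2 1 0"
    if "pverts F = {0, 1, 2}" "parcs F \<subseteq> pverts F \<times> pverts F" "\<And>i. \<not> arc_rel F i i" for F
  proof -
    have "induces (with_proj D) {a, b, c} (with_proj F) \<longleftrightarrow> (\<exists>g. bij_betw g {a, b, c} {0, 1, 2} \<and> R F (g a) (g b) (g c))"
      by (simp only: induces_with_proj[OF V that(2)] that(1) triple_arcs_iff[of ?A "arc_rel F", OF irr that(3)] R_def)
    also have "\<dots> \<longleftrightarrow> R F 0 1 2 \<or> R F 0 2 1 \<or> R F 1 0 2 \<or> R F 1 2 0 \<or> R F 2 0 1 \<or> R F 2 1 0"
      by (subst ex_bij_betw_3[OF d]) (simp_all only: triple_iff, simp_all)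
    finally show ?thesis .
  qed
  have 2: "induces_at (with_proj D) {a, b, c} b (with_proj F) 1 \<longleftrightarrow> R F 0 1 2 \<or> R F 2 1 0"
    if "pverts F = {0, 1, 2}" "parcs F \<subseteq> pverts F \<times> pverts F" "\<And>i. \<not> arc_rel F i i" for F
  proof -
    have "induces_at (with_proj D) {a, b, c} b (with_proj F) 1 \<longleftrightarrow>
        (\<exists>g. bij_betw g {a, b, c} {0, 1, 2} \<and> R F (g a) (g b) (g c) \<and> g b = 1)"
      by (simp only: induces_at_with_proj[OF V _ that(2)] insertI1 insertI2 that(1) triple_arcs_iff[of ?A "arc_rel F", OF irr that(3)] R_def conj_assoc)
    also have "\<dots> \<longleftrightarrow> R F 0 1 2 \<or> R F 2 1 0"
      by (subst ex_bij_betw_3[where R = "\<lambda>i j k. R F i j k \<and> j = 1", OF d]) (simp_all only: triple_iff, simp_all)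
    finally show ?thesis .
  qed
  show "induces (with_proj D) {a, b, c} (with_proj dir_C3) \<longleftrightarrow> ind_C3 (arc_rel D) a b c"
    by (subst 1) (auto simp: R_def dir_C3_def ind_C3_def single_arc_def)
  show "induces_at (with_proj D) {a, b, c} b (with_proj dir_P3) 1 \<longleftrightarrow> ind_P3 (arc_rel D) a b c"
    by (subst 2) (auto simp: R_def dir_P3_def ind_P3_def single_arc_def)
  have p: "induces_at (with_proj D) {a, b, c} b (with_proj dir_P3_plus) 1 \<longleftrightarrow> R dir_P3_plus 0 1 2 \<or> R dir_P3_plus 2 1 0"
    by (rule 2) (auto simp: dir_P3_plus_def)
  have m: "induces_at (with_proj D) {a, b, c} b (with_proj dir_P3_minus) 1 \<longleftrightarrow> R dir_P3_minus 0 1 2 \<or> R dir_P3_minus 2 1 0"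
    by (rule 2) (auto simp: dir_P3_minus_def)
  show "induces_P3_pm_at (with_proj D) {a, b, c} b \<longleftrightarrow> ind_P3pm (arc_rel D) a b c"
    unfolding induces_P3_pm_at_def p m
    by (auto simp: R_def dir_P3_plus_def dir_P3_minus_def
        ind_P3pm_def single_arc_def sym_arc_def)
qed

lemma P4C_isomorphicD:
  assumes P: "P4C_isomorphic (with_proj D) (with_proj D')" and V: "pverts D = pverts D'"
    and irr: "\<And>v. \<not> arc_rel D v v" "\<And>v. \<not> arc_rel D' v v"
  shows "p4iso (sym_arc (arc_rel D)) (sym_arc (arc_rel D')) (pverts D)"
    and "\<And>a b c. a \<in> pverts D \<Longrightarrow> b \<in> pverts D \<Longrightarrow> c \<in> pverts D \<Longrightarrow> distinct [a, b, c] \<Longrightarrow>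
      ind_C3 (arc_rel D) a b c \<longleftrightarrow> ind_C3 (arc_rel D') a b c"
    and "\<And>a b c. a \<in> pverts D \<Longrightarrow> b \<in> pverts D \<Longrightarrow> c \<in> pverts D \<Longrightarrow> distinct [a, b, c] \<Longrightarrow>
      ind_P3 (arc_rel D) a b c \<longleftrightarrow> ind_P3 (arc_rel D') a b c"
    and "\<And>a b c. a \<in> pverts D \<Longrightarrow> b \<in> pverts D \<Longrightarrow> c \<in> pverts D \<Longrightarrow> distinct [a, b, c] \<Longrightarrow>
      ind_P3pm (arc_rel D) a b c \<longleftrightarrow> ind_P3pm (arc_rel D') a b c"
proof -
  note P' = P[unfolded P4C_isomorphic_def with_proj_simps]
  show "p4iso (sym_arc (arc_rel D)) (sym_arc (arc_rel D')) (pverts D)"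
    unfolding p4iso_def
  proof (intro ballI impI)
    fix a b c d assume a: "a \<in> pverts D" "b \<in> pverts D" "c \<in> pverts D" "d \<in> pverts D" and d: "distinct [a, b, c, d]"
    have "{a, b, c, d} \<subseteq> pverts D" "{a, b, c, d} \<subseteq> pverts D'" using a V by auto
    then show "P4on (sym_arc (arc_rel D)) a b c d \<longleftrightarrow> P4on (sym_arc (arc_rel D')) a b c d"
      using conjunct1[OF P'] a induces_P4_iff[OF d _ irr(1)] induces_P4_iff[OF d _ irr(2)] by simp
  qed
  fix a b c assume a: "a \<in> pverts D" "b \<in> pverts D" "c \<in> pverts D" and d: "distinct [a, b, c]"
  then have S: "{a, b, c} \<subseteq> pverts D" "{a, b, c} \<subseteq> pverts D'" using V by auto
  show "ind_C3 (arc_rel D) a b c \<longleftrightarrow> ind_C3 (arc_rel D') a b c"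
    using P' a by (simp add: induces_C3_iff[OF d S(1) irr(1), symmetric] induces_C3_iff[OF d S(2) irr(2), symmetric])
  show "ind_P3 (arc_rel D) a b c \<longleftrightarrow> ind_P3 (arc_rel D') a b c"
    using P' a by (simp add: induces_P3_iff[OF d S(1) irr(1), symmetric] induces_P3_iff[OF d S(2) irr(2), symmetric])
  show "ind_P3pm (arc_rel D) a b c \<longleftrightarrow> ind_P3pm (arc_rel D') a b c"
    using P' a by (simp add: induces_P3_pm_iff[OF d S(1) irr(1), symmetric] induces_P3_pm_iff[OF d S(2) irr(2), symmetric])
qed

subsection \<open>Perfect digraphs\<close>

lemma pcas_imp_successively:
  "pcas u p v \<Longrightarrow> set p \<subseteq> parcs D \<Longrightarrow> p \<noteq> [] \<Longrightarrow>
   hd (map fst p) = u \<and> successively (arc_rel D) (map fst p) \<and> arc_rel D (last (map fst p)) v"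
proof (induction p arbitrary: u)
  case (Cons e p)
  obtain x y where e: "e = (x, y)" by fastforce
  show ?case
  proof (cases p)
    case Nil
    then show ?thesis using Cons.prems e by (auto simp: arc_rel_def)
  next
    case (Cons e' p')
    then have "hd (map fst p) = y \<and> successively (arc_rel D) (map fst p) \<and> arc_rel D (last (map fst p)) v"
      using Cons.IH[of y] Cons.prems e by simp
    then show ?thesis using Cons Cons.prems e by (auto simp: arc_rel_def)
  qed
qed simp

lemma successively_imp_pcas:
  "successively (arc_rel D) (x # xs) \<Longrightarrow> arc_rel D (last (x # xs)) v \<Longrightarrow>
   \<exists>p. p \<noteq> [] \<and> pcas x p v \<and> set p \<subseteq> parcs D"
proof (induction xs arbitrary: x)
  case Nil
  then show ?case by (intro exI[of _ "[(x, v)]"]) (simp add: arc_rel_def)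
next
  case (Cons y ys)
  then obtain p where "p \<noteq> []" "pcas y p v" "set p \<subseteq> parcs D" by auto
  then show ?case using Cons.prems by (intro exI[of _ "(x, y) # p"]) (simp add: arc_rel_def)
qed

lemma successively_induce:
  assumes "set ys \<subseteq> C"
  shows "successively (arc_rel (pair_induce D C)) ys \<longleftrightarrow> successively (arc_rel D) ys"
  using assms unfolding successively_conv_nth arc_rel_def[of "pair_induce D C"] by (auto simp: subset_iff)

text \<open>Passing from arcs to their initial vertices gives a closed walk; conversely a closed
  walk contains a cycle.\<close>

lemma cycle_iff_closed_list:
  "(\<exists>p. pre_digraph.cycle (with_proj (pair_induce D C)) p) \<longleftrightarrow> (\<exists>ys. closed_list (arc_rel D) C ys)"
proof
  let ?K = "pair_induce D C"
  assume "\<exists>p. pre_digraph.cycle (with_proj ?K) p"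
  then obtain p u where p: "pcas u p u" "set p \<subseteq> parcs ?K" "p \<noteq> []"
    unfolding pre_digraph.cycle_def pre_digraph.awalk_def by (auto simp: cas_with_proj_eq)
  have "set (map fst p) \<subseteq> C" using p(2) by (force simp: pair_induce_def)
  moreover have "set p \<subseteq> parcs D" using p(2) by (auto simp: pair_induce_def)
  ultimately have "closed_list (arc_rel D) C (map fst p)"
    using pcas_imp_successively[OF p(1) _ p(3)] p(3) unfolding closed_list_def by simp
  then show "\<exists>ys. closed_list (arc_rel D) C ys" by blast
next
  let ?K = "pair_induce D C"
  assume "\<exists>ys. closed_list (arc_rel D) C ys"
  then obtain ys where ys: "closed_list (arc_rel D) C ys" by blast
  then obtain x xs where x: "ys = x # xs" unfolding closed_list_def by (cases ys) auto
  have C: "set ys \<subseteq> C" and l: "last ys \<in> C" "x \<in> C" using ys x unfolding closed_list_def by (auto simp: subset_iff)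
  have "arc_rel ?K (last ys) x"
    using ys x l unfolding closed_list_def arc_rel_def[of ?K] by simp
  moreover have "successively (arc_rel ?K) ys"
    using ys successively_induce[OF C] unfolding closed_list_def by simp
  ultimately obtain p where p: "p \<noteq> []" "pcas x p x" "set p \<subseteq> parcs ?K"
    using successively_imp_pcas[of ?K x xs x] x by auto
  interpret pair_wf_digraph ?K by (rule wf_pair_induce)
  have "closed_w p" unfolding closed_w_def awalk_def using p l(2) by auto
  then show "\<exists>p. pre_digraph.cycle (with_proj ?K) p" by (rule closed_w_imp_cycle)
qed

lemma proper_coloring_iff:
  "proper_coloring (with_proj (pair_induce D W)) k c \<longleftrightarrow>
    (\<forall>v\<in>W. c v \<in> {1..k}) \<and> (\<forall>i\<in>{1..k}. \<nexists>ys. closed_list (arc_rel D) {v \<in> W. c v = i} ys)"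
proof -
  have e: "pair_induce (pair_induce D W) C = pair_induce D C" if "C \<subseteq> W" for C
    using that by (auto simp: pair_induce_def)
  have "pair_induce (pair_induce D W) {v \<in> W. c v = i} = pair_induce D {v \<in> W. c v = i}" for i by (rule e) auto
  then show ?thesis
    unfolding proper_coloring_def induce_with_proj with_proj_simps pair_induce_simps
    by (simp add: cycle_iff_closed_list)
qed

text \<open>Only the vertex set of a clique counts: conversely, a set of pairwise symmetrically
  joined vertices is a clique through the subgraph it induces.\<close>

lemma clique_number_eq_omega:
  "clique_number (with_proj (pair_induce D W)) = omega (sym_arc (arc_rel D)) W"
proof -
  let ?K = "pair_induce D W"
  interpret pair_wf_digraph ?K by (rule wf_pair_induce)
  have "{card (verts H) |H. clique H (with_proj ?K)} = card ` {C. C \<subseteq> W \<and> clq (sym_arc (arc_rel D)) C}"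
  proof (intro equalityI subsetI)
    fix m assume "m \<in> {card (verts H) |H. clique H (with_proj ?K)}"
    then obtain H where H: "subgraph H (with_proj ?K)" "m = card (verts H)"
      "\<And>v w. v \<in> verts H \<Longrightarrow> w \<in> verts H \<Longrightarrow> v \<noteq> w \<Longrightarrow> v \<rightarrow>\<^bsub>H\<^esub> w \<and> w \<rightarrow>\<^bsub>H\<^esub> v"
      unfolding clique_def by blast
    have "verts H \<subseteq> W" using H(1) by (auto simp: subgraph_def)
    moreover have "arcs_ends H \<subseteq> parcs ?K"
      using arcs_ends_mono[OF H(1)] by simp
    then have "clq (sym_arc (arc_rel D)) (verts H)"
      using H(3) unfolding clq_def sym_arc_def by (metis pair_induce_simps(2) subsetD)
    ultimately show "m \<in> card ` {C. C \<subseteq> W \<and> clq (sym_arc (arc_rel D)) C}" using H(2) by blast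
  next
    fix m assume "m \<in> card ` {C. C \<subseteq> W \<and> clq (sym_arc (arc_rel D)) C}"
    then obtain C where C: "C \<subseteq> W" "clq (sym_arc (arc_rel D)) C" "m = card C" by blast
    have "subgraph (with_proj ?K \<restriction> C) (with_proj ?K)"
      using induced_induce[of C] C(1) by (simp add: induced_subgraph_def)
    moreover have "v \<rightarrow>\<^bsub>with_proj ?K \<restriction> C\<^esub> w \<and> w \<rightarrow>\<^bsub>with_proj ?K \<restriction> C\<^esub> v" if "v \<in> C" "w \<in> C" "v \<noteq> w" for v w
      unfolding induce_with_proj with_proj_simps pair_induce_simps arc_rel_def[of ?K]
      using that C unfolding clq_def sym_arc_def by auto
    ultimately have "clique (with_proj ?K \<restriction> C) (with_proj ?K)" unfolding clique_def by simp
    moreover have "m = card (verts (with_proj ?K \<restriction> C))" using C(3) by simp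
    ultimately show "m \<in> {card (verts H) |H. clique H (with_proj ?K)}" by blast
  qed
  then show ?thesis unfolding clique_number_def omega_def by simp
qed

lemma closed_list_two_cycle:
  assumes "sym_arc A u v" "u \<in> C" "v \<in> C" shows "closed_list A C [u, v]"
  using assms by (simp add: closed_list_def sym_arc_def)

text \<open>Two vertices of a clique form a closed walk and need different colours, so
  \<open>omega\<close> is always a lower bound, and equality means that it is attained.\<close>

lemma dichromatic_eq_omega_iff:
  assumes W: "finite W" and irr: "\<And>v. \<not> arc_rel D v v"
  shows "dichromatic_number (with_proj (pair_induce D W)) = omega (sym_arc (arc_rel D)) W \<longleftrightarrow>
    (\<exists>c. proper_coloring (with_proj (pair_induce D W)) (omega (sym_arc (arc_rel D)) W) c)"
proof
  let ?K = "with_proj (pair_induce D W)" and ?o = "omega (sym_arc (arc_rel D)) W"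
  assume eq: "dichromatic_number ?K = ?o"
  \<comment> \<open>One colour per vertex shows that some proper colouring exists; otherwise the
    value of \<open>LEAST\<close> would carry no information.\<close>
  obtain g where g: "bij_betw g W {1..card W}" using ex_bij_betw_finite_nat[OF W] W
    by (metis bij_betw_iff_card card_atLeastAtMost diff_Suc_1 finite_atLeastAtMost)
  have "\<not> closed_list (arc_rel D) {v \<in> W. g v = i} ys" for i ys
  proof
    assume ys: "closed_list (arc_rel D) {v \<in> W. g v = i} ys"
    then have "ys \<noteq> []" "set ys \<subseteq> {v \<in> W. g v = i}" by (auto simp: closed_list_def)
    then have "last ys \<in> {v \<in> W. g v = i}" "hd ys \<in> {v \<in> W. g v = i}" by (meson hd_in_set last_in_set subsetD)+
    then have "last ys = hd ys" using g by (auto simp: bij_betw_def inj_on_def)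
    then show False using ys irr unfolding closed_list_def by metis
  qed
  moreover have "g v \<in> {1..card W}" if "v \<in> W" for v using g that by (auto simp: bij_betw_def)
  ultimately have "proper_coloring ?K (card W) g" unfolding proper_coloring_iff by blast
  then have "\<exists>c. proper_coloring ?K (dichromatic_number ?K) c"
    unfolding dichromatic_number_def by (intro LeastI[of "\<lambda>k. \<exists>c. proper_coloring ?K k c"]) blast
  then show "\<exists>c. proper_coloring ?K ?o c" unfolding eq .
next
  let ?K = "with_proj (pair_induce D W)" and ?o = "omega (sym_arc (arc_rel D)) W"
  assume ex: "\<exists>c. proper_coloring ?K ?o c"
  show "dichromatic_number ?K = ?o"
    unfolding dichromatic_number_def
  proof (rule Least_equality)
    show "\<exists>c. proper_coloring ?K ?o c" by (rule ex)
    fix k assume "\<exists>c. proper_coloring ?K k c"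
    then obtain c where c: "\<And>v. v \<in> W \<Longrightarrow> c v \<in> {1..k}"
      "\<And>i ys. i \<in> {1..k} \<Longrightarrow> \<not> closed_list (arc_rel D) {v \<in> W. c v = i} ys"
      unfolding proper_coloring_iff by blast
    obtain C where C: "C \<subseteq> W" "clq (sym_arc (arc_rel D)) C" "card C = ?o" using omega_witness[OF W] .
    have "inj_on c C"
    proof (rule inj_onI, rule ccontr)
      fix u v assume uv: "u \<in> C" "v \<in> C" "c u = c v" "u \<noteq> v"
      then have "closed_list (arc_rel D) {x \<in> W. c x = c u} [u, v]"
        using C(1,2) by (intro closed_list_two_cycle) (auto simp: clq_def)
      moreover have "c u \<in> {1..k}" using c(1) C(1) uv(1) by blast
      ultimately show False using c(2) by blast
    qed
    moreover have "c ` C \<subseteq> {1..k}" using c(1) C(1) by blast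
    ultimately have "card C \<le> card {1..k}" by (intro card_inj_on_le) auto
    then show "?o \<le> k" using C(3) by simp
  qed
qed

lemma dicycle_imp_closed_list:
  assumes "dicycle A ys" shows "closed_list A (set ys) ys"
proof -
  have ys: "3 \<le> length ys" and
    A: "\<And>i j. i < length ys \<Longrightarrow> j < length ys \<Longrightarrow> A (ys ! i) (ys ! j) \<longleftrightarrow> j = Suc i \<or> Suc i = length ys \<and> j = 0"
    using assms unfolding dicycle_def by blast+
  have "ys \<noteq> []" using ys by auto
  moreover have "A (last ys) (hd ys)"
    using \<open>ys \<noteq> []\<close> A[of "length ys - 1" 0] by (simp add: last_conv_nth hd_conv_nth)
  moreover have "successively A ys" unfolding successively_conv_nth using A by auto
  ultimately show ?thesis by (simp add: closed_list_def)
qed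

lemma dicycle_stab_sym_arc:
  assumes "dicycle A ys" shows "stab (sym_arc A) (set ys)"
  unfolding stab_def
proof (intro ballI notI)
  fix x y assume "x \<in> set ys" "y \<in> set ys" and s: "sym_arc A x y"
  then obtain i j where ij: "i < length ys" "j < length ys" "x = ys ! i" "y = ys ! j" by (metis in_set_conv_nth)
  have "3 \<le> length ys" "j = Suc i \<or> Suc i = length ys \<and> j = 0" "i = Suc j \<or> Suc j = length ys \<and> i = 0"
    using assms ij s unfolding dicycle_def sym_arc_def by blast+
  then show False by linarith
qed

theorem perfect_iff_perf_sym_arc:
  assumes D: "pair_digraph D"
  shows "perfect (with_proj D) \<longleftrightarrow>
    perf (sym_arc (arc_rel D)) (pverts D) \<and> (\<nexists>ys. dicycle (arc_rel D) ys \<and> set ys \<subseteq> pverts D)"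
proof -
  let ?A = "arc_rel D" and ?S = "sym_arc (arc_rel D)" and ?V = "pverts D"
  interpret pair_digraph D by (rule D)
  have irr: "\<not> ?A v v" for v using pair_no_loops[of "(v, v)"] by (auto simp: arc_rel_def)
  have fin: "finite W" if "W \<subseteq> ?V" for W using that pair_finite_verts by (rule finite_subset)
  have "perfect (with_proj D) \<longleftrightarrow> (\<forall>W\<subseteq>?V. dichromatic_number (with_proj D \<restriction> W) = clique_number (with_proj D \<restriction> W))"
    unfolding perfect_def
  proof (intro iffI allI impI)
    fix W assume "\<forall>H. induced_subgraph H (with_proj D) \<longrightarrow> dichromatic_number H = clique_number H" "W \<subseteq> ?V"
    then show "dichromatic_number (with_proj D \<restriction> W) = clique_number (with_proj D \<restriction> W)"
      using induced_induce[of W] by simp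
  next
    fix H assume *: "\<forall>W\<subseteq>?V. dichromatic_number (with_proj D \<restriction> W) = clique_number (with_proj D \<restriction> W)"
      "induced_subgraph H (with_proj D)"
    then have "with_proj D \<restriction> verts H = H" "verts H \<subseteq> ?V"
      using induce_eq_iff_induced by (auto simp: induced_subgraph_def subgraph_def)
    then show "dichromatic_number H = clique_number H" using * by metis
  qed
  also have "\<dots> \<longleftrightarrow> (\<forall>W\<subseteq>?V. \<exists>c. proper_coloring (with_proj (pair_induce D W)) (omega ?S W) c)"
    unfolding induce_with_proj clique_number_eq_omega using dichromatic_eq_omega_iff[OF fin irr] by simp
  also have "\<dots> \<longleftrightarrow> perf ?S ?V \<and> (\<nexists>ys. dicycle ?A ys \<and> set ys \<subseteq> ?V)"
  proof (intro iffI conjI)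
    assume *: "\<forall>W\<subseteq>?V. \<exists>c. proper_coloring (with_proj (pair_induce D W)) (omega ?S W) c"
    show "perf ?S ?V"
      unfolding perf_def colorable_def
    proof (intro allI impI)
      fix W assume "W \<subseteq> ?V"
      then obtain c where c: "\<And>v. v \<in> W \<Longrightarrow> c v \<in> {1..omega ?S W}"
        "\<And>i ys. i \<in> {1..omega ?S W} \<Longrightarrow> \<not> closed_list ?A {v \<in> W. c v = i} ys"
        using * unfolding proper_coloring_iff by meson
      \<comment> \<open>Colours of digraphs start at 1 and those of graphs at 0. The truncated
        subtraction is injective on colours because these are positive.\<close>
      have "c u - 1 \<noteq> c v - 1" if uv: "u \<in> W" "v \<in> W" "?S u v" for u v
      proof
        assume "c u - 1 = c v - 1"
        then have "c u = c v" using c(1)[OF uv(1)] c(1)[OF uv(2)] by auto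
        then have "closed_list ?A {x \<in> W. c x = c u} [u, v]"
          using uv by (intro closed_list_two_cycle) auto
        then show False using c(2)[OF c(1)[OF uv(1)]] by blast
      qed
      moreover have "c u - 1 < omega ?S W" if "u \<in> W" for u using c(1)[OF that] by auto
      ultimately show "\<exists>c::'a \<Rightarrow> nat. (\<forall>x\<in>W. c x < omega ?S W) \<and> (\<forall>x\<in>W. \<forall>y\<in>W. ?S x y \<longrightarrow> c x \<noteq> c y)"
        by (intro exI[of _ "\<lambda>u. c u - 1"]) blast
    qed
    show "\<nexists>ys. dicycle ?A ys \<and> set ys \<subseteq> ?V"
    proof
      assume "\<exists>ys. dicycle ?A ys \<and> set ys \<subseteq> ?V"
      then obtain ys where ys: "dicycle ?A ys" "set ys \<subseteq> ?V" by blast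
      let ?W = "set ys"
      have "omega ?S ?W \<le> 1"
        unfolding omega_le_iff[OF finite_set]
      proof (intro allI impI)
        fix K assume K: "K \<subseteq> ?W" "clq ?S K"
        then have "\<forall>x\<in>K. \<forall>y\<in>K. x = y"
          using dicycle_stab_sym_arc[OF ys(1)] unfolding clq_def stab_def by blast
        then show "card K \<le> 1" by (metis card_le_Suc0_iff_eq One_nat_def K(1) finite_set finite_subset)
      qed
      moreover obtain c where c: "\<And>v. v \<in> ?W \<Longrightarrow> c v \<in> {1..omega ?S ?W}"
        "\<And>i ys. i \<in> {1..omega ?S ?W} \<Longrightarrow> \<not> closed_list ?A {v \<in> ?W. c v = i} ys"
        using * ys(2) unfolding proper_coloring_iff by meson
      ultimately have c1: "c v = 1" if "v \<in> ?W" for v using c(1)[OF that] by auto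
      have "hd ys \<in> ?W" using ys(1) unfolding dicycle_def by (cases ys) auto
      then have "1 \<in> {1..omega ?S ?W}" using c(1) c1 by force
      moreover have "{v \<in> ?W. c v = 1} = ?W" using c1 by auto
      ultimately show False using c(2)[of 1 ys] dicycle_imp_closed_list[OF ys(1)] by simp
    qed
  next
    assume *: "perf ?S ?V \<and> (\<nexists>ys. dicycle ?A ys \<and> set ys \<subseteq> ?V)"
    show "\<forall>W\<subseteq>?V. \<exists>c. proper_coloring (with_proj (pair_induce D W)) (omega ?S W) c"
    proof (intro allI impI)
      fix W assume W: "W \<subseteq> ?V"
      then obtain f :: "'a \<Rightarrow> nat" where f: "\<And>x. x \<in> W \<Longrightarrow> f x < omega ?S W"
        "\<And>x y. x \<in> W \<Longrightarrow> y \<in> W \<Longrightarrow> ?S x y \<Longrightarrow> f x \<noteq> f y"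
        using * unfolding perf_def colorable_def by meson
      have "\<not> closed_list ?A {v \<in> W. Suc (f v) = i} ys" for i ys
      proof
        assume cl: "closed_list ?A {v \<in> W. Suc (f v) = i} ys"
        have st: "stab ?S {v \<in> W. Suc (f v) = i}"
          unfolding stab_def
        proof (intro ballI notI)
          fix x y assume "x \<in> {v \<in> W. Suc (f v) = i}" "y \<in> {v \<in> W. Suc (f v) = i}" "?S x y"
          then show False using f(2)[of x y] by simp
        qed
        obtain zs where "dicycle ?A zs" "set zs \<subseteq> {v \<in> W. Suc (f v) = i}"
          using closed_list_imp_dicycle[OF cl st irr] .
        then show False using * W by blast
      qed
      moreover have "Suc (f v) \<in> {1..omega ?S W}" if "v \<in> W" for v using f(1)[OF that] by auto
      ultimately show "\<exists>c. proper_coloring (with_proj (pair_induce D W)) (omega ?S W) c"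
        unfolding proper_coloring_iff by (intro exI[of _ "\<lambda>v. Suc (f v)"]) blast
    qed
  qed
  finally show ?thesis .
qed

theorem theorem5:
  fixes D D' :: "'a pair_pre_digraph"
  assumes "pair_digraph D" and "pair_digraph D'"
    and "pverts D = pverts D'"
    and "P4C_isomorphic (with_proj D) (with_proj D')"
  shows "perfect (with_proj D) \<longleftrightarrow> perfect (with_proj D')"
proof -
  let ?A = "arc_rel D" and ?B = "arc_rel D'" and ?V = "pverts D"
  interpret D: pair_digraph D by fact
  interpret D': pair_digraph D' by fact
  have irr: "\<not> ?A v v" "\<not> ?B v v" for v
    using D.pair_no_loops[of "(v, v)"] D'.pair_no_loops[of "(v, v)"] by (auto simp: arc_rel_def)
  note iso = P4C_isomorphicD[OF assms(4,3) irr]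
  have "perf (sym_arc ?A) ?V \<longleftrightarrow> perf (sym_arc ?B) ?V"
    by (rule semi_strong_perfect_graph_theorem[OF ugraph_sym_arc[OF irr(1)] ugraph_sym_arc[OF irr(2)] D.pair_finite_verts iso(1)])
  moreover have "(\<exists>ys. dicycle ?A ys \<and> set ys \<subseteq> ?V) \<longleftrightarrow> (\<exists>ys. dicycle ?B ys \<and> set ys \<subseteq> ?V)"
  proof
    assume "\<exists>ys. dicycle ?A ys \<and> set ys \<subseteq> ?V"
    then obtain ys where ys: "dicycle ?A ys" "set ys \<subseteq> ?V" by blast
    show "\<exists>ys. dicycle ?B ys \<and> set ys \<subseteq> ?V"
      by (rule dicycle_transfer[where B = ?A and V = ?V, OF irr(2) _ _ _ ys]) (use iso(2-4) in auto)
  next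
    assume "\<exists>ys. dicycle ?B ys \<and> set ys \<subseteq> ?V"
    then obtain ys where ys: "dicycle ?B ys" "set ys \<subseteq> ?V" by blast
    show "\<exists>ys. dicycle ?A ys \<and> set ys \<subseteq> ?V"
      by (rule dicycle_transfer[where B = ?B and V = ?V, OF irr(1) _ _ _ ys]) (use iso(2-4) in auto)
  qed
  ultimately show ?thesis
    unfolding perfect_iff_perf_sym_arc[OF assms(1)] perfect_iff_perf_sym_arc[OF assms(2)] assms(3)[symmetric] by blast
qed

end
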